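(* Let $G$ be a graph and $T\subseteq V(G)$ with $|T|$ even, given together with a nice ear-decomposition of $G$ that contains a maximum earmuff for the eardrum $M$ associated with it and $T$. Let $\pi$ be the number of pendant ears of this ear-decomposition. Then a connected-$T$-join of $G$ of cardinality at most $L_\mu(G,M)+\frac{1}{2}L_\varphi(G)-\pi$ can be constructed in $O(|V(G)|^3)$ time.
   Context: All graphs are finite, undirected, may have parallel edges but no loops; $2G$ is $G$ with every edge doubled. For $T\subseteq V(G)$, $|T|$ even, a $T$-join in $G$ is $F\subseteq E(G)$ such that $T$ is exactly the set of vertices incident to an odd number of edges of $F$; a connected-$T$-join of $G$ is a $T$-join $F$ in $2G$ with $(V(G),F)$ connected. Ear-decompositions: an ear-decomposition of $G$ is a sequence $P_0,P_1,\dots,P_k$ of subgraphs of $G$ whose vertex sets cover $V(G)$ and whose edge sets partition $E(G)$, where $P_0$ is a single vertex without edges and each ear $P_i$ ($i\ge1$) is either a circuit sharing exactly one vertex with $V(P_0)\cup\dots\cup V(P_{i-1})$ or a path sharing exactly its two distinct endpoints with $V(P_0)\cup\dots\cup V(P_{i-1})$. The vertices of $P_i$ in $V(P_0)\cup\dots\cup V(P_{i-1})$ are its endpoints, the others its internal vertices, forming the set $\mathrm{inn}(P_i)$. The length of an ear is its number of edges; an $l$-ear has length $l$; an ear is nontrivial if its length exceeds 1, even if its length is even, and short if it is a 2-ear or 3-ear. An ear $P$ is attached to an ear $Q$ if an endpoint of $P$ lies in $\mathrm{inn}(Q)$; an ear is pendant if it is nontrivial and no nontrivial ear is attached to it. A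 graph has an ear-decomposition iff it is 2-edge-connected; for such $G$, $\varphi(G)$ is the minimum number of even ears over all ear-decompositions of $G$, and $L_\varphi(G)=|V(G)|+\varphi(G)-1$. An ear-decomposition is nice if (i) it has exactly $\varphi(G)$ even ears, (ii) all short ears are pendant, and (iii) no edge of $G$ joins internal vertices of two different short ears. Given a nice ear-decomposition and $T$, an ear $P$ is clean if it is short and $\mathrm{inn}(P)\cap T=\emptyset$; the eardrum associated with the ear-decomposition and $T$ is the set $M$ of vertex sets of the connected components of the subgraph of $G$ induced by the union of the internal vertex sets of the clean ears. An eardrum in $G$ is the set $M$ of vertex sets of connected components of an induced subgraph of $G$ in which every vertex has degree at most 1; $V_M=\bigcup M$. For $f\in M$, $\mathcal{P}_f$ is the set of paths $P$ in $G$ with $\mathrm{inn}(P)=f$ (internal vertices = all vertices except the two endpoints). An earmuff for $M$ in $G$ is a set $\{P_f: f\in F\}$ with $F\subseteq M$, $P_f\in\mathcal{P}_f$, such that $(V(G),\bigcup_{f\in F}E(P_f))$ is a forest; its size is $|F|$; $\mu(G,M)$ is the maximum size of an earmuff, and $L_\mu(G,M)=|V(G)|-1+|M|-\mu(G,M)$. The ear-decomposition contains a maximum earmuff for $M$ if some earmuff of size $\mu(G,M)$ consists of ears of the decomposition. *)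

theory Defs
  imports Complex_Main
begin

section \<open>Finite loopless multigraphs\<close>

text \<open>The edges are names with a set of two ends each, so that parallel edges are distinct
  edges with the same ends. A subgraph is a graph of the same type with the same incidence
  function.\<close>

record ('v, 'e) mgraph =
  verts :: "'v set"
  edges :: "'e set"
  ends :: "'e \<Rightarrow> 'v set"

definition fin_mgraph :: "('v, 'e) mgraph \<Rightarrow> bool" where
  "fin_mgraph G \<longleftrightarrow> finite (verts G) \<and> finite (edges G) \<and>
     (\<forall>e\<in>edges G. ends G e \<subseteq> verts G \<and> card (ends G e) = 2)"

definition subgraph :: "('v, 'e) mgraph \<Rightarrow> ('v, 'e) mgraph \<Rightarrow> bool" where
  "subgraph H G \<longleftrightarrow> verts H \<subseteq> verts G \<and> edges H \<subseteq> edges G \<and> ends H = ends G \<and>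
     (\<forall>e\<in>edges H. ends H e \<subseteq> verts H)"

definition spanning_subgraph :: "('v, 'e) mgraph \<Rightarrow> 'e set \<Rightarrow> ('v, 'e) mgraph" where
  "spanning_subgraph G F = \<lparr>verts = verts G, edges = F, ends = ends G\<rparr>"

definition induced_subgraph :: "('v, 'e) mgraph \<Rightarrow> 'v set \<Rightarrow> ('v, 'e) mgraph" where
  "induced_subgraph G X = \<lparr>verts = X, edges = {e \<in> edges G. ends G e \<subseteq> X}, ends = ends G\<rparr>"

definition double_graph :: "('v, 'e) mgraph \<Rightarrow> ('v, 'e \<times> bool) mgraph" where
  "double_graph G = \<lparr>verts = verts G, edges = edges G \<times> UNIV, ends = (\<lambda>e. ends G (fst e))\<rparr>"

definition reachable :: "('v, 'e) mgraph \<Rightarrow> 'v \<Rightarrow> 'v \<Rightarrow> bool" where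
  "reachable G u v \<longleftrightarrow> (u, v) \<in> {(x, y). \<exists>e\<in>edges G. ends G e = {x, y}}\<^sup>*"

definition connected_graph :: "('v, 'e) mgraph \<Rightarrow> bool" where
  "connected_graph G \<longleftrightarrow> verts G \<noteq> {} \<and> (\<forall>u\<in>verts G. \<forall>v\<in>verts G. reachable G u v)"

definition component_verts :: "('v, 'e) mgraph \<Rightarrow> 'v set set" where
  "component_verts G = {C. \<exists>v\<in>verts G. C = {u \<in> verts G. reachable G v u}}"

definition degree :: "('v, 'e) mgraph \<Rightarrow> 'e set \<Rightarrow> 'v \<Rightarrow> nat" where
  "degree G F v = card {e \<in> F. v \<in> ends G e}"

definition T_join :: "('v, 'e) mgraph \<Rightarrow> 'v set \<Rightarrow> 'e set \<Rightarrow> bool" where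
  "T_join G T F \<longleftrightarrow> F \<subseteq> edges G \<and> {v \<in> verts G. odd (degree G F v)} = T"

definition connected_T_join :: "('v, 'e) mgraph \<Rightarrow> 'v set \<Rightarrow> ('e \<times> bool) set \<Rightarrow> bool" where
  "connected_T_join G T F \<longleftrightarrow>
     T_join (double_graph G) T F \<and> connected_graph (spanning_subgraph (double_graph G) F)"


section \<open>Paths, circuits and forests\<close>

text \<open>A traversal lists the vertices and edges of a graph along a trail that uses every edge
  exactly once and visits every vertex.\<close>

definition traversal :: "('v, 'e) mgraph \<Rightarrow> 'v list \<Rightarrow> 'e list \<Rightarrow> bool" where
  "traversal P vs es \<longleftrightarrow>
     length vs = Suc (length es) \<and> set vs = verts P \<and> set es = edges P \<and> distinct es \<and>
     (\<forall>i<length es. ends P (es ! i) = {vs ! i, vs ! Suc i})"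

definition path_between :: "('v, 'e) mgraph \<Rightarrow> 'v \<Rightarrow> 'v \<Rightarrow> bool" where
  "path_between P a b \<longleftrightarrow>
     (\<exists>vs es. traversal P vs es \<and> distinct vs \<and> hd vs = a \<and> last vs = b)"

text \<open>Two parallel edges form a circuit; loops are excluded by \<^const>\<open>fin_mgraph\<close>.\<close>

definition circuit :: "('v, 'e) mgraph \<Rightarrow> bool" where
  "circuit C \<longleftrightarrow>
     (\<exists>vs es. traversal C vs es \<and> es \<noteq> [] \<and> hd vs = last vs \<and> distinct (tl vs))"

definition forest :: "('v, 'e) mgraph \<Rightarrow> bool" where
  "forest H \<longleftrightarrow> \<not> (\<exists>C. subgraph C H \<and> circuit C)"


section \<open>Ear-decompositions\<close>

text \<open>A decomposition is the list of the subgraphs \<open>P\<^sub>0, \<dots>, P\<^sub>k\<close>; the ears are those with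
  index at least 1, and are referred to by their index.\<close>

definition prior_verts :: "('v, 'e) mgraph list \<Rightarrow> nat \<Rightarrow> 'v set" where
  "prior_verts Ps i = (\<Union>j<i. verts (Ps ! j))"

definition ear_idx :: "('v, 'e) mgraph list \<Rightarrow> nat set" where
  "ear_idx Ps = {1..<length Ps}"

definition ear_decomposition :: "('v, 'e) mgraph \<Rightarrow> ('v, 'e) mgraph list \<Rightarrow> bool" where
  "ear_decomposition G Ps \<longleftrightarrow>
     Ps \<noteq> [] \<and> (\<forall>P\<in>set Ps. subgraph P G) \<and>
     (\<Union>P\<in>set Ps. verts P) = verts G \<and>
     (\<Union>P\<in>set Ps. edges P) = edges G \<and>
     (\<forall>i<length Ps. \<forall>j<i. edges (Ps ! i) \<inter> edges (Ps ! j) = {}) \<and>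
     (\<exists>r. verts (Ps ! 0) = {r}) \<and> edges (Ps ! 0) = {} \<and>
     (\<forall>i\<in>ear_idx Ps.
        circuit (Ps ! i) \<and> card (verts (Ps ! i) \<inter> prior_verts Ps i) = 1 \<or>
        (\<exists>a b. a \<noteq> b \<and> path_between (Ps ! i) a b \<and>
               verts (Ps ! i) \<inter> prior_verts Ps i = {a, b}))"

definition ear_endpoints :: "('v, 'e) mgraph list \<Rightarrow> nat \<Rightarrow> 'v set" where
  "ear_endpoints Ps i = verts (Ps ! i) \<inter> prior_verts Ps i"

definition ear_inn :: "('v, 'e) mgraph list \<Rightarrow> nat \<Rightarrow> 'v set" where
  "ear_inn Ps i = verts (Ps ! i) - prior_verts Ps i"

definition ear_length :: "('v, 'e) mgraph list \<Rightarrow> nat \<Rightarrow> nat" where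
  "ear_length Ps i = card (edges (Ps ! i))"

definition nontrivial_ear :: "('v, 'e) mgraph list \<Rightarrow> nat \<Rightarrow> bool" where
  "nontrivial_ear Ps i \<longleftrightarrow> i \<in> ear_idx Ps \<and> ear_length Ps i > 1"

definition short_ear :: "('v, 'e) mgraph list \<Rightarrow> nat \<Rightarrow> bool" where
  "short_ear Ps i \<longleftrightarrow> i \<in> ear_idx Ps \<and> (ear_length Ps i = 2 \<or> ear_length Ps i = 3)"

definition attached :: "('v, 'e) mgraph list \<Rightarrow> nat \<Rightarrow> nat \<Rightarrow> bool" where
  "attached Ps i j \<longleftrightarrow> ear_endpoints Ps i \<inter> ear_inn Ps j \<noteq> {}"

definition pendant_ear :: "('v, 'e) mgraph list \<Rightarrow> nat \<Rightarrow> bool" where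
  "pendant_ear Ps j \<longleftrightarrow>
     nontrivial_ear Ps j \<and> \<not> (\<exists>i. nontrivial_ear Ps i \<and> attached Ps i j)"

definition num_even_ears :: "('v, 'e) mgraph list \<Rightarrow> nat" where
  "num_even_ears Ps = card {i \<in> ear_idx Ps. even (ear_length Ps i)}"

definition num_pendant_ears :: "('v, 'e) mgraph list \<Rightarrow> nat" where
  "num_pendant_ears Ps = card {i \<in> ear_idx Ps. pendant_ear Ps i}"

definition phi :: "('v, 'e) mgraph \<Rightarrow> nat" where
  "phi G = (LEAST k. \<exists>Ps. ear_decomposition G Ps \<and> num_even_ears Ps = k)"

definition L_phi :: "('v, 'e) mgraph \<Rightarrow> real" where
  "L_phi G = real (card (verts G)) + real (phi G) - 1"

definition nice_ear_decomposition :: "('v, 'e) mgraph \<Rightarrow> ('v, 'e) mgraph list \<Rightarrow> bool" where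
  "nice_ear_decomposition G Ps \<longleftrightarrow>
     ear_decomposition G Ps \<and>
     num_even_ears Ps = phi G \<and>
     (\<forall>i. short_ear Ps i \<longrightarrow> pendant_ear Ps i) \<and>
     \<not> (\<exists>i j u v e. short_ear Ps i \<and> short_ear Ps j \<and> i \<noteq> j \<and>
          u \<in> ear_inn Ps i \<and> v \<in> ear_inn Ps j \<and> e \<in> edges G \<and> ends G e = {u, v})"

definition clean_ear :: "('v, 'e) mgraph list \<Rightarrow> 'v set \<Rightarrow> nat \<Rightarrow> bool" where
  "clean_ear Ps T i \<longleftrightarrow> short_ear Ps i \<and> ear_inn Ps i \<inter> T = {}"

definition associated_eardrum ::
    "('v, 'e) mgraph \<Rightarrow> 'v set \<Rightarrow> ('v, 'e) mgraph list \<Rightarrow> 'v set set" where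
  "associated_eardrum G T Ps =
     component_verts (induced_subgraph G (\<Union>i\<in>{i. clean_ear Ps T i}. ear_inn Ps i))"


section \<open>Earmuffs\<close>

definition paths_with_inn :: "('v, 'e) mgraph \<Rightarrow> 'v set \<Rightarrow> ('v, 'e) mgraph set" where
  "paths_with_inn G f =
     {P. subgraph P G \<and> (\<exists>a b. a \<noteq> b \<and> path_between P a b \<and> verts P - {a, b} = f)}"

text \<open>The earmuff \<open>{P\<^sub>f: f \<in> F}\<close> is given by \<open>F\<close> and the function \<open>f \<mapsto> P\<^sub>f\<close>.\<close>

definition earmuff ::
    "('v, 'e) mgraph \<Rightarrow> 'v set set \<Rightarrow> 'v set set \<Rightarrow> ('v set \<Rightarrow> ('v, 'e) mgraph) \<Rightarrow> bool" where
  "earmuff G M F P \<longleftrightarrow>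
     F \<subseteq> M \<and> (\<forall>f\<in>F. P f \<in> paths_with_inn G f) \<and>
     forest (spanning_subgraph G (\<Union>f\<in>F. edges (P f)))"

definition mu :: "('v, 'e) mgraph \<Rightarrow> 'v set set \<Rightarrow> nat" where
  "mu G M = Max {card F | F. \<exists>P. earmuff G M F P}"

definition L_mu :: "('v, 'e) mgraph \<Rightarrow> 'v set set \<Rightarrow> real" where
  "L_mu G M = real (card (verts G)) - 1 + real (card M) - real (mu G M)"

definition contains_max_earmuff ::
    "('v, 'e) mgraph \<Rightarrow> 'v set set \<Rightarrow> ('v, 'e) mgraph list \<Rightarrow> bool" where
  "contains_max_earmuff G M Ps \<longleftrightarrow>
     (\<exists>F P. earmuff G M F P \<and> card F = mu G M \<and> (\<forall>f\<in>F. \<exists>i\<in>ear_idx Ps. P f = Ps ! i))"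


section \<open>Random access machine programs and their running time\<close>

text \<open>Structured programs over a memory of finitely many (per program) registers and
  one-dimensional arrays of natural numbers. The only arithmetic operations are addition and
  truncated subtraction, for which unit cost is the usual convention (multiplication would not be
  innocuous). One step is charged for every assignment and every evaluation of a test. As
  the expressions of a fixed program have bounded size, charging for each operation in an
  expression would change the running time by a constant factor only.\<close>

datatype aexp =
    Const nat
  | Reg nat
  | Load nat aexp
  | Add aexp aexp
  | Sub aexp aexp

datatype bexp =
    Less aexp aexp
  | Eq aexp aexp
  | Not bexp
  | And bexp bexp

datatype com =
    Skip
  | Assign nat aexp
  | Store nat aexp aexp
  | Seq com com
  | Cond bexp com com
  | While bexp com

record memory =
  reg :: "nat \<Rightarrow> nat"
  arr :: "nat \<Rightarrow> nat \<Rightarrow> nat"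

primrec aval :: "aexp \<Rightarrow> memory \<Rightarrow> nat" where
  "aval (Const n) s = n"
| "aval (Reg x) s = reg s x"
| "aval (Load a e) s = arr s a (aval e s)"
| "aval (Add e1 e2) s = aval e1 s + aval e2 s"
| "aval (Sub e1 e2) s = aval e1 s - aval e2 s"

primrec bval :: "bexp \<Rightarrow> memory \<Rightarrow> bool" where
  "bval (Less e1 e2) s \<longleftrightarrow> aval e1 s < aval e2 s"
| "bval (Eq e1 e2) s \<longleftrightarrow> aval e1 s = aval e2 s"
| "bval (Not b) s \<longleftrightarrow> \<not> bval b s"
| "bval (And b1 b2) s \<longleftrightarrow> bval b1 s \<and> bval b2 s"

text \<open>\<open>runs c s t s'\<close>: started in memory \<open>s\<close>, the program \<open>c\<close> halts after exactly \<open>t\<close> steps in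
  memory \<open>s'\<close>.\<close>

inductive runs :: "com \<Rightarrow> memory \<Rightarrow> nat \<Rightarrow> memory \<Rightarrow> bool" where
  Skip: "runs Skip s 1 s"
| Assign: "runs (Assign x e) s 1 (s\<lparr>reg := (reg s)(x := aval e s)\<rparr>)"
| Store: "runs (Store a i e) s 1
            (s\<lparr>arr := (arr s)(a := (arr s a)(aval i s := aval e s))\<rparr>)"
| Seq: "\<lbrakk>runs c1 s t1 s'; runs c2 s' t2 s''\<rbrakk> \<Longrightarrow> runs (Seq c1 c2) s (t1 + t2) s''"
| CondTrue: "\<lbrakk>bval b s; runs c1 s t s'\<rbrakk> \<Longrightarrow> runs (Cond b c1 c2) s (Suc t) s'"
| CondFalse: "\<lbrakk>\<not> bval b s; runs c2 s t s'\<rbrakk> \<Longrightarrow> runs (Cond b c1 c2) s (Suc t) s'"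
| WhileFalse: "\<not> bval b s \<Longrightarrow> runs (While b c) s 1 s"
| WhileTrue: "\<lbrakk>bval b s; runs c s t1 s'; runs (While b c) s' t2 s''\<rbrakk>
              \<Longrightarrow> runs (While b c) s (Suc (t1 + t2)) s''"


section \<open>Input and output conventions\<close>

text \<open>The memory contains \<open>G\<close>, \<open>T\<close> and the ear-decomposition as follows, with respect to arbitrary
  numberings \<open>\<alpha>\<close> of the vertices and \<open>\<beta>\<close> of the edges.

  Registers 0 to 3: number of vertices, number of edges, number of nontrivial ears, and the
  vertex of \<open>P\<^sub>0\<close>. Arrays 0 and 1: the two ends of each edge. Array 2: the characteristic vector
  of \<open>T\<close>. Array 3: for each nontrivial ear, in the order of the decomposition, the position in
  arrays 4 and 5 at which its vertices and its edges start; they are listed along the ear from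
  endpoint to endpoint (for a circuit, the single endpoint comes first and again last), and as an
  ear of length \<open>l\<close> has \<open>l + 1\<close> vertices in this list, one position of array 5 per ear is not used.

  The trivial ears are precisely the edges in no nontrivial ear, hence are not listed: there can
  be more parallel edges than the time bound, which only depends on the number of vertices, would
  allow to read. Nothing is assumed about the rest of the memory.\<close>

definition nontrivial_ears :: "('v, 'e) mgraph list \<Rightarrow> nat list" where
  "nontrivial_ears Ps = filter (nontrivial_ear Ps) [1..<length Ps]"

definition encodes_ear ::
    "memory \<Rightarrow> ('v \<Rightarrow> nat) \<Rightarrow> ('e \<Rightarrow> nat) \<Rightarrow> ('v, 'e) mgraph list \<Rightarrow> nat \<Rightarrow> nat \<Rightarrow> bool" where
  "encodes_ear s \<alpha> \<beta> Ps i pos \<longleftrightarrow>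
     (\<exists>vs es. traversal (Ps ! i) vs es \<and> {hd vs, last vs} = ear_endpoints Ps i \<and>
        (\<forall>p<length vs. arr s 4 (pos + p) = \<alpha> (vs ! p)) \<and>
        (\<forall>p<length es. arr s 5 (pos + p) = \<beta> (es ! p)))"

definition encodes_input ::
    "memory \<Rightarrow> ('v \<Rightarrow> nat) \<Rightarrow> ('e \<Rightarrow> nat) \<Rightarrow> ('v, 'e) mgraph \<Rightarrow> 'v set \<Rightarrow>
     ('v, 'e) mgraph list \<Rightarrow> bool" where
  "encodes_input s \<alpha> \<beta> G T Ps \<longleftrightarrow>
     bij_betw \<alpha> (verts G) {..<card (verts G)} \<and>
     bij_betw \<beta> (edges G) {..<card (edges G)} \<and>
     reg s 0 = card (verts G) \<and> reg s 1 = card (edges G) \<and>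
     reg s 2 = length (nontrivial_ears Ps) \<and> {reg s 3} = \<alpha> ` verts (Ps ! 0) \<and>
     (\<forall>e\<in>edges G. {arr s 0 (\<beta> e), arr s 1 (\<beta> e)} = \<alpha> ` ends G e) \<and>
     (\<forall>v\<in>verts G. arr s 2 (\<alpha> v) = (if v \<in> T then 1 else 0)) \<and>
     arr s 3 0 = 0 \<and>
     (\<forall>j<length (nontrivial_ears Ps).
        arr s 3 (Suc j) = arr s 3 j + ear_length Ps (nontrivial_ears Ps ! j) + 1 \<and>
        encodes_ear s \<alpha> \<beta> Ps (nontrivial_ears Ps ! j) (arr s 3 j))"

text \<open>The output is a list without repetitions of edges of the doubled graph: its length in
  register 0, the numbers of the edges in array 0, and which of the two copies in array 1.\<close>

definition encodes_output :: "memory \<Rightarrow> ('e \<Rightarrow> nat) \<Rightarrow> ('e \<times> bool) set \<Rightarrow> bool" where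
  "encodes_output s \<beta> F \<longleftrightarrow>
     (\<exists>fs. distinct fs \<and> set fs = F \<and> reg s 0 = length fs \<and>
        (\<forall>i<length fs. arr s 0 i = \<beta> (fst (fs ! i)) \<and>
                       arr s 1 i = (if snd (fs ! i) then 1 else 0)))"

end

theory Submission
  imports Defs
begin

text \<open>In an ear of length \<open>l\<close>, the edge sets with prescribed degree parities at the internal vertices
  are two complementary sets; let \<open>J\<close> be the smaller one, so \<open>|J| \<le> l div 2\<close>. A pendant ear, hence
  every short ear, takes all its edges once and those of \<open>J\<close> a second time; if \<open>J\<close> is nonempty then
  both copies of one edge of \<open>J\<close> are dropped again, which changes no parity and disconnects nothing.
  Among the short ears \<open>J\<close> is empty exactly for the clean ones. So a pendant ear costs at most
  \<open>(l - 1) + l div 2 - 1\<close>, and one more if it is clean.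

  Next, the edges of the other ears are scanned and those joining different components are taken.
  They form a forest together with a maximum earmuff, whose ears are all taken completely. So each
  ear of the earmuff saves one edge compared to a spanning tree, although the algorithm
  never computes the earmuff. Finally the nonpendant ears are treated in reverse order, each
  taking its \<open>J\<close> as second copies. Since \<open>(l - 1) + (1 if l is even) = 2 (l div 2)\<close>,
  the numbers \<open>l div 2\<close> add up to half of \<open>L\<^sub>\<phi>\<close>.\<close>

section \<open>Programs with time bounds\<close>

text \<open>The obstacle is that treating an ear changes parities at its endpoints. Other nontrivial
  ears never meet the interior of a pendant ear, so pendant ears can be settled before the forest is
  known. A nonpendant ear has to wait for all ears attached to it. At the end only the root can be
  wrong, and handshaking excludes this since T has even size. A candidate edge is compared with the
  components of all edges taken so far. These include the earmuff, so an accepted edge is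
  independent of the unknown earmuff as well. For the count, remove from the graph the interiors of
  the pendant ears outside the earmuff: the new edges and the earmuff form a forest on what is left.
  There an earmuff ear of length l brings l edges but only l - 1 new vertices, and the difference is
  the saved edge. Dropping both copies of one edge is harmless because either remaining piece of the
  ear hangs on an end, and ends lead back to earlier ears. All arguments are about positions in the
  array of ears, which keeps parallel edges apart and turns "internal to a pendant ear" into "occurs
  at one position only".\<close>

definition wpt :: "com \<Rightarrow> nat \<Rightarrow> (memory \<Rightarrow> bool) \<Rightarrow> memory \<Rightarrow> bool" where
  "wpt c B Q s \<longleftrightarrow> (\<exists>t s'. runs c s t s' \<and> t \<le> B \<and> Q s')"

lemma wpt_mono: "wpt c B Q s \<Longrightarrow> (\<And>s'. Q s' \<Longrightarrow> Q' s') \<Longrightarrow> B \<le> B' \<Longrightarrow> wpt c B' Q' s"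
  unfolding wpt_def by (meson order_trans)

text \<open>As \<open>wpt c2 B2 Q\<close> is itself a predicate on memories, it can be the
  postcondition of the first command; the phases are later chained by nesting in this way.\<close>

lemma wpt_Seq: "wpt c1 B1 (wpt c2 B2 Q) s \<Longrightarrow> wpt (Seq c1 c2) (B1 + B2) Q s"
  unfolding wpt_def by (meson add_mono runs.Seq)

lemma wpt_Seq_le:
  "wpt c1 B1 (wpt c2 B2 Q) s \<Longrightarrow> B1 + B2 \<le> B \<Longrightarrow> wpt (Seq c1 c2) B Q s"
  by (rule wpt_mono[OF wpt_Seq])

lemma wpt_Cond:
  assumes "bval b s \<Longrightarrow> wpt c1 B1 Q s" "\<not> bval b s \<Longrightarrow> wpt c2 B2 Q s"
    "Suc B1 \<le> B" "Suc B2 \<le> B"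
  shows "wpt (Cond b c1 c2) B Q s"
proof (cases "bval b s")
  case True
  then show ?thesis using assms(1,3) unfolding wpt_def
    by (meson CondTrue Suc_le_mono order_trans)
next
  case False
  then show ?thesis using assms(2,4) unfolding wpt_def
    by (meson CondFalse Suc_le_mono order_trans)
qed

text \<open>Code without loops is run symbolically by the simplifier through \<open>exec\<close>, so
  that invariants are needed only at loops. The clauses of \<open>exec\<close> and
  \<open>cost\<close> for \<open>While\<close> are dummies, which this predicate excludes.\<close>

fun loop_free :: "com \<Rightarrow> bool" where
  "loop_free (Seq c1 c2) \<longleftrightarrow> loop_free c1 \<and> loop_free c2"
| "loop_free (Cond b c1 c2) \<longleftrightarrow> loop_free c1 \<and> loop_free c2"
| "loop_free (While b c) \<longleftrightarrow> False"
| "loop_free _ \<longleftrightarrow> True"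

fun exec :: "com \<Rightarrow> memory \<Rightarrow> memory" where
  "exec Skip s = s"
| "exec (Assign x e) s = s\<lparr>reg := (reg s)(x := aval e s)\<rparr>"
| "exec (Store a i e) s = s\<lparr>arr := (arr s)(a := (arr s a)(aval i s := aval e s))\<rparr>"
| "exec (Seq c1 c2) s = exec c2 (exec c1 s)"
| "exec (Cond b c1 c2) s = (if bval b s then exec c1 s else exec c2 s)"
| "exec (While b c) s = s"

fun cost :: "com \<Rightarrow> nat" where
  "cost (Seq c1 c2) = cost c1 + cost c2"
| "cost (Cond b c1 c2) = Suc (max (cost c1) (cost c2))"
| "cost _ = 1"

lemma wpt_exec: "loop_free c \<Longrightarrow> Q (exec c s) \<Longrightarrow> wpt c (cost c) Q s"
proof (induction c arbitrary: s Q)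
  case (Seq c1 c2)
  then have "wpt c1 (cost c1) (wpt c2 (cost c2) Q) s" by simp
  then show ?case using wpt_Seq by simp
next
  case (Cond b c1 c2)
  show ?case using Cond by (intro wpt_Cond[where ?B1.0 = "cost c1" and ?B2.0 = "cost c2"]) auto
next
  case Skip
  then show ?case using runs.Skip[of s] by (auto simp: wpt_def)
next
  case (Assign x e)
  then show ?case using runs.Assign[of x e s] by (auto simp: wpt_def)
next
  case (Store a i e)
  then show ?case using runs.Store[of a i e s] by (auto simp: wpt_def)
qed simp

lemma wpt_exec_le: "loop_free c \<Longrightarrow> Q (exec c s) \<Longrightarrow> cost c \<le> B \<Longrightarrow> wpt c B Q s"
  by (rule wpt_mono[OF wpt_exec])

definition For :: "nat \<Rightarrow> aexp \<Rightarrow> aexp \<Rightarrow> com \<Rightarrow> com" where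
  "For x lo hi c = Seq (Assign x lo)
     (While (Less (Reg x) hi) (Seq c (Assign x (Add (Reg x) (Const 1)))))"

text \<open>The shape in which a loop body leaves the memory: the counter is untouched, and the
  invariant anticipates the increment that \<open>For\<close> performs itself.\<close>

abbreviation advanced :: "nat \<Rightarrow> nat \<Rightarrow> (nat \<Rightarrow> memory \<Rightarrow> bool) \<Rightarrow> memory \<Rightarrow> bool" where
  "advanced x i I \<equiv> \<lambda>s. reg s x = i \<and> I (Suc i) (s\<lparr>reg := (reg s)(x := Suc i)\<rparr>)"

text \<open>The bound \<open>hi\<close> is evaluated anew before each round, so the invariant must
  fix its value. The initial assignment and the last test cost 2, and each round adds a test and an
  increment to the body.\<close>

lemma wpt_For:
  assumes init: "I L (s\<lparr>reg := (reg s)(x := L)\<rparr>)" and lo: "aval lo s = L" and LH: "L \<le> H"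
    and hi: "\<And>i s. L \<le> i \<Longrightarrow> i \<le> H \<Longrightarrow> I i s \<Longrightarrow> reg s x = i \<Longrightarrow> aval hi s = H"
    and body: "\<And>i s. L \<le> i \<Longrightarrow> i < H \<Longrightarrow> I i s \<Longrightarrow> reg s x = i \<Longrightarrow>
      wpt c B (advanced x i I) s"
    and final: "\<And>s. I H s \<Longrightarrow> reg s x = H \<Longrightarrow> Q s"
    and time: "2 + (H - L) * (B + 2) \<le> B'"
  shows "wpt (For x lo hi c) B' Q s"
proof -
  let ?c = "Seq c (Assign x (Add (Reg x) (Const 1)))"
  let ?b = "Less (Reg x) hi"
  have loop: "wpt (While ?b ?c) (1 + (H - i) * (B + 2)) Q s"
    if "L \<le> i" "i \<le> H" "I i s" "reg s x = i" for i s
    using that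
  proof (induction "H - i" arbitrary: i s)
    case 0
    then have "i = H" by simp
    moreover from 0 have "\<not> bval ?b s" using hi[of i s] by simp
    then have "runs (While ?b ?c) s 1 s" by (rule runs.WhileFalse)
    ultimately show ?case using final[of s] 0 unfolding wpt_def by fastforce
  next
    case (Suc m)
    then have "i < H" by simp
    with Suc.prems have "bval ?b s" using hi[of i s] by simp
    obtain t1 s1 where s1: "runs c s t1 s1" "t1 \<le> B" "reg s1 x = i"
      "I (Suc i) (s1\<lparr>reg := (reg s1)(x := Suc i)\<rparr>)"
      using body[OF Suc.prems(1) \<open>i < H\<close> Suc.prems(3,4)] unfolding wpt_def by blast
    let ?s2 = "s1\<lparr>reg := (reg s1)(x := Suc i)\<rparr>"
    have "runs (Assign x (Add (Reg x) (Const 1))) s1 1 ?s2"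
      using runs.Assign[of x "Add (Reg x) (Const 1)" s1] s1(3) by simp
    then have r: "runs ?c s (t1 + 1) ?s2" using s1(1) runs.Seq by blast
    have "wpt (While ?b ?c) (1 + (H - Suc i) * (B + 2)) Q ?s2"
      using Suc.hyps(1)[of "Suc i" ?s2] Suc.hyps(2) Suc.prems \<open>i < H\<close> s1(4) by simp
    then obtain t2 s3 where s3: "runs (While ?b ?c) ?s2 t2 s3" "t2 \<le> 1 + (H - Suc i) * (B + 2)" "Q s3"
      unfolding wpt_def by blast
    have "runs (While ?b ?c) s (Suc (t1 + 1 + t2)) s3"
      using runs.WhileTrue[OF \<open>bval ?b s\<close> r s3(1)] .
    moreover have "H - i = Suc (H - Suc i)" using \<open>i < H\<close> by simp
    then have "Suc (t1 + 1 + t2) \<le> 1 + (H - i) * (B + 2)" using s1(2) s3(2) by simp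
    ultimately show ?case using s3(3) unfolding wpt_def by blast
  qed
  have "wpt (Assign x lo) 1 (wpt (While ?b ?c) (1 + (H - L) * (B + 2)) Q) s"
    using init lo LH loop[of L "s\<lparr>reg := (reg s)(x := L)\<rparr>"] wpt_exec[of "Assign x lo"] by simp
  from wpt_Seq[OF this] show ?thesis
    unfolding For_def by (rule wpt_mono) (use time in auto)
qed

definition frame :: "nat set \<Rightarrow> nat set \<Rightarrow> memory \<Rightarrow> memory \<Rightarrow> bool" where
  "frame A R s s' \<longleftrightarrow> (\<forall>a. a \<notin> A \<longrightarrow> arr s' a = arr s a) \<and> (\<forall>x. x \<notin> R \<longrightarrow> reg s' x = reg s x)"

lemma frame_refl [simp]: "frame A R s s"
  by (simp add: frame_def)

lemma frame_reg_update [simp]: "x \<in> R \<Longrightarrow> frame A R s (s'\<lparr>reg := (reg s')(x := y)\<rparr>) \<longleftrightarrow> frame A R s s'"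
  unfolding frame_def by auto

lemma frame_arr_update [simp]: "a \<in> A \<Longrightarrow> frame A R s (s'\<lparr>arr := (arr s')(a := f)\<rparr>) \<longleftrightarrow> frame A R s s'"
  unfolding frame_def by auto

section \<open>Linked positions\<close>

text \<open>Edges are represented by positions and not by pairs of vertices, so that parallel edges
  remain distinct members of \<open>S\<close>.\<close>

definition link :: "(nat \<Rightarrow> 'a) \<Rightarrow> nat set \<Rightarrow> ('a \<times> 'a) set" where
  "link w S = {(u, v). \<exists>p\<in>S. {w p, w (Suc p)} = {u, v}}"

definition conn :: "(nat \<Rightarrow> 'a) \<Rightarrow> nat set \<Rightarrow> 'a \<Rightarrow> 'a \<Rightarrow> bool" where
  "conn w S u v \<longleftrightarrow> (u, v) \<in> (link w S)\<^sup>*"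

lemma conn_refl [simp]: "conn w S u u"
  by (simp add: conn_def)

lemma conn_trans: "conn w S u v \<Longrightarrow> conn w S v x \<Longrightarrow> conn w S u x"
  by (auto simp: conn_def)

lemma conn_sym: "conn w S u v \<Longrightarrow> conn w S v u"
proof -
  have "sym (link w S)" by (auto simp: link_def sym_def insert_commute)
  then show "conn w S u v \<Longrightarrow> conn w S v u"
    unfolding conn_def by (metis sym_rtrancl symD)
qed

lemma conn_mono: "S \<subseteq> S' \<Longrightarrow> conn w S u v \<Longrightarrow> conn w S' u v"
  unfolding conn_def by (rule subsetD[OF rtrancl_mono]) (auto simp: link_def)

lemma conn_edge: "p \<in> S \<Longrightarrow> conn w S (w p) (w (Suc p))"
  unfolding conn_def by (rule r_into_rtrancl) (auto simp: link_def)

text \<open>A walk that crosses the new edge several times can be shortened to a single crossing, in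
  one of the two directions. This is why merging two labels after taking an edge is correct.\<close>

lemma conn_insertD:
  assumes "conn w (insert p S) u v"
  shows "conn w S u v \<or> (conn w S u (w p) \<and> conn w S (w (Suc p)) v) \<or>
    (conn w S u (w (Suc p)) \<and> conn w S (w p) v)"
  using assms unfolding conn_def[of w "insert p S"]
proof (induction rule: rtrancl_induct)
  case (step y z)
  from step.hyps(2) consider "(y, z) \<in> link w S" | "y = w p" "z = w (Suc p)" | "y = w (Suc p)" "z = w p"
    by (auto simp: link_def doubleton_eq_iff)
  then show ?case
  proof cases
    case 1
    then have "conn w S y z" by (auto simp: conn_def)
    then show ?thesis using step.IH by (meson conn_trans)
  qed (use step.IH in \<open>auto intro: conn_trans conn_sym\<close>)
qed simp

lemma conn_insert:
  "conn w (insert p S) u v \<longleftrightarrow> conn w S u v \<or> (conn w S u (w p) \<and> conn w S (w (Suc p)) v) \<or>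
    (conn w S u (w (Suc p)) \<and> conn w S (w p) v)" (is "?l \<longleftrightarrow> ?r")
proof
  assume ?r
  moreover have "conn w (insert p S) (w p) (w (Suc p))" by (rule conn_edge) simp
  ultimately show ?l
    by (meson conn_mono conn_sym conn_trans subset_insertI)
qed (rule conn_insertD)

text \<open>Forests, described by the order in which a greedy algorithm accepts their edges.
  Accepting an edge is then an introduction rule, and the number of edges is bounded by
  induction.\<close>

inductive indep :: "(nat \<Rightarrow> 'a) \<Rightarrow> nat set \<Rightarrow> bool" for w where
  indep_empty: "indep w {}"
| indep_insert: "indep w S \<Longrightarrow> \<not> conn w S (w p) (w (Suc p)) \<Longrightarrow> indep w (insert p S)"

lemma indep_reps:
  assumes "indep w S" "finite V" "\<And>p. p \<in> S \<Longrightarrow> w p \<in> V \<and> w (Suc p) \<in> V"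
  shows "finite S \<and> (\<exists>R\<subseteq>V. card R + card S = card V \<and> (\<forall>v\<in>V. \<exists>u\<in>R. conn w S v u))"
  using assms(1,3)
proof induction
  case indep_empty
  then show ?case by (auto intro!: exI[of _ V] bexI)
next
  case (indep_insert S p)
  then obtain R where fS: "finite S" and R: "R \<subseteq> V" "card R + card S = card V"
    "\<And>v. v \<in> V \<Longrightarrow> \<exists>u\<in>R. conn w S v u" by auto
  obtain a where a: "a \<in> R" "conn w S (w p) a" using R(3) indep_insert.prems by blast
  obtain b where b: "b \<in> R" "conn w S (w (Suc p)) b" using R(3) indep_insert.prems by blast
  have "a \<noteq> b" using a b indep_insert.hyps(2) by (meson conn_sym conn_trans)
  have "p \<notin> S" using indep_insert.hyps(2) conn_edge by blast
  have "finite R" using R(1) assms(2) finite_subset by blast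
  then have "card R > 0" using b(1) card_gt_0_iff by blast
  then have "card (R - {b}) + card (insert p S) = card V"
    using R(2) b(1) \<open>finite R\<close> fS \<open>p \<notin> S\<close> by simp
  moreover have "\<exists>u\<in>R - {b}. conn w (insert p S) v u" if v: "v \<in> V" for v
  proof -
    obtain u where u: "u \<in> R" "conn w S v u" using R(3) v by blast
    show ?thesis
    proof (cases "u = b")
      case True
      have "conn w (insert p S) v a"
        using u(2) True a b unfolding conn_insert by (meson conn_sym conn_trans)
      then show ?thesis using a(1) \<open>a \<noteq> b\<close> by blast
    next
      case False
      then show ?thesis using u conn_insert by fastforce
    qed
  qed
  ultimately show ?case using R(1) fS by (intro conjI exI[of _ "R - {b}"]) auto
qed

lemma indep_card_less:
  assumes "indep w S" "finite V" "V \<noteq> {}" "\<And>p. p \<in> S \<Longrightarrow> w p \<in> V \<and> w (Suc p) \<in> V"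
  shows "card S < card V"
proof -
  obtain R where R: "R \<subseteq> V" "card R + card S = card V" "\<forall>v\<in>V. \<exists>u\<in>R. conn w S v u"
    using indep_reps[OF assms(1,2,4)] by blast
  then have "R \<noteq> {}" using assms(3) by blast
  then have "card R > 0" using R(1) assms(2) by (meson card_gt_0_iff finite_subset)
  then show ?thesis using R(2) by linarith
qed

section \<open>Ears laid out along an array\<close>

text \<open>Vertices are the numbers below \<open>n\<close>. Ear \<open>j\<close> occupies the positions from \<open>st j\<close> to
  \<open>st (Suc j) - 1\<close>, and \<open>w p\<close> is the vertex at position \<open>p\<close>. A position that is not the last of
  its ear also names the edge from \<open>w p\<close> to \<open>w (Suc p)\<close>. Throughout, \<open>b\<close> and \<open>x\<close> are the
  characteristic functions of the edges taken a first and a second time, and \<open>q\<close> is the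
  set of vertices whose degree still has the wrong parity.\<close>

locale ear_list =
  fixes n k r :: nat and st w \<tau> :: "nat \<Rightarrow> nat"
  assumes st_step: "\<And>j. j < k \<Longrightarrow> st j + 3 \<le> st (Suc j)"
    and root_less: "r < n"
    and vertex_less: "\<And>j p. j < k \<Longrightarrow> st j \<le> p \<Longrightarrow> p < st (Suc j) \<Longrightarrow> w p < n"
    and inner_inj: "\<And>i j p p'. i < k \<Longrightarrow> j < k \<Longrightarrow> st i < p \<Longrightarrow> Suc p < st (Suc i) \<Longrightarrow>
      st j < p' \<Longrightarrow> Suc p' < st (Suc j) \<Longrightarrow> w p = w p' \<Longrightarrow> p = p'"
    and inner_cover: "\<And>v. v < n \<Longrightarrow> v \<noteq> r \<Longrightarrow> \<exists>j<k. \<exists>p. st j < p \<and> Suc p < st (Suc j) \<and> w p = v"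
    and inner_not_root: "\<And>j p. j < k \<Longrightarrow> st j < p \<Longrightarrow> Suc p < st (Suc j) \<Longrightarrow> w p \<noteq> r"
    and endpoint: "\<And>j e. j < k \<Longrightarrow> e = st j \<or> Suc e = st (Suc j) \<Longrightarrow>
      w e = r \<or> (\<exists>i<j. \<exists>p. st i < p \<and> Suc p < st (Suc i) \<and> w e = w p)"
    and short_not_attached: "\<And>i j p e. i < k \<Longrightarrow> j < k \<Longrightarrow> st (Suc j) \<le> st j + 4 \<Longrightarrow>
      st j < p \<Longrightarrow> Suc p < st (Suc j) \<Longrightarrow> e = st i \<or> Suc e = st (Suc i) \<Longrightarrow> w e \<noteq> w p"
    and demand_le: "\<And>v. v < n \<Longrightarrow> \<tau> v \<le> 1"
    and demand_even: "even (\<Sum>v<n. \<tau> v)"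
begin

section \<open>Positions of ears and their internal vertices\<close>

definition fin :: "nat \<Rightarrow> nat" where
  "fin j = st (Suc j) - 1"

definition E :: "nat \<Rightarrow> nat set" where
  "E j = {st j..<fin j}"

definition inner :: "nat \<Rightarrow> nat set" where
  "inner j = {st j<..<fin j}"

definition len :: "nat \<Rightarrow> nat" where
  "len j = fin j - st j"

definition EE :: "nat set" where
  "EE = (\<Union>j<k. E j)"

definition pendant :: "nat \<Rightarrow> bool" where
  "pendant j \<longleftrightarrow> (\<forall>i<k. \<forall>p\<in>inner j. w (st i) \<noteq> w p \<and> w (fin i) \<noteq> w p)"

definition clean :: "nat \<Rightarrow> bool" where
  "clean j \<longleftrightarrow> len j \<le> 3 \<and> (\<forall>p\<in>inner j. \<tau> (w p) = 0)"

lemma st_fin: "j < k \<Longrightarrow> st j + 2 \<le> fin j" "j < k \<Longrightarrow> st (Suc j) = Suc (fin j)"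
  using st_step[of j] by (auto simp: fin_def)

lemma len_ge: "j < k \<Longrightarrow> 2 \<le> len j"
  using st_fin[of j] by (auto simp: len_def)

lemma w_less: "j < k \<Longrightarrow> p \<in> {st j..fin j} \<Longrightarrow> w p < n"
  using vertex_less[of j p] st_fin(2)[of j] by auto

lemma st_mono: "i \<le> j \<Longrightarrow> j \<le> k \<Longrightarrow> st i \<le> st j"
proof (induction j)
  case (Suc j)
  then show ?case using st_step[of j] by (cases "i = Suc j") auto
qed simp

lemma st_mono_fin: "i < j \<Longrightarrow> j < k \<Longrightarrow> fin i < st j"
  using st_mono[of "Suc i" j] st_fin(2)[of i] by simp

lemma pos_unique:
  assumes "i < k" "j < k" "p \<in> {st i..fin i}" "p \<in> {st j..fin j}"
  shows "i = j"
  using assms st_mono_fin[of i j] st_mono_fin[of j i] by (cases i j rule: linorder_cases) auto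

lemma E_unique: "i < k \<Longrightarrow> j < k \<Longrightarrow> p \<in> E i \<Longrightarrow> p \<in> E j \<Longrightarrow> i = j"
  by (rule pos_unique[of i j p]) (auto simp: E_def)

lemma finite_E [simp]: "finite (E j)" "finite (inner j)"
  by (auto simp: E_def inner_def)

lemma finite_EE [simp]: "finite EE"
  by (simp add: EE_def)

lemma E_EE: "j < k \<Longrightarrow> p \<in> E j \<Longrightarrow> p \<in> EE"
  by (auto simp: EE_def)

lemma card_E: "card (E j) = len j"
  by (simp add: E_def len_def)

lemma inner_subset_E: "inner j \<subseteq> E j"
  by (auto simp: E_def inner_def)

lemma EE_less: "p \<in> EE \<Longrightarrow> p < st k"
proof -
  assume "p \<in> EE"
  then obtain j where "j < k" "p \<in> E j" by (auto simp: EE_def)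
  then show ?thesis using st_mono[of "Suc j" k] st_fin(2)[of j] by (auto simp: E_def)
qed

lemma sum_EE: "(\<Sum>p\<in>EE. f p) = (\<Sum>j<k. \<Sum>p\<in>E j. f p)" for f :: "nat \<Rightarrow> nat"
  unfolding EE_def by (rule sum.UNION_disjoint) (use E_unique in auto)

text \<open>The assumption \<open>endpoint\<close> traces each end of an ear, unless it is the root,
  back to an internal position of an earlier ear. So an internal vertex can recur only as an end of
  a later ear.\<close>

lemma inner_unique:
  assumes "i < k" "j < k" "p \<in> inner i" "p' \<in> {st j..fin j}" "w p = w p'"
  shows "p = p' \<or> (i < j \<and> (p' = st j \<or> p' = fin j))"
proof (cases "p' \<in> inner j")
  case True
  then show ?thesis using inner_inj[of i j p p'] assms st_fin(2) by (auto simp: inner_def)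
next
  case False
  then have e: "p' = st j \<or> p' = fin j" using assms(4) by (auto simp: inner_def)
  have "w p' \<noteq> r" using inner_not_root[of i p] assms st_fin(2)[of i] by (auto simp: inner_def)
  then obtain i' p'' where i': "i' < j" "st i' < p''" "Suc p'' < st (Suc i')" "w p' = w p''"
    using endpoint[of j p'] e st_fin(2) assms(2) by metis
  then have "p'' = p" using inner_inj[of i i' p p''] assms st_fin(2) by (auto simp: inner_def)
  then have "i = i'" using pos_unique[of i i' p] i' assms st_fin(2)[of i'] by (auto simp: inner_def)
  then show ?thesis using i' e by simp
qed

lemma inner_unique_same:
  assumes "j < k" "p \<in> inner j" "p' \<in> {st j..fin j}" "w p = w p'"
  shows "p = p'"
  using inner_unique[OF assms(1,1,2,3,4)] by simp

text \<open>With no ear attached, the second alternative of \<open>inner_unique\<close> falls away: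
  the vertex occurs at one position of the whole array.\<close>

lemma inner_unique_pendant:
  assumes "pendant i" "i < k" "j < k" "p \<in> inner i" "p' \<in> {st j..fin j}" "w p = w p'"
  shows "p = p'"
  using inner_unique[OF assms(2-6)] assms unfolding pendant_def by metis

text \<open>An ear of length at most 3 occupies at most four positions, which is the case covered by
  \<open>short_not_attached\<close>.\<close>

lemma short_pendant: "j < k \<Longrightarrow> len j \<le> 3 \<Longrightarrow> pendant j"
  unfolding pendant_def
proof (intro allI impI ballI)
  fix i p assume *: "j < k" "len j \<le> 3" "i < k" "p \<in> inner j"
  have "st (Suc j) \<le> st j + 4" "st j < p" "Suc p < st (Suc j)" "Suc (fin i) = st (Suc i)"
    using * st_fin[of j] st_fin[of i] by (auto simp: len_def inner_def)
  then show "w (st i) \<noteq> w p \<and> w (fin i) \<noteq> w p"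
    using short_not_attached[of i j p] * by auto
qed

text \<open>As every ear has length at least 2, one of the two positions is internal, and an
  internal vertex does not recur within its ear. Hence flipping the two ends of an edge never hits
  the same vertex twice.\<close>

lemma adj_neq: "p \<in> EE \<Longrightarrow> w p \<noteq> w (Suc p)"
proof -
  assume "p \<in> EE"
  then obtain j where j: "j < k" "p \<in> E j" by (auto simp: EE_def)
  show ?thesis
  proof (cases "p = st j")
    case True
    then have "Suc p \<in> inner j" using st_fin[of j] j by (auto simp: inner_def)
    then show ?thesis using inner_unique_same[of j "Suc p" p] j by (auto simp: E_def)
  next
    case False
    then have "p \<in> inner j" using j by (auto simp: inner_def E_def)
    then show ?thesis using inner_unique_same[of j p "Suc p"] j by (auto simp: E_def)
  qed
qed

section \<open>Degrees and parities\<close>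

definition inc :: "nat \<Rightarrow> nat \<Rightarrow> nat" where
  "inc p v = (if w p = v \<or> w (Suc p) = v then 1 else 0)"

definition dg :: "(nat \<Rightarrow> nat) \<Rightarrow> nat \<Rightarrow> nat" where
  "dg y v = (\<Sum>p\<in>EE. y p * inc p v)"

text \<open>Here \<open>q\<close> is the defect modulo 2 of the degrees with respect to
  \<open>\<tau>\<close>; the bound by 1 makes it unique below \<open>n\<close>, see
  \<open>parity_unique\<close>.\<close>

definition parity :: "(nat \<Rightarrow> nat) \<Rightarrow> (nat \<Rightarrow> nat) \<Rightarrow> (nat \<Rightarrow> nat) \<Rightarrow> bool" where
  "parity y z q \<longleftrightarrow> (\<forall>v<n. q v \<le> 1 \<and> even (q v + \<tau> v + dg y v + dg z v))"

text \<open>The nested updates mirror the two stores of \<open>flip_com\<close>, the second of which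
  reads the result of the first. As the ends differ, this is a simultaneous flip
  (\<open>toggle_apply\<close>).\<close>

definition toggle :: "nat \<Rightarrow> (nat \<Rightarrow> nat) \<Rightarrow> nat \<Rightarrow> nat" where
  "toggle p q = (let q1 = q(w p := 1 - q (w p)) in q1(w (Suc p) := 1 - q1 (w (Suc p))))"

lemma toggle_apply: "p \<in> EE \<Longrightarrow> toggle p q v = (if w p = v \<or> w (Suc p) = v then 1 - q v else q v)"
  using adj_neq[of p] by (auto simp: toggle_def Let_def)

lemma dg_update:
  assumes "p \<in> EE"
  shows "dg (y(p := c)) v + y p * inc p v = dg y v + c * inc p v"
proof -
  have "dg y v = y p * inc p v + (\<Sum>p'\<in>EE - {p}. y p' * inc p' v)"
    unfolding dg_def using assms by (simp add: sum.remove)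
  moreover have "dg (y(p := c)) v = c * inc p v + (\<Sum>p'\<in>EE - {p}. y p' * inc p' v)"
    unfolding dg_def using assms by (subst sum.remove[of _ p]) (auto intro!: sum.cong)
  ultimately show ?thesis by simp
qed

text \<open>Since \<open>z\<close> is 0 or 1, \<open>e'\<close> and \<open>e\<close> differ by
  exactly one, and so do \<open>1 - q\<close> and \<open>q\<close>; the two changes of parity
  cancel.\<close>

lemma odd_flip:
  fixes q z t d e e' :: nat
  assumes "q \<le> 1" "z \<le> 1" "even (q + t + d + e)" "e' + z = e + (1 - z)"
  shows "even (1 - q + t + d + e')"
  using assms by (cases "z = 0"; cases "q = 0") (auto simp: le_Suc_eq)

lemma parity_toggle:
  assumes "parity y z q" "p \<in> EE" "z p \<le> 1"
  shows "parity y (z(p := 1 - z p)) (toggle p q)"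
  unfolding parity_def
proof (intro allI impI)
  fix v assume v: "v < n"
  have q: "q v \<le> 1" "even (q v + \<tau> v + dg y v + dg z v)" using assms v by (auto simp: parity_def)
  have u: "dg (z(p := 1 - z p)) v + z p * inc p v = dg z v + (1 - z p) * inc p v"
    using dg_update[OF assms(2)] .
  show "toggle p q v \<le> 1 \<and> even (toggle p q v + \<tau> v + dg y v + dg (z(p := 1 - z p)) v)"
  proof (cases "inc p v = 0")
    case True
    then have "toggle p q v = q v" using assms(2) by (auto simp: toggle_apply inc_def split: if_splits)
    then show ?thesis using q u True by simp
  next
    case False
    then have t: "toggle p q v = 1 - q v" and i: "inc p v = 1"
      using assms(2) by (auto simp: toggle_apply inc_def split: if_splits)
    show ?thesis using odd_flip[OF q(1) assms(3) q(2)] u unfolding t i by simp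
  qed
qed

lemma parity_commute: "parity y z q \<longleftrightarrow> parity z y q"
  by (auto simp: parity_def add_ac)

lemma parity_unique: "parity y z q \<Longrightarrow> parity y z q' \<Longrightarrow> v < n \<Longrightarrow> q v = q' v"
proof -
  assume *: "parity y z q" "parity y z q'" "v < n"
  then have "q v \<le> 1" "q' v \<le> 1" "even (q v + (\<tau> v + dg y v + dg z v))" "even (q' v + (\<tau> v + dg y v + dg z v))"
    by (auto simp: parity_def add.assoc)
  then show ?thesis by (auto simp: even_add le_Suc_eq elim!: le_SucE)
qed

definition off :: "nat \<Rightarrow> (nat \<Rightarrow> nat) \<Rightarrow> (nat \<Rightarrow> nat) \<Rightarrow> bool" where
  "off j q0 q \<longleftrightarrow> (\<forall>v. v \<notin> w ` {st j..fin j} \<longrightarrow> q v = q0 v)"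

lemma off_refl [simp]: "off j q q"
  by (simp add: off_def)

lemma off_trans: "off j q q' \<Longrightarrow> off j q' q'' \<Longrightarrow> off j q q''"
  by (simp add: off_def)

lemma off_toggle: "j < k \<Longrightarrow> p \<in> E j \<Longrightarrow> off j q0 q \<Longrightarrow> off j q0 (toggle p q)"
  using E_EE[of j p] unfolding off_def by (auto simp: toggle_apply E_def)

text \<open>Ear \<open>j\<close> meets internal vertices of other ears only at its own ends, and
  these lie inside earlier, nonpendant ears. Hence pendant ears and ears later than \<open>j\<close>
  are not disturbed.\<close>

lemma off_inner:
  assumes "off j q0 q" "i < k" "j < k" "p \<in> inner i" "i \<noteq> j" "pendant i \<or> j \<le> i"
  shows "q (w p) = q0 (w p)"
proof -
  have "w p \<notin> w ` {st j..fin j}"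
  proof
    assume "w p \<in> w ` {st j..fin j}"
    then obtain p' where p': "p' \<in> {st j..fin j}" "w p = w p'" by auto
    then have "p = p'" using inner_unique[OF assms(2,3,4) p'] inner_unique_pendant[OF _ assms(2,3,4) p'] assms(6) by auto
    then show False using pos_unique[of i j p] p'(1) assms by (auto simp: inner_def)
  qed
  then show ?thesis using assms(1) by (auto simp: off_def)
qed

text \<open>Along an ear, an edge is taken as soon as the vertex before it has the wrong parity; the
  first edge is never taken. If this takes more than half of the edges, all of them are flipped.\<close>

definition solve_inv where
  "solve_inv j q0 x0 b p q x c \<longleftrightarrow> parity b x q \<and> off j q0 q \<and>
     (\<forall>p'. p' \<notin> {st j<..<p} \<longrightarrow> x p' = x0 p') \<and> (\<forall>p'\<in>E j. x p' \<le> 1) \<and>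
     (\<forall>p'\<in>{st j<..<p}. q (w p') = 0) \<and> c = (\<Sum>p'\<in>E j. x p') \<and>
     ((\<forall>p'\<in>inner j. q0 (w p') = 0) \<longrightarrow> q = q0 \<and> x = x0)"

lemma solve_inv_init:
  assumes "parity b x q" "\<forall>p\<in>E j. x p = 0"
  shows "solve_inv j q x b (Suc (st j)) q x 0"
  unfolding solve_inv_def using assms by (intro conjI) auto

lemma sum_E_update:
  assumes "p \<in> E j"
  shows "(\<Sum>p'\<in>E j. (x(p := c)) p') + x p = (\<Sum>p'\<in>E j. x p') + (c::nat)"
proof -
  have "(\<Sum>p'\<in>E j. (x(p := c)) p') = c + (\<Sum>p'\<in>E j - {p}. x p')"
    using assms by (subst sum.remove[of _ p]) (auto intro!: sum.cong)
  moreover have "(\<Sum>p'\<in>E j. x p') = x p + (\<Sum>p'\<in>E j - {p}. x p')"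
    using assms by (simp add: sum.remove)
  ultimately show ?thesis by simp
qed

lemma solve_inv_toggle:
  assumes j: "j < k" and x0: "\<forall>p\<in>E j. x0 p = 0" and p: "st j < p" "p < fin j"
    and inv: "solve_inv j q0 x0 b p q x c" and q1: "q (w p) = 1"
  shows "solve_inv j q0 x0 b (Suc p) (toggle p q) (x(p := 1 - x p)) (Suc c)"
proof -
  note inv' = inv[unfolded solve_inv_def]
  have pE: "p \<in> E j" "p \<in> EE" "p \<in> inner j" using p j E_EE by (auto simp: E_def inner_def)
  have xp: "x p = 0" using inv' x0 pE by auto
  have "parity b (x(p := 1 - x p)) (toggle p q)" using inv' pE by (intro parity_toggle) auto
  moreover have "off j q0 (toggle p q)" using inv' off_toggle j pE by blast
  moreover have "toggle p q (w p') = 0" if "p' \<in> {st j<..<Suc p}" for p'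
  proof (cases "p' = p")
    case True
    then show ?thesis using q1 pE by (simp add: toggle_apply)
  next
    case False
    \<comment> \<open>Vertices already passed stay correct: an internal vertex occurs once in its
      ear, so neither end of the current edge is an earlier vertex.\<close>
    then have "p' \<in> inner j" "p' < p" "q (w p') = 0" using that p inv' by (auto simp: inner_def)
    then have "w p' \<noteq> w p" "w p' \<noteq> w (Suc p)"
      using inner_unique_same[of j p' p] inner_unique_same[of j p' "Suc p"] j p by auto
    then show ?thesis using pE \<open>q (w p') = 0\<close> by (auto simp: toggle_apply)
  qed
  moreover have "Suc c = (\<Sum>p'\<in>E j. (x(p := 1 - x p)) p')"
    using sum_E_update[OF pE(1), of x "1 - x p"] xp inv' by simp
  \<comment> \<open>If \<open>q0\<close> vanished on the interior, the invariant would give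
    \<open>q = q0\<close>, against \<open>q (w p) = 1\<close>. So its last clause is vacuous from
    now on.\<close>
  moreover have "\<not> (\<forall>p'\<in>inner j. q0 (w p') = 0)" using inv' q1 pE by force
  moreover have "\<forall>p'. p' \<notin> {st j<..<Suc p} \<longrightarrow> (x(p := 1 - x p)) p' = x0 p'" using inv' p(1) by auto
  moreover have "\<forall>p'\<in>E j. (x(p := 1 - x p)) p' \<le> 1" using inv' xp by auto
  ultimately show ?thesis unfolding solve_inv_def by blast
qed

lemma solve_inv_skip:
  assumes j: "j < k" and p: "st j < p" "p < fin j"
    and inv: "solve_inv j q0 x0 b p q x c" and q1: "q (w p) \<noteq> 1"
  shows "solve_inv j q0 x0 b (Suc p) q x c"
proof -
  have "w p < n" using w_less[of j p] j p by auto
  then have "q (w p) \<le> 1" using inv by (auto simp: solve_inv_def parity_def)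
  then have "q (w p) = 0" using q1 by simp
  then show ?thesis using inv by (auto simp: solve_inv_def less_Suc_eq)
qed

text \<open>The last clause says that an ear without defects receives no edges; for a clean ear this
  means that \<open>J\<close> is empty, so that nothing of it is dropped later.\<close>

definition solved where
  "solved j q0 x0 b q x \<longleftrightarrow> parity b x q \<and> off j q0 q \<and> (\<forall>p'. p' \<notin> E j \<longrightarrow> x p' = x0 p') \<and>
     (\<forall>p'\<in>E j. x p' \<le> 1) \<and> (\<forall>p'\<in>inner j. q (w p') = 0) \<and> 2 * (\<Sum>p'\<in>E j. x p') \<le> len j \<and>
     ((\<forall>p'\<in>inner j. q0 (w p') = 0) \<longrightarrow> x = x0)"

lemma solved_no_flip:
  assumes "solve_inv j q0 x0 b (fin j) q x c" "\<not> len j < c + c"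
  shows "solved j q0 x0 b q x"
proof -
  note s = assms(1)[unfolded solve_inv_def]
  have "2 * (\<Sum>p'\<in>E j. x p') \<le> len j" using s assms(2) by linarith
  moreover have "x p = x0 p" if "p \<notin> E j" for p using s that by (simp add: E_def)
  moreover have "q (w p) = 0" if "p \<in> inner j" for p using s that by (simp add: inner_def)
  ultimately show ?thesis unfolding solved_def using s by (intro conjI allI ballI impI) simp_all
qed

text \<open>Flipping the edges one after the other pushes a single defect along the ear. At the
  extremes \<open>p = st j\<close> and \<open>p = fin j\<close> no internal vertex is at
  \<open>p\<close>, so a complete sweep starts and ends without internal defects.\<close>

definition sweep :: "nat \<Rightarrow> nat \<Rightarrow> (nat \<Rightarrow> nat) \<Rightarrow> bool" where
  "sweep j p q \<longleftrightarrow> (\<forall>p'\<in>inner j. q (w p') = (if p' = p then 1 else 0))"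

lemma sweep_toggle:
  assumes j: "j < k" and p: "p \<in> E j" and s: "sweep j p q"
  shows "sweep j (Suc p) (toggle p q)"
  unfolding sweep_def
proof
  fix p' assume p': "p' \<in> inner j"
  have "p \<in> {st j..fin j}" "Suc p \<in> {st j..fin j}" using p by (auto simp: E_def)
  then have "w p = w p' \<longleftrightarrow> p = p'" "w (Suc p) = w p' \<longleftrightarrow> Suc p = p'"
    using inner_unique_same[OF j p'] by metis+
  then show "toggle p q (w p') = (if p' = Suc p then 1 else 0)"
    using s p' E_EE[OF j p] by (auto simp: toggle_apply sweep_def)
qed

definition flip_inv where
  "flip_inv j q0 x1 b p q x \<longleftrightarrow> parity b x q \<and> off j q0 q \<and> sweep j p q \<and>
     (\<forall>p'. x p' = (if p' \<in> {st j..<p} then 1 - x1 p' else x1 p'))"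

lemma flip_inv_init:
  assumes "solve_inv j q0 x0 b (fin j) q x c"
  shows "flip_inv j q0 x b (st j) q x"
proof -
  note s = assms[unfolded solve_inv_def]
  have "sweep j (st j) q" using s by (simp add: sweep_def inner_def)
  then show ?thesis unfolding flip_inv_def using s by simp
qed

lemma flip_inv_step:
  assumes "j < k" "p \<in> E j" "flip_inv j q0 x1 b p q x" "\<forall>p'\<in>E j. x1 p' \<le> 1"
  shows "flip_inv j q0 x1 b (Suc p) (toggle p q) (x(p := 1 - x p))"
proof -
  note f = assms(3)[unfolded flip_inv_def]
  have p: "st j \<le> p" using assms(2) by (simp add: E_def)
  have xp: "x p = x1 p" using f by simp
  have "parity b (x(p := 1 - x p)) (toggle p q)"
    using f xp assms(2,4) E_EE[OF assms(1,2)] by (intro parity_toggle) auto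
  moreover have "(x(p := 1 - x p)) p' = (if p' \<in> {st j..<Suc p} then 1 - x1 p' else x1 p')" for p'
    using f xp p by (cases "p' = p") auto
  ultimately show ?thesis unfolding flip_inv_def
    using f off_toggle[OF assms(1,2)] sweep_toggle[OF assms(1,2)] by simp
qed

text \<open>The numbers of edges taken before and after add up to \<open>len j\<close>, so flipping
  a majority leaves a minority. An ear without defects would have \<open>c = 0\<close>, so the last
  clause of \<open>solved\<close> is vacuous here.\<close>

lemma solved_flip:
  assumes j: "j < k" and x0: "\<forall>p\<in>E j. x0 p = 0"
    and s: "solve_inv j q0 x0 b (fin j) q1 x1 c" and c: "len j < c + c"
    and f: "flip_inv j q0 x1 b (fin j) q x"
  shows "solved j q0 x0 b q x"
proof -
  note s' = s[unfolded solve_inv_def] and f' = f[unfolded flip_inv_def]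
  have xx: "x p = 1 - x1 p" if "p \<in> E j" for p using f' that by (auto simp: E_def)
  have "(\<Sum>p\<in>E j. x p) + c = (\<Sum>p\<in>E j. x p + x1 p)"
    using s' by (simp add: sum.distrib)
  also have "\<dots> = (\<Sum>p\<in>E j. 1)" using xx s' by (intro sum.cong) auto
  finally have "(\<Sum>p\<in>E j. x p) + c = len j" by (simp add: card_E)
  then have "2 * (\<Sum>p\<in>E j. x p) \<le> len j" using c by simp
  moreover have "\<not> (\<forall>p'\<in>inner j. q0 (w p') = 0)"
  proof
    assume "\<forall>p'\<in>inner j. q0 (w p') = 0"
    then have "c = 0" using s' x0 by simp
    then show False using c by simp
  qed
  moreover have "x p = x0 p" if "p \<notin> E j" for p using f' s' that by (auto simp: E_def)
  moreover have "q (w p) = 0" if "p \<in> inner j" for p using f' that by (auto simp: sweep_def inner_def)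
  ultimately show ?thesis unfolding solved_def using f' xx by auto
qed

section \<open>Component labels\<close>

definition bset :: "(nat \<Rightarrow> nat) \<Rightarrow> nat set" where
  "bset b = {p \<in> EE. b p = 1}"

definition lab_inv :: "(nat \<Rightarrow> nat) \<Rightarrow> nat set \<Rightarrow> bool" where
  "lab_inv lab S \<longleftrightarrow> (\<forall>u<n. \<forall>v<n. lab u = lab v \<longleftrightarrow> conn w S u v)"

text \<open>The guard \<open>i < n\<close> mirrors the range of the relabelling loop in
  \<open>merge_com\<close>.\<close>

definition merged :: "nat \<Rightarrow> (nat \<Rightarrow> nat) \<Rightarrow> nat \<Rightarrow> nat" where
  "merged p lab = (\<lambda>i. if i < n \<and> lab i = lab (w p) then lab (w (Suc p)) else lab i)"

lemma bset_insert: "p \<in> EE \<Longrightarrow> b p = 0 \<Longrightarrow> bset (b(p := 1 - b p)) = insert p (bset b)"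
  by (auto simp: bset_def)

lemma EE_less_n: "p \<in> EE \<Longrightarrow> w p < n \<and> w (Suc p) < n"
proof -
  assume "p \<in> EE"
  then obtain j where "j < k" "p \<in> E j" by (auto simp: EE_def)
  then show ?thesis using w_less[of j p] w_less[of j "Suc p"] by (auto simp: E_def)
qed

lemma lab_merged:
  assumes "lab_inv lab S" "p \<in> EE"
  shows "lab_inv (merged p lab) (insert p S)"
  unfolding lab_inv_def
proof (intro allI impI)
  fix u v assume uv: "u < n" "v < n"
  have l: "\<And>u v. u < n \<Longrightarrow> v < n \<Longrightarrow> conn w S u v \<longleftrightarrow> lab u = lab v"
    using assms by (auto simp: lab_inv_def)
  show "(merged p lab u = merged p lab v) = conn w (insert p S) u v"
    using uv EE_less_n[OF assms(2)] unfolding conn_insert merged_def by (auto simp: l)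
qed

text \<open>Each edge of a pendant ear is flipped exactly once, in \<open>b\<close> or (only the first edge with
  \<open>x1 p = 1\<close>, which thereby loses both copies) in \<open>x\<close>. So the parities at internal vertices
  stay right; \<open>sweep\<close> says that in between only the current vertex is wrong.\<close>

definition finish_inv where
  "finish_inv j q0 x1 b1 p q lab b x d \<longleftrightarrow> parity b x q \<and> off j q0 q \<and> sweep j p q \<and>
     lab_inv lab (bset b) \<and> (\<forall>p'. p' \<notin> {st j..<p} \<longrightarrow> x p' = x1 p' \<and> b p' = b1 p') \<and>
     (d = (0::nat) \<and> (\<forall>p'\<in>{st j..<p}. x1 p' = 0 \<and> x p' = 0 \<and> b p' = 1) \<or>
      d = 1 \<and> (\<exists>e\<in>{st j..<p}. x1 e = 1 \<and> b e = 0 \<and> x e = 0 \<and>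
        (\<forall>p'\<in>{st j..<p}. p' \<noteq> e \<longrightarrow> b p' = 1 \<and> x p' = x1 p')))"

lemma finish_inv_init:
  assumes "solved j q0 x0 b q x" "lab_inv lab (bset b)"
  shows "finish_inv j q x b (st j) q lab b x 0"
proof -
  note s = assms(1)[unfolded solved_def]
  have "sweep j (st j) q" using s by (simp add: sweep_def inner_def)
  then show ?thesis unfolding finish_inv_def using s assms(2) by simp
qed

text \<open>Removing the second copy without adding the first is the move that saves two edges. It
  flips one copy of the edge, just as taking the first copy would, so the sweep continues
  undisturbed; \<open>b\<close>, and with it the labelling, stays the same.\<close>

lemma finish_inv_drop:
  assumes j: "j < k" and p: "p \<in> E j" and inv: "finish_inv j q0 x1 b1 p q lab b x 0" and x: "x p = 1"
    and b: "\<forall>p\<in>E j. b1 p = 0"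
  shows "finish_inv j q0 x1 b1 (Suc p) (toggle p q) lab b (x(p := 1 - x p)) 1"
proof -
  note inv' = inv[unfolded finish_inv_def]
  have "parity b (x(p := 1 - x p)) (toggle p q)" using inv' p x E_EE[OF j p] by (intro parity_toggle) auto
  moreover have "off j q0 (toggle p q)" "sweep j (Suc p) (toggle p q)"
    using inv' off_toggle[OF j p] sweep_toggle[OF j p] by auto
  moreover have "x1 p = 1" "b p = 0" using inv' x b p by auto
  moreover have "p \<in> {st j..<Suc p}" using p by (auto simp: E_def)
  ultimately show ?thesis unfolding finish_inv_def using inv' x
    by (auto intro!: bexI[of _ p])
qed

lemma finish_inv_take:
  assumes j: "j < k" and p: "p \<in> E j" and inv: "finish_inv j q0 x1 b1 p q lab b x d"
    and x: "\<not> (x p = 1 \<and> d = 0)" and b: "\<forall>p\<in>E j. b1 p = 0 \<and> x1 p \<le> 1"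
  shows "finish_inv j q0 x1 b1 (Suc p) (toggle p q) (merged p lab) (b(p := 1 - b p)) x d"
proof -
  note inv' = inv[unfolded finish_inv_def]
  have bp: "b p = 0" "x p = x1 p" using inv' b p by auto
  \<comment> \<open>As \<open>parity\<close> is symmetric in the two copies, the rule for flipping
    the second copy is applied with the roles exchanged.\<close>
  have "parity x (b(p := 1 - b p)) (toggle p q)"
    using inv' p E_EE[OF j p] bp by (intro parity_toggle) (auto simp: parity_commute)
  moreover have "off j q0 (toggle p q)" "sweep j (Suc p) (toggle p q)"
    using inv' off_toggle[OF j p] sweep_toggle[OF j p] by auto
  moreover have "lab_inv (merged p lab) (bset (b(p := 1 - b p)))"
    using inv' lab_merged[of lab "bset b" p] bset_insert[of p b] E_EE[OF j p] bp by simp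
  moreover have "st j \<le> p" using p by (auto simp: E_def)
  moreover have "x1 p \<le> 1" using b p by blast
  moreover have "d = 0 \<and> (\<forall>p'\<in>{st j..<Suc p}. x1 p' = 0 \<and> x p' = 0 \<and> (b(p := 1 - b p)) p' = 1) \<or>
      d = 1 \<and> (\<exists>e\<in>{st j..<Suc p}. x1 e = 1 \<and> (b(p := 1 - b p)) e = 0 \<and> x e = 0 \<and>
        (\<forall>p'\<in>{st j..<Suc p}. p' \<noteq> e \<longrightarrow> (b(p := 1 - b p)) p' = 1 \<and> x p' = x1 p'))"
  proof (cases "d = 0")
    case True
    then have "x p = 0" using x \<open>x1 p \<le> 1\<close> bp by simp
    moreover have "\<forall>p'\<in>{st j..<p}. x1 p' = 0 \<and> x p' = 0 \<and> b p' = 1" using inv' True by simp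
    ultimately show ?thesis using True bp by (auto simp: less_Suc_eq)
  next
    case False
    then obtain e where "d = 1" "e \<in> {st j..<p}" "x1 e = 1" "b e = 0" "x e = 0"
      "\<forall>p'\<in>{st j..<p}. p' \<noteq> e \<longrightarrow> b p' = 1 \<and> x p' = x1 p'" using inv' by blast
    then show ?thesis using bp by (intro disjI2 conjI bexI[of _ e]) (auto simp: less_Suc_eq)
  qed
  moreover have "\<forall>p'. p' \<notin> {st j..<Suc p} \<longrightarrow> x p' = x1 p' \<and> (b(p := 1 - b p)) p' = b1 p'"
  proof -
    have "\<forall>p'. p' \<notin> {st j..<p} \<longrightarrow> x p' = x1 p' \<and> b p' = b1 p'" using inv' by blast
    then show ?thesis using \<open>st j \<le> p\<close> by auto
  qed
  ultimately show ?thesis unfolding finish_inv_def parity_commute[of "b(p := 1 - b p)"] by blast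
qed

section \<open>The pass over the pendant ears\<close>

definition finished where
  "finished j x1 b x \<longleftrightarrow> (\<forall>p\<in>E j. x1 p = 0 \<and> x p = 0 \<and> b p = 1) \<or>
     (\<exists>e\<in>E j. x1 e = 1 \<and> b e = 0 \<and> x e = 0 \<and> (\<forall>p\<in>E j. p \<noteq> e \<longrightarrow> b p = 1 \<and> x p = x1 p))"

lemma finish_inv_finished: "finish_inv j q0 x1 b1 (fin j) q lab b x d \<Longrightarrow> finished j x1 b x"
  unfolding finish_inv_def finished_def E_def by blast

text \<open>The summand 2 on the left replaces the subtractions in
  \<open>(l - 1) + l div 2 - 1\<close>, which would be truncated. The single exception
  \<open>e\<close> is what connectivity can tolerate, and the last clause makes the earmuff part of
  the edges taken.\<close>

definition ear_ok where
  "ear_ok j b x \<longleftrightarrow> (\<forall>p\<in>E j. b p \<le> 1 \<and> x p \<le> 1) \<and> (\<exists>e. \<forall>p\<in>E j. p \<noteq> e \<longrightarrow> b p = 1) \<and>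
     (\<Sum>p\<in>E j. b p + x p) + 2 \<le> len j + len j div 2 + (if clean j then 1 else 0) \<and>
     (clean j \<longrightarrow> (\<forall>p\<in>E j. b p = 1))"

lemma finished_ok:
  assumes j: "j < k" and f: "finished j x1 b x" and half: "2 * (\<Sum>p\<in>E j. x1 p) \<le> len j"
    and x1: "\<forall>p\<in>E j. x1 p \<le> 1" and c: "clean j \<Longrightarrow> \<forall>p\<in>E j. x1 p = 0"
    and nc: "len j \<le> 3 \<Longrightarrow> \<not> clean j \<Longrightarrow> \<exists>p\<in>E j. x1 p = 1"
  shows "ear_ok j b x"
  using f[unfolded finished_def]
proof
  assume a: "\<forall>p\<in>E j. x1 p = 0 \<and> x p = 0 \<and> b p = 1"
  then have "(\<Sum>p\<in>E j. b p + x p) = len j" by (simp add: card_E)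
  \<comment> \<open>With nothing dropped the ear costs \<open>len j\<close>. From length 4 on,
    \<open>len j div 2\<close> pays for the 2; for a shorter ear it is 1, but then the ear is clean
    by \<open>nc\<close> and may cost one more.\<close>
  moreover have "len j + 2 \<le> len j + len j div 2 + (if clean j then 1 else 0)"
    using nc a len_ge[OF j] by (cases "len j \<le> 3"; cases "clean j") (auto simp: clean_def)
  ultimately show ?thesis unfolding ear_ok_def using a by auto
next
  assume "\<exists>e\<in>E j. x1 e = 1 \<and> b e = 0 \<and> x e = 0 \<and> (\<forall>p\<in>E j. p \<noteq> e \<longrightarrow> b p = 1 \<and> x p = x1 p)"
  then obtain e where e: "e \<in> E j" "x1 e = 1" "b e = 0" "x e = 0"
    "\<forall>p\<in>E j. p \<noteq> e \<longrightarrow> b p = 1 \<and> x p = x1 p" by blast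
  \<comment> \<open>The two dropped copies of \<open>e\<close> are put back into the sum, which then
    is \<open>len j\<close> plus the size of \<open>J\<close>.\<close>
  have "(\<Sum>p\<in>E j. b p + x p) + 2 = (\<Sum>p\<in>E j - {e}. b p + x p) + 2"
    using e by (simp add: sum.remove[of _ e])
  also have "\<dots> = (\<Sum>p\<in>E j - {e}. 1 + x1 p) + (1 + x1 e)"
    using e by (auto intro!: sum.cong)
  also have "\<dots> = (\<Sum>p\<in>E j. 1 + x1 p)" using e by (simp add: sum.remove[of _ e])
  also have "\<dots> = len j + (\<Sum>p\<in>E j. x1 p)" by (simp only: sum.distrib) (simp add: card_E)
  finally have s: "(\<Sum>p\<in>E j. b p + x p) + 2 = len j + (\<Sum>p\<in>E j. x1 p)" .
  have "\<not> clean j" using c e by auto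
  moreover have "b p \<le> 1 \<and> x p \<le> 1" if "p \<in> E j" for p using e x1 that by (cases "p = e") auto
  ultimately show ?thesis unfolding ear_ok_def using e s half by auto
qed

lemma ear_ok_cong: "(\<And>p. p \<in> E j \<Longrightarrow> b p = b' p \<and> x p = x' p) \<Longrightarrow> ear_ok j b x \<longleftrightarrow> ear_ok j b' x'"
  unfolding ear_ok_def by (auto cong: sum.cong)

text \<open>The last clause survives because no nontrivial ear ends inside a pendant one. Through
  it, being clean, a condition on \<open>\<tau>\<close>, can be compared with \<open>q\<close> when
  the turn of the ear comes.\<close>

definition pendant_inv where
  "pendant_inv j q lab b x np \<longleftrightarrow> parity b x q \<and> lab_inv lab (bset b) \<and>
     (\<forall>i<j. np i = (if pendant i then 0 else (1::nat))) \<and>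
     (\<forall>p<st k. (\<forall>i<j. pendant i \<longrightarrow> p \<notin> E i) \<longrightarrow> b p = 0 \<and> x p = 0) \<and>
     (\<forall>i<j. pendant i \<longrightarrow> ear_ok i b x \<and> (\<forall>p\<in>inner i. q (w p) = 0)) \<and>
     (\<forall>i<k. j \<le> i \<longrightarrow> pendant i \<longrightarrow> (\<forall>p\<in>inner i. q (w p) = \<tau> (w p)))"

lemma inner_less_n: "j < k \<Longrightarrow> p \<in> inner j \<Longrightarrow> w p < n"
  using w_less[of j p] by (auto simp: inner_def)

lemma pendant_inv_init:
  assumes "\<And>v. v < n \<Longrightarrow> q v = \<tau> v" "\<And>v. v < n \<Longrightarrow> lab v = v" "\<And>p. p < st k \<Longrightarrow> b p = 0 \<and> x p = 0"
  shows "pendant_inv 0 q lab b x np"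
proof -
  have z: "\<forall>p\<in>EE. b p = 0 \<and> x p = 0" using EE_less assms(3) by blast
  have "dg b v = 0" "dg x v = 0" for v using z by (simp_all add: dg_def)
  then have "parity b x q" using assms(1) demand_le by (simp add: parity_def)
  moreover have "bset b = {}" using z by (auto simp: bset_def)
  then have "lab_inv lab (bset b)" using assms(2) by (simp add: lab_inv_def conn_def link_def)
  moreover have "q (w p) = \<tau> (w p)" if "i < k" "p \<in> inner i" for i p using inner_less_n that assms(1) by blast
  ultimately show ?thesis using assms(3) by (simp add: pendant_inv_def)
qed

lemma pendant_inv_zero: "pendant_inv j q lab b x np \<Longrightarrow> j < k \<Longrightarrow> p \<in> E j \<Longrightarrow> b p = 0 \<and> x p = 0"
  using E_unique[of _ j p] EE_less[OF E_EE, of j p] unfolding pendant_inv_def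
  by (metis less_trans nat_neq_iff)

lemma pendant_inv_pendant:
  assumes j: "j < k" and pj: "pendant j" and A: "pendant_inv j q0 lab0 b0 x0 np"
    and S: "solved j q0 x0 b0 q1 x1" and F: "finish_inv j q1 x1 b0 (fin j) q lab b x d"
    and np: "np' = np(j := 0)"
  shows "pendant_inv (Suc j) q lab b x np'"
proof -
  note A' = A[unfolded pendant_inv_def] and S' = S[unfolded solved_def] and F' = F[unfolded finish_inv_def]
  have z: "b0 p = 0 \<and> x0 p = 0" if "p \<in> E j" for p using pendant_inv_zero[OF A j that] .
  have off1: "off j q0 q" using S' F' off_trans by blast
  have q0: "q0 (w p) = \<tau> (w p)" if "p \<in> inner j" for p using A' j pj that by blast
  have same: "b p = b0 p \<and> x p = x0 p" if "p \<notin> E j" for p using S' F' that by (simp add: E_def)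
  have "ear_ok j b x"
  proof (rule finished_ok[OF j finish_inv_finished[OF F]])
    show "2 * (\<Sum>p\<in>E j. x1 p) \<le> len j" "\<forall>p\<in>E j. x1 p \<le> 1" using S' by auto
    show "\<forall>p\<in>E j. x1 p = 0" if "clean j"
    proof -
      have "\<forall>p\<in>inner j. q0 (w p) = 0" using that q0 by (simp add: clean_def)
      then have "x1 = x0" using S' by blast
      then show ?thesis using z by simp
    qed
    show "\<exists>p\<in>E j. x1 p = 1" if "len j \<le> 3" "\<not> clean j"
    proof (rule ccontr)
      assume "\<not> ?thesis"
      \<comment> \<open>If solving took no edge, then by \<open>parity_unique\<close>
        \<open>q1\<close> agrees with \<open>q0\<close>, that is with \<open>\<tau>\<close>, inside
        the ear. Since \<open>q1\<close> vanishes there, the ear would be clean.\<close>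
      then have "x1 p = x0 p" for p using S' z[of p] by (cases "p \<in> E j") (auto simp: le_Suc_eq)
      then have "x1 = x0" by auto
      then have "parity b0 x0 q1" using S' by simp
      then have "q0 (w p) = q1 (w p)" if "p \<in> inner j" for p
        using parity_unique[of b0 x0 q0 q1 "w p"] A' inner_less_n[OF j that] by simp
      then have "\<forall>p\<in>inner j. \<tau> (w p) = 0" using S' q0 by simp
      then show False using that by (simp add: clean_def)
    qed
  qed
  moreover have "ear_ok i b x" if "i < j" "pendant i" for i
  proof -
    have "ear_ok i b0 x0" using A' that by blast
    moreover have "p \<notin> E j" if "p \<in> E i" for p using E_unique[of i j p] \<open>i < j\<close> j that by auto
    ultimately show ?thesis using ear_ok_cong[of i b b0 x x0] same by blast
  qed
  moreover have "q (w p) = q0 (w p)" if "i < k" "i \<noteq> j" "pendant i" "p \<in> inner i" for i p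
    using off_inner[OF off1 that(1) j that(4,2)] that(3) by simp
  moreover have "q (w p) = 0" if "p \<in> inner j" for p using F' that by (auto simp: sweep_def inner_def)
  moreover have "np' i = (if pendant i then 0 else 1)" if "i < Suc j" for i
    using A' np that pj by (auto simp: less_Suc_eq)
  moreover have "b p = 0 \<and> x p = 0" if "p < st k" "\<forall>i<Suc j. pendant i \<longrightarrow> p \<notin> E i" for p
    using A' same[of p] that pj by simp
  ultimately show ?thesis unfolding pendant_inv_def using A' F' j
    by (simp add: less_Suc_eq) (metis Suc_le_eq less_irrefl less_trans nat_less_le)
qed

lemma pendant_inv_skip:
  assumes j: "j < k" and pj: "\<not> pendant j" and A: "pendant_inv j q lab b x np" and np: "np' = np(j := 1)"
  shows "pendant_inv (Suc j) q lab b x np'"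
  using assms unfolding pendant_inv_def by (simp add: less_Suc_eq)

section \<open>The forest on the nonpendant ears\<close>

definition NP :: "nat set" where
  "NP = (\<Union>j\<in>{j. j < k \<and> \<not> pendant j}. E j)"

lemma NP_EE: "p \<in> NP \<Longrightarrow> p \<in> EE"
  by (auto simp: NP_def EE_def)

lemma finite_NP [simp]: "finite NP"
  by (auto simp: NP_def)

lemma NP_not_pendant: "p \<in> NP \<Longrightarrow> j < k \<Longrightarrow> pendant j \<Longrightarrow> p \<notin> E j"
  using E_unique by (auto simp: NP_def)

text \<open>A nonpendant ear has no vertex inside a pendant one, so the forest pass preserves what
  the pendant pass has achieved.\<close>

lemma toggle_pendant:
  assumes "p \<in> NP" "i < k" "pendant i" "p' \<in> inner i"
  shows "toggle p q (w p') = q (w p')"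
proof -
  obtain j where j: "j < k" "\<not> pendant j" "p \<in> E j" using assms(1) by (auto simp: NP_def)
  then have "i \<noteq> j" using assms(3) by blast
  show ?thesis
    using off_inner[OF off_toggle[OF j(1,3) off_refl] assms(2) j(1) assms(4) \<open>i \<noteq> j\<close>] assms(3) by simp
qed

end

text \<open>The earmuff enters only the analysis: the program takes all clean ears completely, whether
  or not they belong to it.\<close>

locale muff_list = ear_list +
  fixes muff :: "nat set"
  assumes muff_clean: "j \<in> muff \<Longrightarrow> j < k \<and> clean j"
    and muff_indep: "indep w (\<Union>j\<in>muff. E j)"
begin

definition muff_edges :: "nat set" where
  "muff_edges = (\<Union>j\<in>muff. E j)"

text \<open>Independence is claimed only for the new edges with the earmuff, whereas the labels
  refer to all of \<open>bset b\<close>: the pendant ears together may contain circuits, for example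
  two clean ears with the same two ends.\<close>

definition tree_inv where
  "tree_inv P q lab b x \<longleftrightarrow> parity b x q \<and> lab_inv lab (bset b) \<and>
     (\<forall>i<k. pendant i \<longrightarrow> ear_ok i b x \<and> (\<forall>p\<in>inner i. q (w p) = 0)) \<and>
     (\<forall>p<st k. p \<notin> EE \<longrightarrow> b p = 0 \<and> x p = 0) \<and>
     (\<forall>p\<in>NP. b p \<le> 1 \<and> (P \<le> p \<longrightarrow> b p = 0) \<and> x p = 0) \<and>
     (\<forall>p\<in>NP. p < P \<longrightarrow> conn w (bset b) (w p) (w (Suc p))) \<and>
     indep w (muff_edges \<union> {p \<in> NP. b p = 1})"

text \<open>An earmuff ear is clean, hence short, hence pendant, and \<open>ear_ok\<close> takes
  clean ears completely. Through this inclusion the program respects an earmuff that it does not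
  know.\<close>

lemma muff_subset_bset:
  assumes "\<And>i. i < k \<Longrightarrow> pendant i \<Longrightarrow> ear_ok i b x"
  shows "muff_edges \<union> {p \<in> NP. b p = 1} \<subseteq> bset b"
proof -
  have "b p = 1" if "j \<in> muff" "p \<in> E j" for j p
    using assms[of j] that muff_clean[of j] short_pendant[of j] by (auto simp: ear_ok_def clean_def)
  then show ?thesis using muff_clean E_EE NP_EE by (fastforce simp: muff_edges_def bset_def)
qed

lemma tree_inv_init:
  assumes "pendant_inv k q lab b x np"
  shows "tree_inv (st 0) q lab b x"
proof -
  note A = assms[unfolded pendant_inv_def]
  have z: "b p = 0 \<and> x p = 0" if "p \<in> NP" for p
    using A NP_EE[THEN EE_less, OF that] NP_not_pendant[OF that] by blast
  have "b p = 0 \<and> x p = 0" if "p < st k" "p \<notin> EE" for p using A that E_EE by blast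
  moreover have "st 0 \<le> p" if "p \<in> NP" for p
  proof -
    from that obtain j where "j < k" "p \<in> E j" by (auto simp: NP_def)
    then show ?thesis using st_mono[of 0 j] by (auto simp: E_def)
  qed
  moreover have "{p \<in> NP. b p = 1} = {}" using z by auto
  then have "muff_edges \<union> {p \<in> NP. b p = 1} = (\<Union>j\<in>muff. E j)"
    by (simp only: muff_edges_def Un_empty_right)
  then have "indep w (muff_edges \<union> {p \<in> NP. b p = 1})" using muff_indep by (simp only:)
  moreover have "parity b x q" "lab_inv lab (bset b)"
    "\<forall>i<k. pendant i \<longrightarrow> ear_ok i b x \<and> (\<forall>p\<in>inner i. q (w p) = 0)" using A by blast+
  moreover have "\<forall>p\<in>NP. b p \<le> 1 \<and> (st 0 \<le> p \<longrightarrow> b p = 0) \<and> x p = 0" using z by simp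
  ultimately show ?thesis unfolding tree_inv_def by (meson leD)
qed

lemma tree_inv_mono:
  assumes "tree_inv P q lab b x" "P \<le> P'" "\<And>p. p \<in> NP \<Longrightarrow> P \<le> p \<Longrightarrow> P' \<le> p"
  shows "tree_inv P' q lab b x"
proof -
  note B = assms(1)[unfolded tree_inv_def]
  have "\<forall>p\<in>NP. b p \<le> 1 \<and> (P' \<le> p \<longrightarrow> b p = 0) \<and> x p = 0" using B assms(2) by (meson order_trans)
  moreover have "\<forall>p\<in>NP. p < P' \<longrightarrow> conn w (bset b) (w p) (w (Suc p))" using B assms(3) by (meson leD leI)
  ultimately show ?thesis unfolding tree_inv_def using B by (intro conjI) simp_all
qed

text \<open>Pendant ears and the last position of an ear carry no edge of \<open>NP\<close>, so the
  scan may jump over them.\<close>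

lemma tree_inv_next:
  assumes "tree_inv P q lab b x" "j < k" "P = st j \<and> pendant j \<or> P = fin j"
  shows "tree_inv (st (Suc j)) q lab b x"
proof (rule tree_inv_mono[OF assms(1)])
  show "P \<le> st (Suc j)" using assms st_fin[of j] by auto
  fix p assume p: "p \<in> NP" "P \<le> p"
  then obtain i where i: "i < k" "\<not> pendant i" "p \<in> E i" by (auto simp: NP_def)
  show "st (Suc j) \<le> p"
  proof (rule ccontr)
    assume "\<not> ?thesis"
    then have "p \<in> {st j..fin j}" using p(2) assms(2,3) st_fin[of j] by auto
    then have "i = j" using pos_unique[of i j p] i assms(2) by (auto simp: E_def)
    then show False using i p(2) assms(3) by (auto simp: E_def)
  qed
qed

lemma tree_inv_take:
  assumes B: "tree_inv p q lab b x" and j: "j < k" "\<not> pendant j" "p \<in> E j"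
    and l: "lab (w p) \<noteq> lab (w (Suc p))"
  shows "tree_inv (Suc p) (toggle p q) (merged p lab) (b(p := 1 - b p)) x"
proof -
  note B' = B[unfolded tree_inv_def]
  let ?b = "b(p := 1 - b p)"
  have p: "p \<in> NP" "p \<in> EE" using j E_EE by (auto simp: NP_def)
  have bp: "b p = 0" using B' p by blast
  have bset: "bset ?b = insert p (bset b)" using p(2) bp by (rule bset_insert)
  have sub: "muff_edges \<union> {p \<in> NP. b p = 1} \<subseteq> bset b"
    by (rule muff_subset_bset) (use B' in blast)
  have "\<not> conn w (bset b) (w p) (w (Suc p))"
    using B' l EE_less_n[OF p(2)] unfolding lab_inv_def by blast
  \<comment> \<open>Different components of \<open>bset b\<close> are also different components of
    the smaller set that has to stay independent.\<close>
  then have "\<not> conn w (muff_edges \<union> {p \<in> NP. b p = 1}) (w p) (w (Suc p))"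
    using conn_mono[OF sub, of w "w p" "w (Suc p)"] by blast
  then have "indep w (insert p (muff_edges \<union> {p \<in> NP. b p = 1}))"
    using B' by (intro indep_insert) auto
  moreover have "insert p (muff_edges \<union> {p \<in> NP. b p = 1}) = muff_edges \<union> {p \<in> NP. ?b p = 1}"
    using p bp by auto
  ultimately have 1: "indep w (muff_edges \<union> {p \<in> NP. ?b p = 1})" by simp
  have "parity x ?b (toggle p q)"
    using B' p bp by (intro parity_toggle) (auto simp: parity_commute)
  then have 2: "parity ?b x (toggle p q)" by (simp add: parity_commute)
  have 3: "lab_inv (merged p lab) (bset ?b)" using B' lab_merged p bset by simp
  have 4: "conn w (bset ?b) (w p') (w (Suc p'))" if "p' \<in> NP" "p' < Suc p" for p'
  proof (cases "p' = p")
    case True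
    then show ?thesis using bset by (intro conn_edge) auto
  next
    case False
    then have "conn w (bset b) (w p') (w (Suc p'))" using B' that by simp
    then show ?thesis using bset by (auto intro: conn_mono[of "bset b"])
  qed
  have 5: "ear_ok i ?b x \<and> (\<forall>p'\<in>inner i. toggle p q (w p') = 0)" if "i < k" "pendant i" for i
  proof -
    have "ear_ok i b x" "\<forall>p'\<in>inner i. q (w p') = 0" using B' that by blast+
    moreover have "?b p' = b p'" if "p' \<in> E i" for p'
      using NP_not_pendant[OF p(1) \<open>i < k\<close> \<open>pendant i\<close>] that by auto
    ultimately show ?thesis
      using ear_ok_cong[of i ?b b x x] toggle_pendant[OF p(1) that] by simp
  qed
  have "\<forall>p'\<in>NP. b p' \<le> 1 \<and> (p \<le> p' \<longrightarrow> b p' = 0) \<and> x p' = 0" using B' by blast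
  then have 6: "\<forall>p'\<in>NP. ?b p' \<le> 1 \<and> (Suc p \<le> p' \<longrightarrow> ?b p' = 0) \<and> x p' = 0" by simp
  have "\<forall>p<st k. p \<notin> EE \<longrightarrow> b p = 0 \<and> x p = 0" using B' by blast
  then have 7: "\<forall>p'<st k. p' \<notin> EE \<longrightarrow> ?b p' = 0 \<and> x p' = 0" using p by auto
  have "\<forall>i<k. pendant i \<longrightarrow> ear_ok i ?b x \<and> (\<forall>p'\<in>inner i. toggle p q (w p') = 0)"
    by (intro allI impI) (rule 5)
  moreover have "\<forall>p'\<in>NP. p' < Suc p \<longrightarrow> conn w (bset ?b) (w p') (w (Suc p'))"
    by (intro ballI impI) (rule 4)
  ultimately show ?thesis unfolding tree_inv_def using 1 2 3 6 7 by (intro conjI)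
qed

lemma tree_inv_skip:
  assumes B: "tree_inv p q lab b x" and j: "j < k" "p \<in> E j" and l: "lab (w p) = lab (w (Suc p))"
  shows "tree_inv (Suc p) q lab b x"
proof -
  note B' = B[unfolded tree_inv_def]
  have "conn w (bset b) (w p) (w (Suc p))"
    using B' l EE_less_n[OF E_EE[OF j]] unfolding lab_inv_def by blast
  then show ?thesis unfolding tree_inv_def using B' by (auto simp: less_Suc_eq)
qed

section \<open>Second copies on the nonpendant ears, in reverse order\<close>

definition join_inv where
  "join_inv i b q x \<longleftrightarrow> parity b x q \<and> (\<forall>p<st k. p \<notin> EE \<longrightarrow> x p = 0) \<and>
     (\<forall>j<k. pendant j \<longrightarrow> ear_ok j b x \<and> (\<forall>p\<in>inner j. q (w p) = 0)) \<and>
     (\<forall>j<k. \<not> pendant j \<longrightarrow> k \<le> j + i \<longrightarrow>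
        (\<forall>p\<in>inner j. q (w p) = 0) \<and> (\<forall>p\<in>E j. x p \<le> 1) \<and> 2 * (\<Sum>p\<in>E j. x p) \<le> len j) \<and>
     (\<forall>j<k. \<not> pendant j \<longrightarrow> j + i < k \<longrightarrow> (\<forall>p\<in>E j. x p = 0))"

lemma join_inv_init: "tree_inv P q lab b x \<Longrightarrow> join_inv 0 b q x"
  unfolding tree_inv_def join_inv_def by (auto simp: NP_def)

lemma join_inv_skip:
  assumes "join_inv i b q x" "i < k" "pendant (k - 1 - i)"
  shows "join_inv (Suc i) b q x"
proof -
  note C = assms(1)[unfolded join_inv_def]
  have "k \<le> j + i" if "\<not> pendant j" "k \<le> j + Suc i" for j
  proof -
    have "j \<noteq> k - 1 - i" using that(1) assms(3) by blast
    then show ?thesis using that(2) assms(2) by linarith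
  qed
  moreover have "j + i < k" if "j + Suc i < k" for j using that by simp
  ultimately show ?thesis unfolding join_inv_def using C by blast
qed

text \<open>The condition \<open>k \<le> j + i\<close> in \<open>join_inv\<close> singles out the
  last \<open>i\<close> ears. These come after the current one, so \<open>off_inner\<close> protects
  them as well as all pendant ears; only nonpendant ears still to come can be spoilt inside.\<close>

lemma join_inv_solved:
  assumes C: "join_inv i b q0 x0" and i: "i < k" and j: "j = k - 1 - i" "\<not> pendant j"
    and S: "solved j q0 x0 b q x"
  shows "join_inv (Suc i) b q x"
proof -
  note C' = C[unfolded join_inv_def] and S' = S[unfolded solved_def]
  have jk: "j < k" using i j by simp
  have xs: "x p = x0 p" if "i' < k" "i' \<noteq> j" "p \<in> E i'" for i' p
    using S' E_unique[OF that(1) jk that(3)] that(2) by metis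
  have qs: "q (w p) = q0 (w p)" if "i' < k" "i' \<noteq> j" "p \<in> inner i'" "pendant i' \<or> j \<le> i'" for i' p
    using off_inner[OF _ that(1) jk that(3,2,4)] S' by blast
  have 1: "ear_ok i' b x \<and> (\<forall>p\<in>inner i'. q (w p) = 0)" if "i' < k" "pendant i'" for i'
  proof -
    have "i' \<noteq> j" using that j by blast
    then show ?thesis using C' ear_ok_cong[of i' b b x x0] xs qs that by simp
  qed
  have 2: "(\<forall>p\<in>inner i'. q (w p) = 0) \<and> (\<forall>p\<in>E i'. x p \<le> 1) \<and> 2 * (\<Sum>p\<in>E i'. x p) \<le> len i'"
    if "i' < k" "\<not> pendant i'" "k \<le> i' + Suc i" for i'
  proof (cases "i' = j")
    case True
    then show ?thesis using S' by simp
  next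
    case False
    then have "k \<le> i' + i" "j \<le> i'" using that(3) j(1) i by auto
    then have "(\<forall>p\<in>inner i'. q0 (w p) = 0) \<and> (\<forall>p\<in>E i'. x0 p \<le> 1) \<and> 2 * (\<Sum>p\<in>E i'. x0 p) \<le> len i'"
      using C' that by blast
    moreover have "(\<Sum>p\<in>E i'. x p) = (\<Sum>p\<in>E i'. x0 p)" using xs[OF that(1) False] by simp
    ultimately show ?thesis using qs[OF that(1) False] xs[OF that(1) False] \<open>j \<le> i'\<close> by simp
  qed
  have 3: "x p = 0" if "i' < k" "\<not> pendant i'" "i' + Suc i < k" "p \<in> E i'" for i' p
  proof -
    have "i' \<noteq> j" "i' + i < k" using that j(1) by auto
    then have "x0 p = 0" using C' that by blast
    then show ?thesis using xs[OF that(1) \<open>i' \<noteq> j\<close> that(4)] by simp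
  qed
  have 4: "x p = 0" if "p < st k" "p \<notin> EE" for p
    using S' C' that E_EE[OF jk] by metis
  have 5: "parity b x q" using S' by blast
  have "\<forall>p<st k. p \<notin> EE \<longrightarrow> x p = 0" using 4 by simp
  moreover have "\<forall>j<k. pendant j \<longrightarrow> ear_ok j b x \<and> (\<forall>p\<in>inner j. q (w p) = 0)" using 1 by simp
  moreover have "\<forall>j<k. \<not> pendant j \<longrightarrow> k \<le> j + Suc i \<longrightarrow>
        (\<forall>p\<in>inner j. q (w p) = 0) \<and> (\<forall>p\<in>E j. x p \<le> 1) \<and> 2 * (\<Sum>p\<in>E j. x p) \<le> len j"
    by (intro allI impI) (rule 2)
  moreover have "\<forall>j<k. \<not> pendant j \<longrightarrow> j + Suc i < k \<longrightarrow> (\<forall>p\<in>E j. x p = 0)"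
    by (intro allI impI ballI) (rule 3)
  ultimately show ?thesis unfolding join_inv_def using 5 by (intro conjI)
qed

section \<open>Parity at the root, connectivity and the count\<close>

definition outcome :: "(nat \<Rightarrow> nat) \<Rightarrow> (nat \<Rightarrow> nat) \<Rightarrow> bool" where
  "outcome b x \<longleftrightarrow> (\<forall>p\<in>EE. b p \<le> 1 \<and> x p \<le> 1) \<and> (\<forall>p<st k. p \<notin> EE \<longrightarrow> b p = 0 \<and> x p = 0) \<and>
     (\<forall>v<n. even (\<tau> v + dg b v + dg x v)) \<and> (\<forall>u<n. \<forall>v<n. conn w (bset b) u v) \<and>
     (\<Sum>p\<in>EE. b p + x p) + card muff + card {j. j < k \<and> pendant j}
       \<le> (n - 1) + card {j. j < k \<and> clean j} + (\<Sum>j<k. len j div 2)"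

lemma sum_inc: "p \<in> EE \<Longrightarrow> (\<Sum>v<n. inc p v) = 2"
proof -
  assume p: "p \<in> EE"
  have "(\<Sum>v<n. inc p v) = (\<Sum>v\<in>{w p, w (Suc p)}. inc p v)"
    using EE_less_n[OF p] by (intro sum.mono_neutral_right) (auto simp: inc_def)
  then show ?thesis using adj_neq[OF p] by (simp add: inc_def)
qed

lemma sum_dg: "(\<Sum>v<n. dg y v) = 2 * (\<Sum>p\<in>EE. y p)"
proof -
  have "(\<Sum>v<n. dg y v) = (\<Sum>p\<in>EE. \<Sum>v<n. y p * inc p v)"
    unfolding dg_def by (rule sum.swap)
  also have "\<dots> = (\<Sum>p\<in>EE. y p * 2)"
    using sum_inc by (intro sum.cong) (simp_all add: sum_distrib_left[symmetric])
  finally show ?thesis by (simp add: sum_distrib_right[symmetric] mult.commute)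
qed

text \<open>Every vertex but the root is internal to some ear. By the handshake identity
  \<open>sum_dg\<close> and \<open>demand_even\<close> the number of defects is even, so the root
  cannot be the only one.\<close>

lemma parity_all_zero:
  assumes "parity b x q" "\<And>j p. j < k \<Longrightarrow> p \<in> inner j \<Longrightarrow> q (w p) = 0" "v < n"
  shows "q v = 0"
proof -
  have z: "q u = 0" if "u < n" "u \<noteq> r" for u
  proof -
    obtain j p where "j < k" "st j < p" "Suc p < st (Suc j)" "w p = u" using inner_cover \<open>u < n\<close> \<open>u \<noteq> r\<close> by blast
    then show ?thesis using assms(2)[of j p] st_fin(2)[of j] by (auto simp: inner_def)
  qed
  have "even (\<Sum>v<n. q v + \<tau> v + dg b v + dg x v)" using assms(1) by (intro dvd_sum) (auto simp: parity_def)
  then have "even (\<Sum>v<n. q v)" using demand_even by (simp add: sum.distrib sum_dg)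
  moreover have "(\<Sum>v<n. q v) = (\<Sum>v\<in>{r}. q v)"
    using root_less z by (intro sum.mono_neutral_right) auto
  ultimately have "even (q r)" by simp
  moreover have "q r \<le> 1" using assms(1) root_less by (simp add: parity_def)
  ultimately have "q r = 0" by (auto simp: le_Suc_eq)
  then show ?thesis using z assms(3) by blast
qed

lemma conn_path:
  assumes "\<And>p. a \<le> p \<Longrightarrow> p < c \<Longrightarrow> conn w S (w p) (w (Suc p))" "a \<le> c"
  shows "conn w S (w a) (w c)"
  using assms(2,1)
proof (induction c rule: dec_induct)
  case (step m)
  then have "conn w S (w a) (w m)" "conn w S (w m) (w (Suc m))" by auto
  then show ?case by (rule conn_trans)
qed simp

text \<open>Induction along the ears. In spite of the gap \<open>e\<close>, an internal vertex is
  joined to one end of its ear: to the first if it lies before the gap, to the last if behind it.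
  That end is the root or internal to an earlier ear.\<close>

lemma all_connected:
  assumes "\<And>j. j < k \<Longrightarrow> \<exists>e. \<forall>p\<in>E j. p \<noteq> e \<longrightarrow> conn w S (w p) (w (Suc p))" "v < n"
  shows "conn w S v r"
proof -
  have "\<forall>p\<in>inner j. conn w S (w p) r" if "j < k" for j
    using that
  proof (induction j rule: less_induct)
    case (less j)
    obtain e where e: "\<forall>p\<in>E j. p \<noteq> e \<longrightarrow> conn w S (w p) (w (Suc p))" using assms(1) less.prems by blast
    have end1: "conn w S (w a) r" if a: "a = st j \<or> a = fin j" for a
    proof -
      have "a = st j \<or> Suc a = st (Suc j)" using a st_fin(2)[OF less.prems] by auto
      then consider "w a = r" | i p where "i < j" "st i < p" "Suc p < st (Suc i)" "w a = w p"
        using endpoint[OF less.prems] by blast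
      then show ?thesis
      proof cases
        case 2
        then have "p \<in> inner i" using st_fin(2)[of i] less.prems by (auto simp: inner_def)
        then show ?thesis using less.IH[of i] 2 less.prems by simp
      qed simp
    qed
    show ?case
    proof
      fix p assume p: "p \<in> inner j"
      show "conn w S (w p) r"
      proof (cases "p \<le> e")
        case True
        have "conn w S (w (st j)) (w p)"
          by (rule conn_path) (use e p True in \<open>auto simp: E_def inner_def\<close>)
        then show ?thesis using end1[of "st j"] by (meson conn_sym conn_trans)
      next
        case False
        have "conn w S (w p) (w (fin j))"
          by (rule conn_path) (use e p False in \<open>auto simp: E_def inner_def\<close>)
        then show ?thesis using end1[of "fin j"] by (meson conn_trans)
      qed
    qed
  qed
  note inn = this
  show ?thesis
  proof (cases "v = r")
    case False
    then obtain j p where "j < k" "st j < p" "Suc p < st (Suc j)" "w p = v" using inner_cover assms(2) by blast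
    then show ?thesis using inn[of j] st_fin(2)[of j] by (auto simp: inner_def)
  qed simp
qed

lemma card_inner_image:
  assumes "J \<subseteq> {..<k}"
  shows "card (w ` (\<Union>j\<in>J. inner j)) = (\<Sum>j\<in>J. len j - 1)"
proof -
  have "inj_on w (\<Union>j\<in>J. inner j)"
  proof (rule inj_onI)
    fix p p' assume "p \<in> (\<Union>j\<in>J. inner j)" "p' \<in> (\<Union>j\<in>J. inner j)" "w p = w p'"
    then obtain i j where "i < k" "j < k" "p \<in> inner i" "p' \<in> inner j" using assms by auto
    then show "p = p'" using inner_inj[of i j p p'] st_fin(2) \<open>w p = w p'\<close> by (auto simp: inner_def)
  qed
  then have "card (w ` (\<Union>j\<in>J. inner j)) = card (\<Union>j\<in>J. inner j)" by (rule card_image)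
  also have "\<dots> = (\<Sum>j\<in>J. card (inner j))"
  proof (rule card_UN_disjoint)
    show "finite J" using assms finite_subset by blast
    show "\<forall>i\<in>J. \<forall>j\<in>J. i \<noteq> j \<longrightarrow> inner i \<inter> inner j = {}"
      using assms E_unique inner_subset_E by (metis disjoint_iff lessThan_iff subsetD)
  qed simp
  also have "\<dots> = (\<Sum>j\<in>J. len j - 1)" by (simp add: inner_def len_def)
  finally show ?thesis .
qed

text \<open>Every vertex except the root is internal to exactly one ear, and an ear of length l has
  l - 1 internal vertices.\<close>

lemma n_eq: "n = Suc (\<Sum>j<k. len j - 1)"
proof -
  have "w ` (\<Union>j\<in>{..<k}. inner j) = {..<n} - {r}"
  proof
    show "w ` (\<Union>j\<in>{..<k}. inner j) \<subseteq> {..<n} - {r}"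
      using inner_less_n inner_not_root st_fin(2) by (force simp: inner_def)
    show "{..<n} - {r} \<subseteq> w ` (\<Union>j\<in>{..<k}. inner j)"
    proof
      fix v assume "v \<in> {..<n} - {r}"
      then obtain j p where "j < k" "st j < p" "Suc p < st (Suc j)" "w p = v" using inner_cover by blast
      then show "v \<in> w ` (\<Union>j\<in>{..<k}. inner j)" using st_fin(2)[of j] by (fastforce simp: inner_def)
    qed
  qed
  then have "card ({..<n} - {r}) = (\<Sum>j<k. len j - 1)" using card_inner_image[of "{..<k}"] by simp
  then show ?thesis using root_less by simp
qed

text \<open>The new edges and the edges of the earmuff are independent on the vertices that are not
  internal to a pendant ear outside the earmuff.\<close>

lemma card_new_edges:
  assumes "indep w (muff_edges \<union> {p \<in> NP. b p = 1})"
  shows "card {p \<in> NP. b p = 1} + card muff \<le> (\<Sum>j | j < k \<and> \<not> pendant j. len j - 1)"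
proof -
  let ?D = "{p \<in> NP. b p = 1}"
  let ?R = "{j. j < k \<and> pendant j \<and> j \<notin> muff}"
  let ?V = "{..<n} - w ` (\<Union>j\<in>?R. inner j)"
  have mp: "j < k \<and> pendant j" if "j \<in> muff" for j
    using muff_clean[OF that] short_pendant by (auto simp: clean_def)
  have fm: "finite muff" by (rule finite_subset[of _ "{..<k}"]) (use mp in auto)
  have sub: "w ` (\<Union>j\<in>?R. inner j) \<subseteq> {..<n}" using inner_less_n by auto
  \<comment> \<open>An internal vertex of a pendant ear occurs at a single position, so removing the
    interiors of \<open>?R\<close> takes no vertex away from other ears.\<close>
  have V: "w p \<in> ?V" if "j < k" "j \<notin> ?R" "p \<in> {st j..fin j}" for j p
  proof -
    have "w p \<noteq> w p'" if p': "i \<in> ?R" "p' \<in> inner i" for i p'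
    proof
      assume "w p = w p'"
      then have "p' = p" using inner_unique_pendant[of i j p' p] p' \<open>j < k\<close> \<open>p \<in> _\<close> by auto
      then have "i = j" using pos_unique[of i j p] p' \<open>j < k\<close> \<open>p \<in> _\<close> by (auto simp: inner_def)
      then show False using p' \<open>j \<notin> ?R\<close> by blast
    qed
    then show ?thesis using w_less[OF that(1,3)] by auto
  qed
  have "r \<in> ?V" using root_less inner_not_root st_fin(2) by (force simp: inner_def)
  moreover have "w p \<in> ?V \<and> w (Suc p) \<in> ?V" if "p \<in> muff_edges \<union> ?D" for p
  proof -
    obtain j where "j < k" "j \<notin> ?R" "p \<in> E j" using \<open>p \<in> _\<close> mp by (auto simp: muff_edges_def NP_def)
    then show ?thesis using V[of j p] V[of j "Suc p"] by (auto simp: E_def)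
  qed
  \<comment> \<open>The root makes \<open>?V\<close> nonempty, which gives the strict
    inequality.\<close>
  ultimately have "card (muff_edges \<union> ?D) < card ?V"
    by (intro indep_card_less[OF assms]) auto
  moreover have "card ?V + (\<Sum>j\<in>?R. len j - 1) = n"
    using card_inner_image[of ?R] card_Diff_subset[OF _ sub] card_mono[OF _ sub]
    by (simp add: finite_subset[OF sub] subset_iff)
  moreover have "card (muff_edges \<union> ?D) = card muff_edges + card ?D"
    using mp NP_not_pendant fm by (intro card_Un_disjoint) (auto simp: muff_edges_def)
  moreover have "card muff_edges = (\<Sum>j\<in>muff. len j)"
    unfolding muff_edges_def card_E[symmetric]
    by (rule card_UN_disjoint) (use fm mp E_unique in auto)
  \<comment> \<open>Here the saving arises: an earmuff ear contributes \<open>len j\<close> edges to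
    the independent set but only \<open>len j - 1\<close> internal vertices to
    \<open>?V\<close>.\<close>
  moreover have "(\<Sum>j\<in>muff. len j) = (\<Sum>j\<in>muff. len j - 1) + card muff"
  proof -
    have "(\<Sum>j\<in>muff. len j) = (\<Sum>j\<in>muff. (len j - 1) + 1)"
      by (rule sum.cong) (use mp len_ge in force)+
    then show ?thesis by (simp only: sum.distrib) simp
  qed
  moreover have "(\<Sum>j<k. len j - 1) = (\<Sum>j | j < k \<and> \<not> pendant j. len j - 1) +
      ((\<Sum>j\<in>muff. len j - 1) + (\<Sum>j\<in>?R. len j - 1))"
  proof -
    have "(\<Sum>j\<in>muff. len j - 1) + (\<Sum>j\<in>?R. len j - 1) = (\<Sum>j\<in>muff \<union> ?R. len j - 1)"
      using fm by (intro sum.union_disjoint[symmetric]) auto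
    moreover have "(\<Sum>j | j < k \<and> \<not> pendant j. len j - 1) + (\<Sum>j\<in>muff \<union> ?R. len j - 1) =
        (\<Sum>j\<in>{j. j < k \<and> \<not> pendant j} \<union> (muff \<union> ?R). len j - 1)"
      using fm mp by (intro sum.union_disjoint[symmetric]) auto
    moreover have "{j. j < k \<and> \<not> pendant j} \<union> (muff \<union> ?R) = {..<k}" using mp by auto
    ultimately show ?thesis by simp
  qed
  ultimately show ?thesis using n_eq by linarith
qed

text \<open>By \<open>st k \<le> P\<close> the scan is complete, so each edge of a nonpendant ear
  has its ends joined by \<open>bset b\<close>; a pendant ear lacks at most one edge. This is what
  \<open>all_connected\<close> asks for.\<close>

lemma join_inv_outcome:
  assumes B: "tree_inv P q0 lab b x0" "st k \<le> P" and C: "join_inv k b q x"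
  shows "outcome b x"
proof -
  note B' = B(1)[unfolded tree_inv_def] and C' = C[unfolded join_inv_def]
  let ?pe = "{j. j < k \<and> pendant j}" and ?np = "{j. j < k \<and> \<not> pendant j}"
  have npx: "(\<forall>p\<in>inner j. q (w p) = 0) \<and> (\<forall>p\<in>E j. x p \<le> 1) \<and> 2 * (\<Sum>p\<in>E j. x p) \<le> len j"
    if "j < k" "\<not> pendant j" for j using C' that by simp
  have pe: "ear_ok j b x" if "j < k" "pendant j" for j using C' that by blast
  have "q (w p) = 0" if "j < k" "p \<in> inner j" for j p using C' npx that by blast
  then have "q v = 0" if "v < n" for v using parity_all_zero C' that by blast
  then have 1: "even (\<tau> v + dg b v + dg x v)" if "v < n" for v
    using C' that by (auto simp: parity_def)
  have 2: "b p \<le> 1 \<and> x p \<le> 1" if "p \<in> EE" for p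
  proof -
    obtain j where j: "j < k" "p \<in> E j" using \<open>p \<in> EE\<close> by (auto simp: EE_def)
    show ?thesis
    proof (cases "pendant j")
      case True
      then show ?thesis using pe j by (auto simp: ear_ok_def)
    next
      case False
      then have "p \<in> NP" using j by (auto simp: NP_def)
      then show ?thesis using B' npx[OF j(1) False] j by blast
    qed
  qed
  have "\<exists>e. \<forall>p\<in>E j. p \<noteq> e \<longrightarrow> conn w (bset b) (w p) (w (Suc p))" if j: "j < k" for j
  proof (cases "pendant j")
    case True
    then obtain e where "\<forall>p\<in>E j. p \<noteq> e \<longrightarrow> b p = 1" using pe[OF j True] by (auto simp: ear_ok_def)
    then have "\<forall>p\<in>E j. p \<noteq> e \<longrightarrow> p \<in> bset b" using E_EE[OF j] by (simp add: bset_def)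
    then show ?thesis using conn_edge by metis
  next
    case False
    then have "p \<in> NP \<and> p < P" if "p \<in> E j" for p
      using j that EE_less[OF E_EE[OF j that]] B(2) by (auto simp: NP_def)
    then show ?thesis using B' by blast
  qed
  then have "conn w (bset b) v r" if "v < n" for v using all_connected that by blast
  then have 3: "conn w (bset b) u v" if "u < n" "v < n" for u v using that by (meson conn_sym conn_trans)
  have split: "(\<Sum>j<k. f j) = (\<Sum>j\<in>?np. f j) + (\<Sum>j\<in>?pe. f j)" for f :: "nat \<Rightarrow> nat"
  proof -
    have "{..<k} = ?np \<union> ?pe" by auto
    then show ?thesis by (simp add: sum.union_disjoint[symmetric] disjoint_iff)
  qed
  have "(\<Sum>j\<in>?np. \<Sum>p\<in>E j. b p) = (\<Sum>p\<in>NP. b p)"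
    unfolding NP_def by (rule sum.UNION_disjoint[symmetric]) (use E_unique in auto)
  also have "\<dots> = (\<Sum>p\<in>NP. if b p = 1 then 1 else 0)"
    using B' by (intro sum.cong) (auto simp: le_Suc_eq)
  also have "\<dots> = card {p \<in> NP. b p = 1}" by (simp add: sum.If_cases Int_def)
  finally have "(\<Sum>j\<in>?np. \<Sum>p\<in>E j. b p) = card {p \<in> NP. b p = 1}" .
  moreover have "indep w (muff_edges \<union> {p \<in> NP. b p = 1})" using B' by blast
  ultimately have "(\<Sum>j\<in>?np. \<Sum>p\<in>E j. b p) + card muff \<le> (\<Sum>j\<in>?np. len j - 1)"
    using card_new_edges[of b] by simp
  moreover have "(\<Sum>j\<in>?np. \<Sum>p\<in>E j. x p) \<le> (\<Sum>j\<in>?np. len j div 2)"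
    by (rule sum_mono) (use npx in force)
  moreover have "(\<Sum>j\<in>?np. \<Sum>p\<in>E j. b p + x p) = (\<Sum>j\<in>?np. \<Sum>p\<in>E j. b p) + (\<Sum>j\<in>?np. \<Sum>p\<in>E j. x p)"
    by (simp add: sum.distrib)
  moreover have "(\<Sum>j\<in>?pe. \<Sum>p\<in>E j. b p + x p) + card ?pe \<le>
      (\<Sum>j\<in>?pe. len j - 1) + (\<Sum>j\<in>?pe. len j div 2) + card {j. j < k \<and> clean j}"
  proof -
    have "(\<Sum>j\<in>?pe. (\<Sum>p\<in>E j. b p + x p) + 1) \<le>
        (\<Sum>j\<in>?pe. (len j - 1) + len j div 2 + (if clean j then 1 else 0))"
    proof (rule sum_mono)
      fix j assume "j \<in> ?pe"
      then have "ear_ok j b x" "2 \<le> len j" using pe len_ge by auto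
      then show "(\<Sum>p\<in>E j. b p + x p) + 1 \<le> (len j - 1) + len j div 2 + (if clean j then 1 else 0)"
        unfolding ear_ok_def by linarith
    qed
    moreover have "(\<Sum>j\<in>?pe. if clean j then 1 else 0) = card {j. j < k \<and> clean j}"
    proof -
      have "{j \<in> ?pe. clean j} = {j. j < k \<and> clean j}" using short_pendant by (auto simp: clean_def)
      then show ?thesis by (simp add: sum.If_cases Int_def)
    qed
    ultimately show ?thesis by (simp only: sum.distrib) simp
  qed
  \<comment> \<open>The terms \<open>len j - 1\<close> of pendant and nonpendant ears add up to
    \<open>n - 1\<close> by \<open>n_eq\<close>.\<close>
  ultimately have 4: "(\<Sum>p\<in>EE. b p + x p) + card muff + card ?pe
       \<le> (n - 1) + card {j. j < k \<and> clean j} + (\<Sum>j<k. len j div 2)"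
    unfolding sum_EE n_eq split[of "\<lambda>j. \<Sum>p\<in>E j. b p + x p"] split[of "\<lambda>j. len j - 1"]
      split[of "\<lambda>j. len j div 2"] by linarith
  have "\<forall>p\<in>EE. b p \<le> 1 \<and> x p \<le> 1" using 2 by blast
  moreover have "\<forall>p<st k. p \<notin> EE \<longrightarrow> b p = 0 \<and> x p = 0"
  proof -
    have "\<forall>p<st k. p \<notin> EE \<longrightarrow> b p = 0 \<and> x0 p = 0" using B' by simp
    moreover have "\<forall>p<st k. p \<notin> EE \<longrightarrow> x p = 0" using C' by simp
    ultimately show ?thesis by simp
  qed
  moreover have "\<forall>v<n. even (\<tau> v + dg b v + dg x v)" using 1 by blast
  moreover have "\<forall>u<n. \<forall>v<n. conn w (bset b) u v" by (intro allI impI) (rule 3)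
  ultimately show ?thesis unfolding outcome_def using 4 by (intro conjI)
qed

end

lemma wpt_Seq_cong:
  "wpt c1 B1 P s \<Longrightarrow> (\<And>s'. P s' \<Longrightarrow> wpt c2 B2 Q s') \<Longrightarrow> wpt (Seq c1 c2) (B1 + B2) Q s"
  by (rule wpt_Seq) (erule wpt_mono, auto)

lemma wpt_Seq_exec:
  "loop_free c1 \<Longrightarrow> wpt c2 B2 Q (exec c1 s) \<Longrightarrow> cost c1 + B2 \<le> B \<Longrightarrow> wpt (Seq c1 c2) B Q s"
  by (rule wpt_Seq_le[OF wpt_exec])

section \<open>The program\<close>

text \<open>Array 2 is turned from \<open>T\<close> into the set \<open>q\<close>. Arrays 6 to 10 hold component labels, marks of
  the endpoints of ears, \<open>b\<close>, \<open>x\<close>, and marks of the ears that are not pendant. Register 4 is the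
  current ear, 5 the current position, 6 and 7 the first and last position of the ear, 8 the number
  of edges taken, 9 whether an edge has been dropped. The last ear must come first in
  \<open>join_phase\<close>, as treating an ear can spoil parities at its endpoints.\<close>

definition flip_com :: "nat \<Rightarrow> com" where
  "flip_com a = Seq (Store a (Reg 5) (Sub (Const 1) (Load a (Reg 5))))
     (Seq (Store 2 (Load 4 (Reg 5)) (Sub (Const 1) (Load 2 (Load 4 (Reg 5)))))
       (Store 2 (Load 4 (Add (Reg 5) (Const 1)))
         (Sub (Const 1) (Load 2 (Load 4 (Add (Reg 5) (Const 1)))))))"

text \<open>Both labels are saved in registers first, because the loop also overwrites the entry
  from which the old label was read.\<close>

definition merge_com :: com where
  "merge_com = Seq (Assign 11 (Load 6 (Load 4 (Reg 5))))
     (Seq (Assign 12 (Load 6 (Load 4 (Add (Reg 5) (Const 1)))))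
       (For 10 (Const 0) (Reg 0)
         (Cond (Eq (Load 6 (Reg 10)) (Reg 11)) (Store 6 (Reg 10) (Reg 12)) Skip)))"

definition span_com :: com where
  "span_com = Seq (Assign 6 (Load 3 (Reg 4)))
     (Assign 7 (Sub (Load 3 (Add (Reg 4) (Const 1))) (Const 1)))"

definition solve_com :: com where
  "solve_com = Seq (Assign 8 (Const 0))
     (Seq (For 5 (Add (Reg 6) (Const 1)) (Reg 7)
        (Cond (Eq (Load 2 (Load 4 (Reg 5))) (Const 1))
          (Seq (flip_com 9) (Assign 8 (Add (Reg 8) (Const 1)))) Skip))
       (Cond (Less (Sub (Reg 7) (Reg 6)) (Add (Reg 8) (Reg 8)))
         (For 5 (Reg 6) (Reg 7) (flip_com 9)) Skip))"

definition finish_com :: com where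
  "finish_com = Seq (Assign 9 (Const 0)) (For 5 (Reg 6) (Reg 7)
     (Cond (And (Eq (Load 9 (Reg 5)) (Const 1)) (Eq (Reg 9) (Const 0)))
       (Seq (flip_com 9) (Assign 9 (Const 1))) (Seq (flip_com 8) merge_com)))"

definition mark_com :: com where
  "mark_com = Seq (Store 10 (Reg 4) (Const 0))
     (For 5 (Add (Reg 6) (Const 1)) (Reg 7)
       (Cond (Eq (Load 7 (Load 4 (Reg 5))) (Const 1)) (Store 10 (Reg 4) (Const 1)) Skip))"

definition pendant_phase :: com where
  "pendant_phase = For 4 (Const 0) (Reg 2) (Seq span_com (Seq mark_com
     (Cond (Eq (Load 10 (Reg 4)) (Const 0)) (Seq solve_com finish_com) Skip)))"

definition tree_phase :: com where
  "tree_phase = For 4 (Const 0) (Reg 2) (Seq span_com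
     (Cond (Eq (Load 10 (Reg 4)) (Const 1)) (For 5 (Reg 6) (Reg 7)
        (Cond (Eq (Load 6 (Load 4 (Reg 5))) (Load 6 (Load 4 (Add (Reg 5) (Const 1))))) Skip
          (Seq (flip_com 8) merge_com))) Skip))"

definition join_phase :: com where
  "join_phase = For 13 (Const 0) (Reg 2) (Seq (Assign 4 (Sub (Sub (Reg 2) (Const 1)) (Reg 13)))
     (Seq span_com (Cond (Eq (Load 10 (Reg 4)) (Const 1)) solve_com Skip)))"

text \<open>The memory beyond the input is arbitrary, so arrays 6 to 9 are initialised. The last
  loop marks the ends of all ears, so that \<open>mark_com\<close> recognises a pendant ear by
  looking at its internal vertices alone.\<close>

definition init_phase :: com where
  "init_phase = Seq
     (For 10 (Const 0) (Reg 0) (Seq (Store 6 (Reg 10) (Reg 10)) (Store 7 (Reg 10) (Const 0))))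
     (Seq (For 5 (Const 0) (Load 3 (Reg 2)) (Seq (Store 8 (Reg 5) (Const 0)) (Store 9 (Reg 5) (Const 0))))
       (For 4 (Const 0) (Reg 2) (Seq (Store 7 (Load 4 (Load 3 (Reg 4))) (Const 1))
          (Store 7 (Load 4 (Sub (Load 3 (Add (Reg 4) (Const 1))) (Const 1))) (Const 1)))))"

definition emit_com :: "nat \<Rightarrow> com" where
  "emit_com c = Seq (Store 0 (Reg 8) (Load 5 (Reg 5)))
     (Seq (Store 1 (Reg 8) (Const c)) (Assign 8 (Add (Reg 8) (Const 1))))"

definition output_phase :: com where
  "output_phase = Seq (Assign 8 (Const 0)) (Seq (For 5 (Const 0) (Load 3 (Reg 2))
     (Seq (Cond (Eq (Load 8 (Reg 5)) (Const 1)) (emit_com 0) Skip)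
       (Cond (Eq (Load 9 (Reg 5)) (Const 1)) (emit_com 1) Skip))) (Assign 0 (Reg 8)))"

definition program :: com where
  "program = Seq init_phase (Seq pendant_phase (Seq tree_phase (Seq join_phase output_phase)))"

text \<open>The range also contains the last position of each ear, which names no edge; there
  \<open>b\<close> and \<open>x\<close> are 0 by the second clause of
  \<open>outcome\<close>.\<close>

definition out_list :: "(nat \<Rightarrow> 'e) \<Rightarrow> (nat \<Rightarrow> nat) \<Rightarrow> (nat \<Rightarrow> nat) \<Rightarrow> nat \<Rightarrow> ('e \<times> bool) list" where
  "out_list f b x N = concat (map (\<lambda>p. (if b p = 1 then [(f p, False)] else []) @
     (if x p = 1 then [(f p, True)] else [])) [0..<N])"

abbreviation stored :: "memory \<Rightarrow> (nat \<times> bool) list \<Rightarrow> bool" where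
  "stored s fs \<equiv> \<forall>i<length fs. arr s 0 i = fst (fs ! i) \<and> arr s 1 i = (if snd (fs ! i) then 1 else 0)"

definition listed :: "memory \<Rightarrow> (nat \<times> bool) list \<Rightarrow> bool" where
  "listed s fs \<longleftrightarrow> reg s 8 = length fs \<and> stored s fs"

lemma listed_emit:
  assumes "listed s fs" "c \<le> 1"
  shows "listed (exec (emit_com c) s) (fs @ [(arr s 5 (reg s 5), c = 1)])"
  using assms by (auto simp: listed_def emit_com_def nth_append less_Suc_eq)

context ear_list
begin

lemma exec_flip:
  assumes "arr s 4 = w" "a \<noteq> 2" "a \<noteq> 4"
  shows "exec (flip_com a) s = s\<lparr>arr := (arr s)(a := (arr s a)(reg s 5 := 1 - arr s a (reg s 5)),
    2 := toggle (reg s 5) (arr s 2))\<rparr>"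
  using assms by (simp add: flip_com_def toggle_def Let_def fun_upd_twist)

lemma flip_com_simps [simp]: "loop_free (flip_com a)" "cost (flip_com a) = 3"
  by (simp_all add: flip_com_def)

lemma emit_com_simps [simp]: "loop_free (emit_com a)" "cost (emit_com a) = 3"
  by (simp_all add: emit_com_def)

lemma n_pos: "1 \<le> n"
  using root_less by simp

lemma wpt_merge:
  assumes s: "reg s 0 = n" "arr s 4 = w" "reg s 5 = p"
    and Q: "\<And>s'. frame {6} {10, 11, 12} s s' \<Longrightarrow> arr s' 6 = merged p (arr s 6) \<Longrightarrow> Q s'"
  shows "wpt merge_com (8 * n) Q s"
proof -
  let ?loop = "(For 10 (Const 0) (Reg 0) (Cond (Eq (Load 6 (Reg 10)) (Reg 11)) (Store 6 (Reg 10) (Reg 12)) Skip))"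
  let ?lab = "arr s 6" and ?a = "arr s 6 (w p)" and ?c = "arr s 6 (w (Suc p))"
  define I where "I i s' \<longleftrightarrow> frame {6} {10, 11, 12} s s' \<and> reg s' 11 = ?a \<and> reg s' 12 = ?c \<and>
    arr s' 6 = (\<lambda>v. if v < i \<and> ?lab v = ?a then ?c else ?lab v)" for i s'
  let ?s1 = "s\<lparr>reg := (reg s)(11 := ?a, 12 := ?c)\<rparr>"
  have loop: "wpt ?loop (2 + n * 4) Q ?s1"
  proof (rule wpt_For[where I = I and L = 0 and H = n and B = 2])
    show "I 0 (?s1\<lparr>reg := (reg ?s1)(10 := 0)\<rparr>)" by (simp add: I_def frame_def)
    show "aval (Reg 0) s' = n" if "I i s'" for i s' using that s by (simp add: I_def frame_def)
    show "Q s'" if "I n s'" for s'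
    proof (rule Q)
      show "frame {6} {10, 11, 12} s s'" "arr s' 6 = merged p (arr s 6)"
        using that by (simp_all add: I_def merged_def)
    qed
    fix i s' assume I: "I i s'" and i: "reg s' 10 = i"
    show "wpt (Cond (Eq (Load 6 (Reg 10)) (Reg 11)) (Store 6 (Reg 10) (Reg 12)) Skip) 2
      (advanced 10 i I) s'"
      by (rule wpt_exec_le) (use I i in \<open>auto simp: I_def less_Suc_eq\<close>)
  qed auto
  have "wpt (Seq (Assign 12 (Load 6 (Load 4 (Add (Reg 5) (Const 1))))) ?loop) (1 + (2 + n * 4)) Q
      (s\<lparr>reg := (reg s)(11 := ?a)\<rparr>)"
    by - (rule wpt_Seq_exec[where ?B2.0 = "2 + n * 4"], use loop s in simp_all)
  then show ?thesis unfolding merge_com_def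
    by - (rule wpt_Seq_exec[where ?B2.0 = "1 + (2 + n * 4)"], use s n_pos in simp_all)
qed

end

section \<open>Correctness and running time of the phases\<close>

context muff_list
begin

lemma len_le: "j < k \<Longrightarrow> len j \<le> n"
proof -
  assume j: "j < k"
  have "(\<Sum>i\<in>{j}. len i - 1) \<le> (\<Sum>i<k. len i - 1)" by (rule sum_mono2) (use j in auto)
  then show ?thesis using n_eq by simp
qed

lemma k_le: "k \<le> n"
proof -
  have "(\<Sum>i<k. 1) \<le> (\<Sum>i<k. len i - 1)" by (rule sum_mono) (use len_ge in force)
  then show ?thesis using n_eq by simp
qed

text \<open>For length at least 2, the \<open>len j + 1\<close> positions of an ear are at most
  \<open>3 * (len j - 1)\<close>, and the numbers \<open>len j - 1\<close> add up to
  \<open>n - 1\<close>.\<close>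

lemma st_le:
  assumes "st 0 = 0"
  shows "st k \<le> 3 * n"
proof -
  have "st j \<le> 3 * (\<Sum>i<j. len i - 1)" if "j \<le> k" for j
    using that
  proof (induction j)
    case (Suc j)
    then have "st j \<le> 3 * (\<Sum>i<j. len i - 1)" "2 \<le> len j" "st (Suc j) = st j + len j + 1"
      using len_ge[of j] st_fin[of j] by (auto simp: len_def)
    then show ?case by simp
  qed (simp add: assms)
  from this[of k] show ?thesis using n_eq by simp
qed

text \<open>Including loop overhead, an edge costs 7 steps in the first loop and 5 in the flipping
  loop, and an ear has at most \<open>n\<close> edges.\<close>

lemma wpt_solve:
  assumes j: "j < k" and s: "reg s 6 = st j" "reg s 7 = fin j" "arr s 4 = w"
    and par: "parity b (arr s 9) (arr s 2)" and x0: "\<forall>p\<in>E j. arr s 9 p = 0"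
    and Q: "\<And>s'. frame {2, 9} {5, 8} s s' \<Longrightarrow>
      solved j (arr s 2) (arr s 9) b (arr s' 2) (arr s' 9) \<Longrightarrow> Q s'"
  shows "wpt solve_com (20 * n) Q s"
proof -
  let ?flip = "(Cond (Less (Sub (Reg 7) (Reg 6)) (Add (Reg 8) (Reg 8)))
    (For 5 (Reg 6) (Reg 7) (flip_com 9)) Skip)"
  let ?body = "(Cond (Eq (Load 2 (Load 4 (Reg 5))) (Const 1))
    (Seq (flip_com 9) (Assign 8 (Add (Reg 8) (Const 1)))) Skip)"
  define I where "I p s' \<longleftrightarrow> frame {2, 9} {5, 8} s s' \<and>
    solve_inv j (arr s 2) (arr s 9) b p (arr s' 2) (arr s' 9) (reg s' 8)" for p s'
  note st_fin = st_fin[OF j]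
  have loop2: "wpt ?flip (3 + 5 * n) Q s1"
    if I1: "I (fin j) s1" for s1
  proof (rule wpt_Cond)
    note I = I1[unfolded I_def]
    have r: "reg s1 7 = fin j" "reg s1 6 = st j" "arr s1 4 = w" using I s by (simp_all add: frame_def)
    have x1: "\<forall>p\<in>E j. arr s1 9 p \<le> 1" using I by (simp add: solve_inv_def)
    define J where "J p s' \<longleftrightarrow> frame {2, 9} {5, 8} s s' \<and>
      flip_inv j (arr s 2) (arr s1 9) b p (arr s' 2) (arr s' 9)" for p s'
    assume c: "bval (Less (Sub (Reg 7) (Reg 6)) (Add (Reg 8) (Reg 8))) s1"
    show "wpt (For 5 (Reg 6) (Reg 7) (flip_com 9)) (2 + len j * 5) Q s1"
    proof (rule wpt_For[where I = J and L = "st j" and H = "fin j" and B = 3])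
      show "J (st j) (s1\<lparr>reg := (reg s1)(5 := st j)\<rparr>)"
        using I flip_inv_init[of j "arr s 2" "arr s 9" b "arr s1 2" "arr s1 9" "reg s1 8"] by (simp add: J_def)
      show "aval (Reg 7) s' = fin j" if "J p s'" for p s' using that s by (simp add: J_def frame_def)
      show "Q s'" if J: "J (fin j) s'" for s'
      proof (rule Q)
        show "solved j (arr s 2) (arr s 9) b (arr s' 2) (arr s' 9)"
          using I J r c solved_flip[OF j x0, of "arr s 2" b "arr s1 2" "arr s1 9" "reg s1 8"]
          by (simp add: J_def len_def)
        show "frame {2, 9} {5, 8} s s'" using J by (simp add: J_def)
      qed
      fix p s' assume p: "st j \<le> p" "p < fin j" and J: "J p s'" and r5: "reg s' 5 = p"
      have pE: "p \<in> E j" using p by (simp add: E_def)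
      have w4: "arr s' 4 = w" using J s by (simp add: J_def frame_def)
      show "wpt (flip_com 9) 3 (advanced 5 p J) s'"
        by (rule wpt_exec_le)
          (use J r5 w4 flip_inv_step[OF j pE _ x1] in \<open>simp_all add: exec_flip J_def frame_def\<close>)
    qed (use r st_fin in \<open>auto simp: len_def\<close>)
  next
    note I = I1[unfolded I_def]
    assume "\<not> bval (Less (Sub (Reg 7) (Reg 6)) (Add (Reg 8) (Reg 8))) s1"
    moreover have r: "reg s1 7 = fin j" "reg s1 6 = st j" using I s by (simp_all add: frame_def)
    ultimately have "Q s1"
      using I by (intro Q solved_no_flip[of _ _ _ _ _ _ "reg s1 8"]) (simp_all add: len_def)
    then show "wpt Skip 1 Q s1" by (intro wpt_exec_le) simp_all
  qed (use len_le[OF j] n_pos in simp_all)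
  let ?s0 = "s\<lparr>reg := (reg s)(8 := 0)\<rparr>"
  have loop1: "wpt (For 5 (Add (Reg 6) (Const 1)) (Reg 7) ?body) (2 + 7 * n)
      (wpt ?flip (3 + 5 * n) Q) ?s0"
  proof (rule wpt_For[where I = I and L = "Suc (st j)" and H = "fin j" and B = 5])
    show "I (Suc (st j)) (?s0\<lparr>reg := (reg ?s0)(5 := Suc (st j))\<rparr>)"
      using solve_inv_init[OF par x0] by (simp add: I_def frame_def)
    show "aval (Reg 7) s' = fin j" if "I p s'" for p s' using that s by (simp add: I_def frame_def)
    fix p s' assume p: "Suc (st j) \<le> p" "p < fin j" and I: "I p s'" and r5: "reg s' 5 = p"
    have w4: "arr s' 4 = w" using I s by (simp add: I_def frame_def)
    note I' = I[unfolded I_def]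
    have "st j < p" using p by simp
    note steps = solve_inv_toggle[OF j x0 this p(2)] solve_inv_skip[OF j this p(2)]
    show "wpt ?body 5
      (advanced 5 p I) s'"
      by (rule wpt_exec_le)
        (use I' r5 w4 steps in \<open>simp_all add: exec_flip I_def frame_def\<close>)
  qed (use loop2 s st_fin len_le[OF j] in \<open>auto simp: len_def\<close>)
  from wpt_Seq[OF loop1] show ?thesis unfolding solve_com_def
    by - (rule wpt_Seq_exec[where ?B2.0 = "2 + 7 * n + (3 + 5 * n)"], use n_pos in simp_all)
qed

text \<open>Taking one edge may relabel all vertices, and an ear has at most \<open>n\<close> edges.
  This gives a quadratic bound per ear, and a cubic one for at most \<open>n\<close> ears.\<close>

lemma wpt_finish:
  assumes j: "j < k" and s: "reg s 0 = n" "reg s 6 = st j" "reg s 7 = fin j" "arr s 4 = w"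
    and S: "solved j q0 x0 (arr s 8) (arr s 2) (arr s 9)" and L: "lab_inv (arr s 6) (bset (arr s 8))"
    and b0: "\<forall>p\<in>E j. arr s 8 p = 0"
    and Q: "\<And>s' d. frame {2, 6, 8, 9} {5, 9, 10, 11, 12} s s' \<Longrightarrow>
      finish_inv j (arr s 2) (arr s 9) (arr s 8) (fin j) (arr s' 2) (arr s' 6) (arr s' 8) (arr s' 9) d \<Longrightarrow> Q s'"
  shows "wpt finish_com (20 * n ^ 2) Q s"
proof -
  let ?body = "(Cond (And (Eq (Load 9 (Reg 5)) (Const 1)) (Eq (Reg 9) (Const 0)))
    (Seq (flip_com 9) (Assign 9 (Const 1))) (Seq (flip_com 8) merge_com))"
  define I where "I p s' \<longleftrightarrow> frame {2, 6, 8, 9} {5, 9, 10, 11, 12} s s' \<and>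
    finish_inv j (arr s 2) (arr s 9) (arr s 8) p (arr s' 2) (arr s' 6) (arr s' 8) (arr s' 9) (reg s' 9)" for p s'
  let ?s0 = "s\<lparr>reg := (reg s)(9 := 0)\<rparr>"
  have x1: "\<forall>p\<in>E j. arr s 8 p = 0 \<and> arr s 9 p \<le> 1" using S b0 by (simp add: solved_def)
  note st_fin = st_fin[OF j]
  have "wpt (For 5 (Reg 6) (Reg 7) ?body) (2 + n * (14 * n)) Q ?s0"
  proof (rule wpt_For[where I = I and L = "st j" and H = "fin j" and B = "4 + 8 * n"])
    show "I (st j) (?s0\<lparr>reg := (reg ?s0)(5 := st j)\<rparr>)"
      using finish_inv_init[OF S L] by (simp add: I_def frame_def)
    show "aval (Reg 7) s' = fin j" if "I p s'" for p s' using that s by (simp add: I_def frame_def)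
    show "Q s'" if "I (fin j) s'" for s' using that Q[of s' "reg s' 9"] by (simp add: I_def)
    have "len j * (6 + 8 * n) \<le> n * (14 * n)"
      using len_le[OF j] n_pos by (intro mult_mono) auto
    then show "2 + (fin j - st j) * (4 + 8 * n + 2) \<le> 2 + n * (14 * n)" by (simp add: len_def)
    fix p s' assume p: "st j \<le> p" "p < fin j" and I: "I p s'" and r5: "reg s' 5 = p"
    have pE: "p \<in> E j" using p by (simp add: E_def)
    note I' = I[unfolded I_def]
    have w4: "arr s' 4 = w" "reg s' 0 = n" using I' s by (simp_all add: frame_def)
    show "wpt ?body (4 + 8 * n)
      (advanced 5 p I) s'"
    proof (rule wpt_Cond[where ?B2.0 = "3 + 8 * n"])
      assume "bval (And (Eq (Load 9 (Reg 5)) (Const 1)) (Eq (Reg 9) (Const 0))) s'"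
      then show "wpt (Seq (flip_com 9) (Assign 9 (Const 1))) 4
        (advanced 5 p I) s'"
        by (intro wpt_exec_le)
          (use I' r5 w4 b0 finish_inv_drop[OF j pE] in \<open>simp_all add: exec_flip I_def frame_def\<close>)
    next
      assume c: "\<not> bval (And (Eq (Load 9 (Reg 5)) (Const 1)) (Eq (Reg 9) (Const 0))) s'"
      let ?s1 = "exec (flip_com 8) s'"
      have s1: "?s1 = s'\<lparr>arr := (arr s')(8 := (arr s' 8)(p := 1 - arr s' 8 p), 2 := toggle p (arr s' 2))\<rparr>"
        using w4 r5 by (simp add: exec_flip)
      have "wpt merge_com (8 * n)
        (advanced 5 p I) ?s1"
      proof (rule wpt_merge)
        fix s2 assume f: "frame {6} {10, 11, 12} ?s1 s2" and l: "arr s2 6 = merged p (arr ?s1 6)"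
        have "finish_inv j (arr s 2) (arr s 9) (arr s 8) (Suc p) (toggle p (arr s' 2)) (merged p (arr s' 6))
           ((arr s' 8)(p := 1 - arr s' 8 p)) (arr s' 9) (reg s' 9)"
          using finish_inv_take[OF j pE _ _ x1] I' c r5 by simp
        then show "reg s2 5 = p \<and> I (Suc p) (s2\<lparr>reg := (reg s2)(5 := Suc p)\<rparr>)"
          using f l r5 I' by (simp add: s1 I_def frame_def)
      qed (use w4 r5 s1 in simp_all)
      then show "wpt (Seq (flip_com 8) merge_com) (3 + 8 * n)
        (advanced 5 p I) s'"
        by - (rule wpt_Seq_exec[where ?B2.0 = "8 * n"], simp_all)
    qed (use n_pos in auto)
  qed (use s st_fin in auto)
  moreover have "1 \<le> n * n" using n_pos by simp
  ultimately show ?thesis unfolding finish_com_def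
    by - (rule wpt_Seq_exec[where ?B2.0 = "2 + n * (14 * n)"], simp_all add: power2_eq_square)
qed

text \<open>The part of the input that stays fixed until the output is written and that every phase
  relies on.\<close>

definition stat :: "memory \<Rightarrow> bool" where
  "stat s \<longleftrightarrow> reg s 0 = n \<and> reg s 2 = k \<and> arr s 3 = st \<and> arr s 4 = w"

definition marks :: "(nat \<Rightarrow> nat) \<Rightarrow> bool" where
  "marks em \<longleftrightarrow> (\<forall>v<n. em v = 1 \<longleftrightarrow> (\<exists>i<k. w (st i) = v \<or> w (fin i) = v))"

lemma wpt_span:
  assumes "arr s 3 = st" "reg s 4 = j" "Q (s\<lparr>reg := (reg s)(6 := st j, 7 := fin j)\<rparr>)"
  shows "wpt span_com 2 Q s"
  by (rule wpt_exec_le) (use assms in \<open>simp_all add: span_com_def fin_def\<close>)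

lemma wpt_mark:
  assumes j: "j < k" and s: "reg s 4 = j" "reg s 6 = st j" "reg s 7 = fin j" "arr s 4 = w"
    and em: "marks (arr s 7)"
    and Q: "\<And>s'. frame {10} {5} s s' \<Longrightarrow> arr s' 10 = (arr s 10)(j := if pendant j then 0 else 1) \<Longrightarrow> Q s'"
  shows "wpt mark_com (7 * n) Q s"
proof -
  define hit where "hit p \<longleftrightarrow> (\<exists>p'\<in>{st j<..<p}. arr s 7 (w p') = 1)" for p
  define I where "I p s' \<longleftrightarrow> frame {10} {5} s s' \<and> arr s' 10 = (arr s 10)(j := if hit p then 1 else 0)" for p s'
  let ?s0 = "s\<lparr>arr := (arr s)(10 := (arr s 10)(j := 0))\<rparr>"
  have hit_Suc: "hit (Suc p) \<longleftrightarrow> hit p \<or> arr s 7 (w p) = 1" if "st j < p" for p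
    using that by (auto simp: hit_def less_Suc_eq)
  have "hit (fin j) \<longleftrightarrow> \<not> pendant j"
    using em inner_less_n[OF j] by (auto simp: hit_def marks_def pendant_def inner_def)
  then have fin: "Q s'" if "I (fin j) s'" for s' using that Q by (simp add: I_def)
  have "wpt (For 5 (Add (Reg 6) (Const 1)) (Reg 7)
       (Cond (Eq (Load 7 (Load 4 (Reg 5))) (Const 1)) (Store 10 (Reg 4) (Const 1)) Skip)) (2 + n * 4) Q ?s0"
  proof (rule wpt_For[where I = I and L = "Suc (st j)" and H = "fin j" and B = 2])
    show "I (Suc (st j)) (?s0\<lparr>reg := (reg ?s0)(5 := Suc (st j))\<rparr>)"
      by (auto simp: I_def hit_def frame_def)
    show "aval (Reg 7) s' = fin j" if "I p s'" for p s' using that s by (simp add: I_def frame_def)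
    fix p s' assume p: "Suc (st j) \<le> p" "p < fin j" and I: "I p s'" and r5: "reg s' 5 = p"
    have r: "arr s' 4 = w" "arr s' 7 = arr s 7" "reg s' 4 = j" using I s by (simp_all add: I_def frame_def)
    show "wpt (Cond (Eq (Load 7 (Load 4 (Reg 5))) (Const 1)) (Store 10 (Reg 4) (Const 1)) Skip) 2
      (advanced 5 p I) s'"
      by (rule wpt_exec_le) (use I r5 r hit_Suc[of p] p in \<open>simp_all add: I_def\<close>)
  qed (use s fin st_fin[OF j] len_le[OF j] in \<open>auto simp: len_def\<close>)
  then show ?thesis unfolding mark_com_def
    by - (rule wpt_Seq_exec[where ?B2.0 = "2 + n * 4"], use s n_pos in simp_all)
qed

lemma k_mult: "k * c \<le> n * c"
  using k_le by simp

lemma n_pow: "n \<le> n ^ 2" "n ^ 2 \<le> n ^ 3" "1 \<le> n ^ 2" "1 \<le> n ^ 3" "n \<le> n ^ 3" "n * n ^ 2 = n ^ 3" "n * n = n ^ 2"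
  using n_pos by (auto simp: power2_eq_square power3_eq_cube)

lemma wpt_pendant_phase:
  assumes s: "stat s" and em: "marks (arr s 7)"
    and A: "pendant_inv 0 (arr s 2) (arr s 6) (arr s 8) (arr s 9) (arr s 10)"
    and Q: "\<And>s'. frame {2, 6, 8, 9, 10} {4, 5, 6, 7, 8, 9, 10, 11, 12} s s' \<Longrightarrow>
      pendant_inv k (arr s' 2) (arr s' 6) (arr s' 8) (arr s' 9) (arr s' 10) \<Longrightarrow> Q s'"
  shows "wpt pendant_phase (60 * n ^ 3) Q s"
  unfolding pendant_phase_def
proof -
  define I where "I j s' \<longleftrightarrow> frame {2, 6, 8, 9, 10} {4, 5, 6, 7, 8, 9, 10, 11, 12} s s' \<and>
    pendant_inv j (arr s' 2) (arr s' 6) (arr s' 8) (arr s' 9) (arr s' 10)" for j s'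
  let ?c = "Cond (Eq (Load 10 (Reg 4)) (Const 0)) (Seq solve_com finish_com) Skip"
  show "wpt (For 4 (Const 0) (Reg 2) (Seq span_com (Seq mark_com ?c))) (60 * n ^ 3) Q s"
  proof (rule wpt_For[where I = I and L = 0 and H = k and B = "50 * n ^ 2"])
    show "I 0 (s\<lparr>reg := (reg s)(4 := 0)\<rparr>)" using A by (simp add: I_def)
    show "aval (Reg 2) s' = k" if "I j s'" for j s' using that s by (simp add: I_def frame_def stat_def)
    show "Q s'" if "I k s'" for s' using that Q by (simp add: I_def)
    show "2 + (k - 0) * (50 * n ^ 2 + 2) \<le> 60 * n ^ 3"
      using k_mult[of "50 * n ^ 2 + 2"] n_pow by (simp add: algebra_simps)
    fix j s' assume j: "j < k" and I: "I j s'" and r4: "reg s' 4 = j"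
    note I' = I[unfolded I_def]
    let ?q = "advanced 4 j I"
    define s1 where "s1 = s'\<lparr>reg := (reg s')(6 := st j, 7 := fin j)\<rparr>"
    have st1: "reg s1 0 = n" "reg s1 4 = j" "reg s1 6 = st j" "reg s1 7 = fin j" "arr s1 4 = w" "arr s1 7 = arr s 7"
      and f1: "frame {} {6, 7} s' s1"
      using I' s r4 by (simp_all add: s1_def stat_def frame_def)
    have "wpt mark_com (7 * n) (wpt ?c (40 * n ^ 2 + 1) ?q) s1"
    proof (rule wpt_mark[OF j st1(2-5)])
      show "marks (arr s1 7)" using em st1 by simp
      fix s2 assume f2: "frame {10} {5} s1 s2"
        and np: "arr s2 10 = (arr s1 10)(j := if pendant j then 0 else 1)"
      have st2: "reg s2 0 = n" "reg s2 4 = j" "reg s2 6 = st j" "reg s2 7 = fin j" "arr s2 4 = w"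
        and eq2: "arr s2 2 = arr s' 2" "arr s2 6 = arr s' 6" "arr s2 8 = arr s' 8" "arr s2 9 = arr s' 9"
        using f2 st1 by (simp_all add: frame_def s1_def)
      have A2: "pendant_inv j (arr s2 2) (arr s2 6) (arr s2 8) (arr s2 9) (arr s' 10)" using I' eq2 by simp
      have np2: "arr s2 10 = (arr s' 10)(j := if pendant j then 0 else 1)" using np by (simp add: s1_def)
      have fr: "frame {2, 6, 8, 9, 10} {4, 5, 6, 7, 8, 9, 10, 11, 12} s s2"
        using I' f1 f2 by (simp add: frame_def)
      show "wpt ?c (40 * n ^ 2 + 1) ?q s2"
      proof (rule wpt_Cond)
        assume "bval (Eq (Load 10 (Reg 4)) (Const 0)) s2"
        then have pj: "pendant j" using np2 st2 by (simp split: if_splits)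
        have z: "\<forall>p\<in>E j. arr s2 9 p = 0" "\<forall>p\<in>E j. arr s2 8 p = 0" using pendant_inv_zero[OF A2 j] by auto
        have "wpt solve_com (20 * n) (wpt finish_com (20 * n ^ 2) ?q) s2"
        proof (rule wpt_solve[OF j st2(3-5)])
          show "parity (arr s2 8) (arr s2 9) (arr s2 2)" using A2 by (simp add: pendant_inv_def)
          show "\<forall>p\<in>E j. arr s2 9 p = 0" using z by simp
          fix s3 assume f3: "frame {2, 9} {5, 8} s2 s3"
            and S: "solved j (arr s2 2) (arr s2 9) (arr s2 8) (arr s3 2) (arr s3 9)"
          have st3: "reg s3 0 = n" "reg s3 6 = st j" "reg s3 7 = fin j" "arr s3 4 = w"
            and eq3: "arr s3 8 = arr s2 8" "arr s3 6 = arr s2 6" "arr s3 10 = arr s2 10"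
            using f3 st2 by (simp_all add: frame_def)
          show "wpt finish_com (20 * n ^ 2) ?q s3"
          proof (rule wpt_finish[OF j st3])
            show "solved j (arr s2 2) (arr s2 9) (arr s3 8) (arr s3 2) (arr s3 9)" using S eq3 by simp
            show "lab_inv (arr s3 6) (bset (arr s3 8))" using A2 eq3 by (simp add: pendant_inv_def)
            show "\<forall>p\<in>E j. arr s3 8 p = 0" using z eq3 by simp
            fix s4 d assume f4: "frame {2, 6, 8, 9} {5, 9, 10, 11, 12} s3 s4"
              and F: "finish_inv j (arr s3 2) (arr s3 9) (arr s3 8) (fin j)
                (arr s4 2) (arr s4 6) (arr s4 8) (arr s4 9) d"
            have "arr s4 10 = (arr s' 10)(j := 0)" using f4 eq3 np2 pj by (simp add: frame_def)
            then have "pendant_inv (Suc j) (arr s4 2) (arr s4 6) (arr s4 8) (arr s4 9) (arr s4 10)"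
              using pendant_inv_pendant[OF j pj A2 S] F eq3 by simp
            moreover have "frame {2, 6, 8, 9, 10} {4, 5, 6, 7, 8, 9, 10, 11, 12} s s4"
              using fr f3 f4 by (simp add: frame_def)
            moreover have "reg s4 4 = j" using f3 f4 st2 by (simp add: frame_def)
            ultimately show "?q s4" by (simp add: I_def)
          qed
        qed
        then show "wpt (Seq solve_com finish_com) (40 * n ^ 2) ?q s2"
          by (rule wpt_Seq_le) (use n_pow in simp)
      next
        assume "\<not> bval (Eq (Load 10 (Reg 4)) (Const 0)) s2"
        then have pj: "\<not> pendant j" using np2 st2 by (simp split: if_splits)
        have "pendant_inv (Suc j) (arr s2 2) (arr s2 6) (arr s2 8) (arr s2 9) (arr s2 10)"
          using pendant_inv_skip[OF j pj A2] np2 pj by simp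
        then show "wpt Skip 1 ?q s2"
          by (intro wpt_exec_le) (use fr st2 in \<open>simp_all add: I_def\<close>)
      qed (use n_pow in auto)
    qed
    then have "wpt (Seq mark_com ?c) (48 * n ^ 2) ?q s1"
      by (rule wpt_Seq_le) (use n_pow in simp)
    then have "wpt span_com 2 (wpt (Seq mark_com ?c) (48 * n ^ 2) ?q) s'"
      by (intro wpt_span) (use I' s r4 in \<open>simp_all add: frame_def stat_def s1_def\<close>)
    then show "wpt (Seq span_com (Seq mark_com ?c)) (50 * n ^ 2) ?q s'"
      by (rule wpt_Seq_le) (use n_pow in simp)
  qed auto
qed

lemma wpt_tree_phase:
  assumes s: "stat s" and np: "\<And>i. i < k \<Longrightarrow> arr s 10 i = (if pendant i then 0 else 1)"
    and B: "tree_inv (st 0) (arr s 2) (arr s 6) (arr s 8) (arr s 9)"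
    and Q: "\<And>s'. frame {2, 6, 8} {4, 5, 6, 7, 10, 11, 12} s s' \<Longrightarrow>
      tree_inv (st k) (arr s' 2) (arr s' 6) (arr s' 8) (arr s 9) \<Longrightarrow> Q s'"
  shows "wpt tree_phase (60 * n ^ 3) Q s"
  unfolding tree_phase_def
proof -
  define I where "I P s' \<longleftrightarrow> frame {2, 6, 8} {4, 5, 6, 7, 10, 11, 12} s s' \<and>
    tree_inv P (arr s' 2) (arr s' 6) (arr s' 8) (arr s 9)" for P s'
  let ?t = "Cond (Eq (Load 6 (Load 4 (Reg 5))) (Load 6 (Load 4 (Add (Reg 5) (Const 1))))) Skip
          (Seq (flip_com 8) merge_com)"
  let ?c = "Cond (Eq (Load 10 (Reg 4)) (Const 1)) (For 5 (Reg 6) (Reg 7) ?t) Skip"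
  show "wpt (For 4 (Const 0) (Reg 2) (Seq span_com ?c)) (60 * n ^ 3) Q s"
  \<comment> \<open>One invariant serves both loops: it is indexed by scan positions, and the outer
    loop reads it at \<open>st j\<close>.\<close>
  proof (rule wpt_For[where I = "\<lambda>j. I (st j)" and L = 0 and H = k and B = "30 * n ^ 2"])
    show "I (st 0) (s\<lparr>reg := (reg s)(4 := 0)\<rparr>)" using B by (simp add: I_def)
    show "aval (Reg 2) s' = k" if "I (st j) s'" for j s' using that s by (simp add: I_def frame_def stat_def)
    show "Q s'" if "I (st k) s'" for s' using that Q by (simp add: I_def)
    show "2 + (k - 0) * (30 * n ^ 2 + 2) \<le> 60 * n ^ 3"
      using k_mult[of "30 * n ^ 2 + 2"] n_pow by (simp add: algebra_simps)
    fix j s' assume j: "j < k" and I: "I (st j) s'" and r4: "reg s' 4 = j"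
    note I' = I[unfolded I_def]
    let ?q = "\<lambda>s'. reg s' 4 = j \<and> I (st (Suc j)) (s'\<lparr>reg := (reg s')(4 := Suc j)\<rparr>)"
    define s1 where "s1 = s'\<lparr>reg := (reg s')(6 := st j, 7 := fin j)\<rparr>"
    have st1: "reg s1 4 = j" "reg s1 6 = st j" "reg s1 7 = fin j" "arr s1 10 = arr s 10"
      and I1: "I (st j) s1"
      using I' s r4 by (simp_all add: s1_def stat_def I_def frame_def)
    have "wpt ?c (3 + n * (14 * n)) ?q s1"
    proof (rule wpt_Cond)
      assume "bval (Eq (Load 10 (Reg 4)) (Const 1)) s1"
      then have "arr s 10 j = 1" using st1 by simp
      then have pj: "\<not> pendant j" using np[OF j] by (metis zero_neq_one)
      define J where "J p s' \<longleftrightarrow> I p s' \<and> reg s' 4 = j \<and> reg s' 7 = fin j" for p s'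
      show "wpt (For 5 (Reg 6) (Reg 7) ?t) (2 + n * (14 * n)) ?q s1"
      proof (rule wpt_For[where I = J and L = "st j" and H = "fin j" and B = "4 + 8 * n"])
        show "J (st j) (s1\<lparr>reg := (reg s1)(5 := st j)\<rparr>)" using I1 st1 by (simp add: J_def I_def)
        show "aval (Reg 7) s' = fin j" if "J p s'" for p s' using that by (simp add: J_def)
        show "?q s'" if "J (fin j) s'" for s'
          using that tree_inv_next[OF _ j, of "fin j"] by (simp add: J_def I_def)
        have "len j * (6 + 8 * n) \<le> n * (14 * n)"
          using len_le[OF j] n_pos by (intro mult_mono) auto
        then show "2 + (fin j - st j) * (4 + 8 * n + 2) \<le> 2 + n * (14 * n)" by (simp add: len_def)
        fix p s' assume p: "st j \<le> p" "p < fin j" and J: "J p s'" and r5: "reg s' 5 = p"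
        have pE: "p \<in> E j" using p by (simp add: E_def)
        note J' = J[unfolded J_def I_def]
        have w4: "arr s' 4 = w" "reg s' 0 = n" using J' s by (simp_all add: frame_def stat_def)
        let ?qq = "advanced 5 p J"
        show "wpt ?t (4 + 8 * n) ?qq s'"
        proof (rule wpt_Cond[where ?B1.0 = 1 and ?B2.0 = "3 + 8 * n"])
          assume "bval (Eq (Load 6 (Load 4 (Reg 5))) (Load 6 (Load 4 (Add (Reg 5) (Const 1))))) s'"
          then show "wpt Skip 1 ?qq s'"
            by (intro wpt_exec_le)
              (use J' r5 w4 tree_inv_skip[OF _ j pE] in \<open>simp_all add: J_def I_def\<close>)
        next
          assume c: "\<not> bval (Eq (Load 6 (Load 4 (Reg 5))) (Load 6 (Load 4 (Add (Reg 5) (Const 1))))) s'"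
          let ?s2 = "exec (flip_com 8) s'"
          have s2: "?s2 = s'\<lparr>arr := (arr s')(8 := (arr s' 8)(p := 1 - arr s' 8 p), 2 := toggle p (arr s' 2))\<rparr>"
            using w4 r5 by (simp add: exec_flip)
          have "wpt merge_com (8 * n) ?qq ?s2"
          proof (rule wpt_merge)
            fix s3 assume f: "frame {6} {10, 11, 12} ?s2 s3" and l: "arr s3 6 = merged p (arr ?s2 6)"
            have "tree_inv (Suc p) (toggle p (arr s' 2)) (merged p (arr s' 6))
               ((arr s' 8)(p := 1 - arr s' 8 p)) (arr s 9)"
              using tree_inv_take[OF _ j pj pE] J' c r5 w4 by simp
            then show "?qq s3" using f l r5 J' by (simp add: s2 J_def I_def frame_def)
          qed (use w4 r5 s2 in simp_all)
          then show "wpt (Seq (flip_com 8) merge_com) (3 + 8 * n) ?qq s'"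
            by - (rule wpt_Seq_exec[where ?B2.0 = "8 * n"], simp_all)
        qed (use n_pos in auto)
      qed (use st1 st_fin[OF j] in auto)
    next
      assume "\<not> bval (Eq (Load 10 (Reg 4)) (Const 1)) s1"
      then have "arr s 10 j \<noteq> 1" using st1 by simp
      then have "pendant j" using np[OF j] by metis
      then have "tree_inv (st (Suc j)) (arr s1 2) (arr s1 6) (arr s1 8) (arr s 9)"
        using I1 tree_inv_next[OF _ j, of "st j"] by (simp add: I_def)
      then show "wpt Skip 1 ?q s1"
        by (intro wpt_exec_le) (use I1 st1 in \<open>simp_all add: I_def\<close>)
    qed auto
    then have "wpt span_com 2 (wpt ?c (3 + n * (14 * n)) ?q) s'"
      by (intro wpt_span) (use I' s r4 in \<open>simp_all add: frame_def stat_def s1_def\<close>)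
    moreover have "n * (14 * n) = 14 * n ^ 2" by (simp add: power2_eq_square)
    then have "2 + (3 + n * (14 * n)) \<le> 30 * n ^ 2" using n_pow(3) by linarith
    ultimately show "wpt (Seq span_com ?c) (30 * n ^ 2) ?q s'" by (rule wpt_Seq_le)
  qed auto
qed

lemma wpt_join_phase:
  assumes s: "stat s" and np: "\<And>i. i < k \<Longrightarrow> arr s 10 i = (if pendant i then 0 else 1)"
    and C: "join_inv 0 (arr s 8) (arr s 2) (arr s 9)"
    and Q: "\<And>s'. frame {2, 9} {4, 5, 6, 7, 8, 13} s s' \<Longrightarrow>
      join_inv k (arr s 8) (arr s' 2) (arr s' 9) \<Longrightarrow> Q s'"
  shows "wpt join_phase (60 * n ^ 3) Q s"
  unfolding join_phase_def
proof -
  define I where "I i s' \<longleftrightarrow> frame {2, 9} {4, 5, 6, 7, 8, 13} s s' \<and>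
    join_inv i (arr s 8) (arr s' 2) (arr s' 9)" for i s'
  let ?c = "Cond (Eq (Load 10 (Reg 4)) (Const 1)) solve_com Skip"
  let ?a = "Assign 4 (Sub (Sub (Reg 2) (Const 1)) (Reg 13))"
  show "wpt (For 13 (Const 0) (Reg 2) (Seq ?a (Seq span_com ?c))) (60 * n ^ 3) Q s"
  proof (rule wpt_For[where I = I and L = 0 and H = k and B = "25 * n ^ 2"])
    show "I 0 (s\<lparr>reg := (reg s)(13 := 0)\<rparr>)" using C by (simp add: I_def)
    show "aval (Reg 2) s' = k" if "I j s'" for j s' using that s by (simp add: I_def frame_def stat_def)
    show "Q s'" if "I k s'" for s' using that Q by (simp add: I_def)
    show "2 + (k - 0) * (25 * n ^ 2 + 2) \<le> 60 * n ^ 3"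
      using k_mult[of "25 * n ^ 2 + 2"] n_pow by (simp add: algebra_simps)
    fix i s' assume i: "i < k" and I: "I i s'" and r13: "reg s' 13 = i"
    note I' = I[unfolded I_def]
    define j where "j = k - 1 - i"
    have j: "j < k" using i by (simp add: j_def)
    let ?q = "advanced 13 i I"
    define s1 where "s1 = s'\<lparr>reg := (reg s')(4 := j, 6 := st j, 7 := fin j)\<rparr>"
    have st1: "reg s1 4 = j" "reg s1 6 = st j" "reg s1 7 = fin j" "arr s1 4 = w" "arr s1 10 = arr s 10" "reg s1 13 = i"
      and I1: "I i s1"
      using I' s r13 by (simp_all add: s1_def stat_def I_def frame_def)
    have "wpt ?c (1 + 20 * n) ?q s1"
    proof (rule wpt_Cond)
      assume "bval (Eq (Load 10 (Reg 4)) (Const 1)) s1"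
      then have "arr s 10 j = 1" using st1 by simp
      then have pj: "\<not> pendant j" using np[OF j] by (metis zero_neq_one)
      show "wpt solve_com (20 * n) ?q s1"
      proof (rule wpt_solve[OF j st1(2-4)])
        show "parity (arr s 8) (arr s1 9) (arr s1 2)" using I1 by (simp add: I_def join_inv_def)
        have "j + i < k" using i by (simp add: j_def)
        then show "\<forall>p\<in>E j. arr s1 9 p = 0" using I1 j pj unfolding I_def join_inv_def by blast
        fix s2 assume f: "frame {2, 9} {5, 8} s1 s2"
          and S: "solved j (arr s1 2) (arr s1 9) (arr s 8) (arr s2 2) (arr s2 9)"
        have "join_inv (Suc i) (arr s 8) (arr s2 2) (arr s2 9)"
          using join_inv_solved[OF _ i j_def pj S] I1 by (simp add: I_def)
        then show "?q s2" using f I1 st1 by (simp add: I_def frame_def)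
      qed
    next
      assume "\<not> bval (Eq (Load 10 (Reg 4)) (Const 1)) s1"
      then have "arr s 10 j \<noteq> 1" using st1 by simp
      then have "pendant (k - 1 - i)" using np[OF j] unfolding j_def[symmetric] by metis
      then have "join_inv (Suc i) (arr s 8) (arr s1 2) (arr s1 9)" using join_inv_skip[OF _ i] I1 by (simp add: I_def)
      then show "wpt Skip 1 ?q s1"
        by (intro wpt_exec_le) (use I1 st1 in \<open>simp_all add: I_def\<close>)
    qed (use n_pos in auto)
    then have "wpt span_com 2 (wpt ?c (1 + 20 * n) ?q) (s'\<lparr>reg := (reg s')(4 := j)\<rparr>)"
      by (intro wpt_span[where j = j]) (use I' s in \<open>simp_all add: frame_def stat_def s1_def\<close>)
    then have "wpt (Seq span_com ?c) (3 + 20 * n) ?q (s'\<lparr>reg := (reg s')(4 := j)\<rparr>)"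
      by (rule wpt_Seq_le) simp
    then have "wpt ?a 1 (wpt (Seq span_com ?c) (3 + 20 * n) ?q) s'"
      by - (rule wpt_exec_le, use I' s r13 in \<open>simp_all add: frame_def stat_def j_def\<close>)
    then show "wpt (Seq ?a (Seq span_com ?c)) (25 * n ^ 2) ?q s'"
      by (rule wpt_Seq_le) (use n_pow in simp)
  qed auto
qed

lemma wpt_output_phase:
  assumes s: "stat s" and st0: "st 0 = 0"
    and Q: "\<And>s' fs. fs = out_list (arr s 5) (arr s 8) (arr s 9) (st k) \<Longrightarrow> reg s' 0 = length fs \<Longrightarrow>
      stored s' fs \<Longrightarrow> Q s'"
  shows "wpt output_phase (60 * n ^ 3) Q s"
proof -
  define fs where "fs = out_list (arr s 5) (arr s 8) (arr s 9)"
  define I where "I P s' \<longleftrightarrow> frame {0, 1} {5, 8} s s' \<and> listed s' (fs P)" for P s'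
  let ?s0 = "s\<lparr>reg := (reg s)(8 := 0)\<rparr>"
  let ?b = "Seq (Cond (Eq (Load 8 (Reg 5)) (Const 1)) (emit_com 0) Skip)
       (Cond (Eq (Load 9 (Reg 5)) (Const 1)) (emit_com 1) Skip)"
  have "wpt (For 5 (Const 0) (Load 3 (Reg 2)) ?b) (2 + 3 * n * 10) (wpt (Assign 0 (Reg 8)) 1 Q) ?s0"
  proof (rule wpt_For[where I = I and L = 0 and H = "st k" and B = 8])
    show "I 0 (?s0\<lparr>reg := (reg ?s0)(5 := 0)\<rparr>)"
      by (simp add: I_def listed_def fs_def out_list_def frame_def)
    show "aval (Load 3 (Reg 2)) s' = st k" if "I P s'" for P s'
      using that s by (simp add: I_def frame_def stat_def)
    show "2 + (st k - 0) * (8 + 2) \<le> 2 + 3 * n * 10" using st_le[OF st0] by simp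
    show "wpt (Assign 0 (Reg 8)) 1 Q s'" if I: "I (st k) s'" for s'
    proof (rule wpt_exec_le)
      show "Q (exec (Assign 0 (Reg 8)) s')"
        using I by (intro Q[of "fs (st k)"]) (simp_all add: I_def fs_def listed_def)
    qed simp_all
    fix p s' assume I: "I p s'" and r5: "reg s' 5 = p"
    have eqs: "arr s' 8 = arr s 8" "arr s' 9 = arr s 9" "arr s' 5 = arr s 5" using I by (simp_all add: I_def frame_def)
    define fs1 where "fs1 = fs p @ (if arr s 8 p = 1 then [(arr s 5 p, False)] else [])"
    define s1 where "s1 = exec (Cond (Eq (Load 8 (Reg 5)) (Const 1)) (emit_com 0) Skip) s'"
    have 1: "frame {0, 1} {5, 8} s s1 \<and> listed s1 fs1 \<and> reg s1 5 = p"
      using I listed_emit[of s' "fs p" 0] eqs r5 unfolding s1_def fs1_def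
      by (simp add: I_def emit_com_def frame_def)
    have fs_Suc: "fs (Suc p) = fs1 @ (if arr s 9 p = 1 then [(arr s 5 p, True)] else [])"
      by (simp add: fs_def fs1_def out_list_def)
    define s2 where "s2 = exec (Cond (Eq (Load 9 (Reg 5)) (Const 1)) (emit_com 1) Skip) s1"
    have eqs1: "arr s1 9 = arr s 9" "arr s1 5 = arr s 5" using 1 by (simp_all add: frame_def)
    have 2: "frame {0, 1} {5, 8} s s2 \<and> listed s2 (fs (Suc p)) \<and> reg s2 5 = p"
      using 1 listed_emit[of s1 fs1 1] eqs1 unfolding s2_def fs_Suc
      by (simp add: emit_com_def frame_def)
    have "I (Suc p) (s2\<lparr>reg := (reg s2)(5 := Suc p)\<rparr>)" using 2 by (simp add: I_def listed_def)
    then show "wpt ?b 8 (advanced 5 p I) s'"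
      by (intro wpt_exec_le) (use 2 in \<open>simp_all add: s1_def s2_def\<close>)
  qed auto
  then have "wpt (Seq (For 5 (Const 0) (Load 3 (Reg 2)) ?b) (Assign 0 (Reg 8))) (3 + 30 * n) Q ?s0"
    by (rule wpt_Seq_le) simp
  then have "wpt (Assign 8 (Const 0)) 1
    (wpt (Seq (For 5 (Const 0) (Load 3 (Reg 2)) ?b) (Assign 0 (Reg 8))) (3 + 30 * n) Q) s"
    by - (rule wpt_exec_le, simp_all)
  then show ?thesis unfolding output_phase_def
    by (rule wpt_Seq_le) (use n_pow in simp)
qed

lemma wpt_init_phase:
  assumes s: "stat s" and st0: "st 0 = 0"
    and Q: "\<And>s'. frame {6, 7, 8, 9} {4, 5, 10} s s' \<Longrightarrow> marks (arr s' 7) \<Longrightarrow>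
      \<forall>v<n. arr s' 6 v = v \<Longrightarrow> \<forall>p<st k. arr s' 8 p = 0 \<and> arr s' 9 p = 0 \<Longrightarrow> Q s'"
  shows "wpt init_phase (60 * n ^ 3) Q s"
proof -
  define I where "I i s' \<longleftrightarrow> frame {6, 7, 8, 9} {4, 5, 10} s s' \<and> (\<forall>v<i. arr s' 6 v = v \<and> arr s' 7 v = 0)" for i s'
  define J where "J p s' \<longleftrightarrow> I n s' \<and> (\<forall>p'<p. arr s' 8 p' = 0 \<and> arr s' 9 p' = 0)" for p s'
  define H where "H j s' \<longleftrightarrow> frame {6, 7, 8, 9} {4, 5, 10} s s' \<and> (\<forall>v<n. arr s' 6 v = v) \<and>
    (\<forall>p<st k. arr s' 8 p = 0 \<and> arr s' 9 p = 0) \<and>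
    (\<forall>v<n. arr s' 7 v = 1 \<longleftrightarrow> (\<exists>i<j. w (st i) = v \<or> w (fin i) = v))" for j s'
  let ?c1 = "For 10 (Const 0) (Reg 0) (Seq (Store 6 (Reg 10) (Reg 10)) (Store 7 (Reg 10) (Const 0)))"
  let ?c2 = "For 5 (Const 0) (Load 3 (Reg 2)) (Seq (Store 8 (Reg 5) (Const 0)) (Store 9 (Reg 5) (Const 0)))"
  let ?c3 = "For 4 (Const 0) (Reg 2) (Seq (Store 7 (Load 4 (Load 3 (Reg 4))) (Const 1))
          (Store 7 (Load 4 (Sub (Load 3 (Add (Reg 4) (Const 1))) (Const 1))) (Const 1)))"
  have 3: "wpt ?c3 (2 + n * 4) Q s'" if J: "J (st k) s'" for s'
  proof (rule wpt_For[where I = H and L = 0 and H = k and B = 2])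
    show "H 0 (s'\<lparr>reg := (reg s')(4 := 0)\<rparr>)" using J by (simp add: H_def I_def J_def)
    show "aval (Reg 2) s' = k" if "H i s'" for i s' using that s by (simp add: H_def frame_def stat_def)
    show "Q s'" if "H k s'" for s' using that Q[of s'] by (simp add: H_def marks_def)
    fix j s' assume j: "j < k" and H: "H j s'" and r4: "reg s' 4 = j"
    have r: "arr s' 3 = st" "arr s' 4 = w" using H s by (simp_all add: H_def frame_def stat_def)
    have f: "st (Suc j) - 1 = fin j" by (simp add: fin_def)
    show "wpt (Seq (Store 7 (Load 4 (Load 3 (Reg 4))) (Const 1))
          (Store 7 (Load 4 (Sub (Load 3 (Add (Reg 4) (Const 1))) (Const 1))) (Const 1))) 2
          (advanced 4 j H) s'"
      by (rule wpt_exec_le) (use H r4 r f in \<open>auto simp: H_def frame_def less_Suc_eq\<close>)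
  qed (use k_le in auto)
  have 2: "wpt ?c2 (2 + 3 * n * 4) (wpt ?c3 (2 + n * 4) Q) s'" if I: "I n s'" for s'
  proof (rule wpt_For[where I = J and L = 0 and H = "st k" and B = 2])
    show "J 0 (s'\<lparr>reg := (reg s')(5 := 0)\<rparr>)" using I by (simp add: I_def J_def)
    show "aval (Load 3 (Reg 2)) s' = st k" if "J i s'" for i s' using that s by (simp add: I_def J_def frame_def stat_def)
    show "wpt ?c3 (2 + n * 4) Q s'" if "J (st k) s'" for s' using 3 that .
    fix p s' assume J: "J p s'" and r: "reg s' 5 = p"
    show "wpt (Seq (Store 8 (Reg 5) (Const 0)) (Store 9 (Reg 5) (Const 0))) 2
          (advanced 5 p J) s'"
      by (rule wpt_exec_le) (use J r in \<open>auto simp: J_def I_def frame_def less_Suc_eq\<close>)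
  qed (use st_le[OF st0] in auto)
  have 1: "wpt ?c1 (2 + n * 4) (wpt (Seq ?c2 ?c3) (4 + 16 * n) Q) s"
  proof (rule wpt_For[where I = I and L = 0 and H = n and B = 2])
    show "I 0 (s\<lparr>reg := (reg s)(10 := 0)\<rparr>)" by (simp add: I_def)
    show "aval (Reg 0) s' = n" if "I i s'" for i s' using that s by (simp add: I_def frame_def stat_def)
    show "wpt (Seq ?c2 ?c3) (4 + 16 * n) Q s'" if "I n s'" for s'
      using 2[OF that] by (rule wpt_Seq_le) simp
    fix i s' assume I: "I i s'" and r: "reg s' 10 = i"
    show "wpt (Seq (Store 6 (Reg 10) (Reg 10)) (Store 7 (Reg 10) (Const 0))) 2
          (advanced 10 i I) s'"
      by (rule wpt_exec_le) (use I r in \<open>auto simp: I_def frame_def less_Suc_eq\<close>)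
  qed auto
  from 1 show ?thesis unfolding init_phase_def by (rule wpt_Seq_le) (use n_pow in simp)
qed

theorem wpt_program:
  assumes s: "stat s" and st0: "st 0 = 0" and q: "\<And>v. v < n \<Longrightarrow> arr s 2 v = \<tau> v"
    and Q: "\<And>s' b x fs. outcome b x \<Longrightarrow> fs = out_list (arr s 5) b x (st k) \<Longrightarrow> reg s' 0 = length fs \<Longrightarrow>
      stored s' fs \<Longrightarrow> Q s'"
  shows "wpt program (300 * n ^ 3) Q s"
proof -
  \<comment> \<open>All five phases are granted the same bound, whence the factor 300.\<close>
  let ?B = "60 * n ^ 3"
  have "wpt init_phase ?B (wpt pendant_phase ?B (wpt tree_phase ?B (wpt join_phase ?B (wpt output_phase ?B Q)))) s"
  proof (rule wpt_init_phase[OF s st0])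
    fix s1 assume f1: "frame {6, 7, 8, 9} {4, 5, 10} s s1" and m: "marks (arr s1 7)"
      and 1: "\<forall>v<n. arr s1 6 v = v" "\<forall>p<st k. arr s1 8 p = 0 \<and> arr s1 9 p = 0"
    have s1: "stat s1" using s f1 by (simp add: stat_def frame_def)
    have "arr s1 2 = arr s 2" using f1 by (simp add: frame_def)
    then have "pendant_inv 0 (arr s1 2) (arr s1 6) (arr s1 8) (arr s1 9) (arr s1 10)"
      using 1 q by (intro pendant_inv_init) simp_all
    then show "wpt pendant_phase ?B (wpt tree_phase ?B (wpt join_phase ?B (wpt output_phase ?B Q))) s1"
    proof (rule wpt_pendant_phase[OF s1 m])
      fix s2 assume f2: "frame {2, 6, 8, 9, 10} {4, 5, 6, 7, 8, 9, 10, 11, 12} s1 s2"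
        and A: "pendant_inv k (arr s2 2) (arr s2 6) (arr s2 8) (arr s2 9) (arr s2 10)"
      have s2: "stat s2" using s1 f2 by (simp add: stat_def frame_def)
      have np: "arr s2 10 i = (if pendant i then 0 else 1)" if "i < k" for i
        using A that unfolding pendant_inv_def by blast
      show "wpt tree_phase ?B (wpt join_phase ?B (wpt output_phase ?B Q)) s2"
      proof (rule wpt_tree_phase[OF s2 _ tree_inv_init[OF A]])
        show "arr s2 10 i = (if pendant i then 0 else 1)" if "i < k" for i using np that .
        fix s3 assume f3: "frame {2, 6, 8} {4, 5, 6, 7, 10, 11, 12} s2 s3"
          and B: "tree_inv (st k) (arr s3 2) (arr s3 6) (arr s3 8) (arr s2 9)"
        have s3: "stat s3" and np3: "arr s3 10 = arr s2 10" and x3: "arr s3 9 = arr s2 9"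
          using s2 f3 by (simp_all add: stat_def frame_def)
        have C: "join_inv 0 (arr s3 8) (arr s3 2) (arr s3 9)" using join_inv_init[OF B] x3 by simp
        show "wpt join_phase ?B (wpt output_phase ?B Q) s3"
        proof (rule wpt_join_phase[OF s3 _ C])
          show "arr s3 10 i = (if pendant i then 0 else 1)" if "i < k" for i using np np3 that by simp
          fix s4 assume f4: "frame {2, 9} {4, 5, 6, 7, 8, 13} s3 s4"
            and C4: "join_inv k (arr s3 8) (arr s4 2) (arr s4 9)"
          have s4: "stat s4" and b4: "arr s4 8 = arr s3 8" and e4: "arr s4 5 = arr s 5"
            using s3 f4 f3 f2 f1 by (simp_all add: stat_def frame_def)
          have out: "outcome (arr s4 8) (arr s4 9)" using join_inv_outcome[OF B order_refl C4] b4 by simp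
          show "wpt output_phase ?B Q s4"
          proof (rule wpt_output_phase[OF s4 st0])
            fix s' :: memory and fs assume "fs = out_list (arr s4 5) (arr s4 8) (arr s4 9) (st k)" "reg s' 0 = length fs"
              "stored s' fs"
            then show "Q s'" using Q[OF out, of fs s'] e4 by simp
          qed
        qed
      qed
    qed
  qed
  then have "wpt program (?B + (?B + (?B + (?B + ?B)))) Q s"
    unfolding program_def by - (erule wpt_Seq_cong)+
  then show ?thesis by (rule wpt_mono) auto
qed

end

section \<open>Ear-decompositions\<close>

text \<open>If the next vertex already occurs, the path is cut back to that occurrence; otherwise it
  is extended.\<close>

lemma rtrancl_simple_path:
  assumes "(u, v) \<in> R\<^sup>*"
  shows "\<exists>vs. vs \<noteq> [] \<and> hd vs = u \<and> last vs = v \<and> distinct vs \<and>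
    (\<forall>i. Suc i < length vs \<longrightarrow> (vs ! i, vs ! Suc i) \<in> R)"
  using assms
proof (induction rule: rtrancl_induct)
  case base
  show ?case by (rule exI[of _ "[u]"]) simp
next
  case (step y z)
  then obtain vs where vs: "vs \<noteq> []" "hd vs = u" "last vs = y" "distinct vs"
    "\<And>i. Suc i < length vs \<Longrightarrow> (vs ! i, vs ! Suc i) \<in> R" by blast
  show ?case
  proof (cases "z \<in> set vs")
    case True
    then obtain xs ys where v: "vs = xs @ z # ys" by (meson split_list)
    have "(vs ! i, vs ! Suc i) \<in> R" "(xs @ [z]) ! i = vs ! i" "(xs @ [z]) ! Suc i = vs ! Suc i"
      if "Suc i < length (xs @ [z])" for i
      using vs(5)[of i] that by (auto simp: v nth_append)
    moreover have "hd (xs @ [z]) = u" using vs(2) v by (cases xs) auto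
    ultimately show ?thesis using vs(4) v by (intro exI[of _ "xs @ [z]"]) auto
  next
    case False
    have "((vs @ [z]) ! i, (vs @ [z]) ! Suc i) \<in> R" if "Suc i < length (vs @ [z])" for i
    proof (cases "Suc i < length vs")
      case True
      then show ?thesis using vs(5)[of i] by (simp add: nth_append)
    next
      case F: False
      then have "i = length vs - 1" "i < length vs" using that vs(1) by auto
      then show ?thesis using vs(1,3) step.hyps(2) by (simp add: nth_append last_conv_nth)
    qed
    then show ?thesis using vs False by (intro exI[of _ "vs @ [z]"]) auto
  qed
qed

text \<open>A simple path from \<open>u\<close> to \<open>v\<close> in \<open>Y\<close>, closed by
  \<open>e\<close>, would be a circuit in \<open>S\<close>. If its only edge is parallel to
  \<open>e\<close>, the circuit has two edges.\<close>

lemma forest_not_reachable: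
  assumes f: "forest (spanning_subgraph G S)" and wf: "\<And>e. e \<in> S \<Longrightarrow> ends G e \<subseteq> verts G"
    and e: "e \<in> S" "ends G e = {u, v}" "u \<noteq> v" and Y: "Y \<subseteq> S" "e \<notin> Y"
  shows "\<not> reachable (spanning_subgraph G Y) u v"
proof
  assume "reachable (spanning_subgraph G Y) u v"
  then have "(u, v) \<in> {(x, y). \<exists>e\<in>Y. ends G e = {x, y}}\<^sup>*"
    by (simp add: reachable_def spanning_subgraph_def)
  from rtrancl_simple_path[OF this] obtain vs where vs: "vs \<noteq> []" "hd vs = u" "last vs = v" "distinct vs"
    and "\<And>i. Suc i < length vs \<Longrightarrow> \<exists>e\<in>Y. ends G e = {vs ! i, vs ! Suc i}" by auto
  then obtain f where f': "\<And>i. Suc i < length vs \<Longrightarrow> f i \<in> Y \<and> ends G (f i) = {vs ! i, vs ! Suc i}" by metis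
  define m where "m = length vs - 1"
  have m: "length vs = Suc m" using vs(1) by (simp add: m_def)
  have u0: "vs ! 0 = u" "vs ! m = v" using vs m by (simp_all add: hd_conv_nth last_conv_nth)
  have fi: "f i \<in> Y" "ends G (f i) = {vs ! i, vs ! Suc i}" if "i < m" for i using f'[of i] that m by auto
  define es where "es = map f [0..<m] @ [e]"
  define C where "C = \<lparr>verts = set vs, edges = set es, ends = ends G\<rparr>"
  have len: "length es = Suc m" by (simp add: es_def)
  \<comment> \<open>Different steps along distinct vertices have different pairs of ends, so the
    chosen edges differ too.\<close>
  have "inj_on f {0..<m}"
  proof (rule inj_onI)
    fix i j assume ij: "i \<in> {0..<m}" "j \<in> {0..<m}" "f i = f j"
    then have "{vs ! i, vs ! Suc i} = {vs ! j, vs ! Suc j}" using fi by (metis atLeastLessThan_iff)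
    then show "i = j" using ij m vs(4) by (auto simp: doubleton_eq_iff nth_eq_iff_index_eq)
  qed
  then have des: "distinct es" using fi Y(2) by (auto simp: es_def distinct_map)
  have ends_es: "ends G (es ! i) = {(vs @ [u]) ! i, (vs @ [u]) ! Suc i}" if "i < Suc m" for i
  proof (cases "i < m")
    case True
    then show ?thesis using fi(2) m by (simp add: es_def nth_append)
  next
    case False
    then have "i = m" using that by simp
    then show ?thesis using e(2) m u0 by (auto simp: es_def nth_append)
  qed
  have "traversal C (vs @ [u]) es"
    unfolding traversal_def C_def using len m des ends_es u0 nth_mem[of 0 vs] by auto
  moreover have "hd (vs @ [u]) = last (vs @ [u])" using vs by simp
  moreover have "distinct (tl (vs @ [u]))" using vs by (cases vs) auto
  ultimately have "circuit C" unfolding circuit_def using len by (intro exI[of _ "vs @ [u]"] exI[of _ es]) auto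
  moreover have "subgraph C (spanning_subgraph G S)"
  proof -
    have sub: "set es \<subseteq> S" using fi(1) Y(1) e(1) by (auto simp: es_def)
    have ee: "ends G (es ! i) \<subseteq> set vs" if "i < Suc m" for i
      using ends_es[OF that] that m u0 nth_mem[of 0 vs] nth_mem[of i vs] nth_mem[of "Suc i" vs]
      by (auto simp: nth_append)
    then have "ends G e' \<subseteq> set vs" if "e' \<in> set es" for e'
      using that len by (auto simp: in_set_conv_nth)
    moreover have "set vs \<subseteq> verts G"
    proof
      fix x assume "x \<in> set vs"
      then obtain i where i: "i < Suc m" "x = vs ! i" using m by (auto simp: in_set_conv_nth)
      then have "x \<in> ends G (es ! i)" using ends_es[OF i(1)] m by (simp add: nth_append)
      moreover have "es ! i \<in> S" using sub len i by (simp add: subset_iff)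
      ultimately show "x \<in> verts G" using wf by blast
    qed
    ultimately show ?thesis using sub by (auto simp: subgraph_def spanning_subgraph_def C_def)
  qed
  ultimately show False using f unfolding forest_def by blast
qed

locale ear_decomposed =
  fixes G :: "('v, 'e) mgraph" and Ps :: "('v, 'e) mgraph list"
  assumes fin_G: "fin_mgraph G" and ears: "ear_decomposition G Ps"
begin

lemma ear_cases:
  assumes "i \<in> ear_idx Ps"
  obtains (circuit) vs es where "traversal (Ps ! i) vs es" "es \<noteq> []" "hd vs = last vs" "distinct (tl vs)"
      "card (ear_endpoints Ps i) = 1"
  | (path) a b vs es where "a \<noteq> b" "traversal (Ps ! i) vs es" "distinct vs" "hd vs = a" "last vs = b"
      "ear_endpoints Ps i = {a, b}"
  using assms ears unfolding ear_decomposition_def circuit_def path_between_def ear_endpoints_def by metis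

lemma ear_in_set: "i \<in> ear_idx Ps \<Longrightarrow> Ps ! i \<in> set Ps"
  by (simp add: ear_idx_def)

lemma sub: "P \<in> set Ps \<Longrightarrow> subgraph P G"
  using ears by (simp add: ear_decomposition_def)

lemma traversal_length: "traversal P vs es \<Longrightarrow> length es = card (edges P)" "traversal P vs es \<Longrightarrow> length vs = Suc (card (edges P))"
  using distinct_card by (fastforce simp: traversal_def)+

lemma circuit_card_verts:
  assumes "traversal P vs es" "es \<noteq> []" "hd vs = last vs" "distinct (tl vs)"
  shows "card (verts P) = card (edges P)"
proof -
  have l: "length vs = Suc (length es)" "verts P = set vs" using assms(1) by (simp_all add: traversal_def)
  then obtain x xs where x: "vs = x # xs" "xs \<noteq> []" using assms(2) by (cases vs) fastforce+
  then have "x \<in> set xs" using assms(3) by (metis last_ConsR last_in_set list.sel(1))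
  then have "card (set vs) = length xs" using x assms(4) by (simp add: distinct_card insert_absorb)
  then show ?thesis using l x traversal_length(1)[OF assms(1)] by simp
qed

lemma ear_length_pos:
  assumes "i \<in> ear_idx Ps"
  shows "1 \<le> ear_length Ps i"
  using assms
proof (cases rule: ear_cases)
  case (circuit vs es)
  then have "0 < length es" by simp
  then show ?thesis using traversal_length(1)[OF circuit(1)] unfolding ear_length_def by linarith
next
  case (path a b vs es)
  then have "0 < length es" by (auto simp: traversal_def length_Suc_conv)
  then show ?thesis using traversal_length(1)[OF path(2)] unfolding ear_length_def by linarith
qed

text \<open>An ear of length 1 is either a loop, excluded by \<open>fin_mgraph\<close>, or an edge
  whose two vertices are its endpoints.\<close>

lemma inn_nontrivial:
  assumes i: "i \<in> ear_idx Ps" and v: "v \<in> ear_inn Ps i"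
  shows "nontrivial_ear Ps i"
proof -
  have "ear_length Ps i \<noteq> 1"
  proof
    assume one: "ear_length Ps i = 1"
    show False using i
    proof (cases rule: ear_cases)
      case (circuit vs es)
      have "length es = 1" "length vs = 2" using traversal_length[OF circuit(1)] one by (simp_all add: ear_length_def)
      then obtain x y e where xy: "vs = [x, y]" "es = [e]" by (auto simp: length_Suc_conv numeral_2_eq_2)
      then have "x = y" "ends (Ps ! i) e = {x, y}" "e \<in> edges (Ps ! i)" using circuit by (auto simp: traversal_def)
      then have "card (ends G e) = 1" "e \<in> edges G"
        using sub[OF ear_in_set[OF i]] by (auto simp: subgraph_def)
      then show False using fin_G by (auto simp: fin_mgraph_def)
    next
      case (path a b vs es)
      have "length vs = 2" using traversal_length[OF path(2)] one by (simp add: ear_length_def)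
      then obtain x y where "vs = [x, y]" by (auto simp: length_Suc_conv numeral_2_eq_2)
      then have "verts (Ps ! i) = ear_endpoints Ps i" using path by (auto simp: traversal_def)
      then show False using v by (auto simp: ear_inn_def ear_endpoints_def)
    qed
  qed
  then show ?thesis using ear_length_pos[OF i] i by (simp add: nontrivial_ear_def)
qed

text \<open>The encoded traversal need not be the one from the decomposition, so distinctness is
  recovered by counting: a circuit of length l has l vertices and a path has l + 1, which leaves no
  room for repetitions.\<close>

lemma traversal_inner:
  assumes i: "i \<in> ear_idx Ps" and t: "traversal (Ps ! i) vs es" and e: "{hd vs, last vs} = ear_endpoints Ps i"
    and l: "2 \<le> ear_length Ps i"
  shows "distinct (tl vs)" "hd vs \<notin> set (butlast (tl vs))" "ear_inn Ps i = set (butlast (tl vs))"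
proof -
  have len: "length vs = Suc (ear_length Ps i)" and V: "verts (Ps ! i) = set vs"
    using t traversal_length[OF t] by (simp_all add: traversal_def ear_length_def)
  obtain x xs where x: "vs = x # xs" "xs \<noteq> []" using len l by (cases vs) fastforce+
  obtain ys z where xs: "xs = ys @ [z]" using x(2) by (meson rev_exhaust)
  have *: "distinct xs \<and> x \<notin> set ys" using i
  proof (cases rule: ear_cases)
    case (circuit vs' es')
    have "card (set vs) = length xs"
      using circuit_card_verts[OF circuit(1-4)] V len x by (simp add: ear_length_def)
    moreover have "x = z" using circuit(5) x xs unfolding e[symmetric] by (auto simp: card_Suc_eq doubleton_eq_iff)
    then have "set vs = set xs" using x xs by auto
    ultimately have "distinct xs" by (simp add: card_distinct)
    then show ?thesis using \<open>x = z\<close> xs by auto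
  next
    case (path a b vs' es')
    have "card (set vs) = length vs"
      using path distinct_card[of vs'] V t traversal_length[OF path(2)] traversal_length[OF t]
      by (simp add: traversal_def)
    then have "distinct vs" by (rule card_distinct)
    then show ?thesis using x xs by auto
  qed
  then show "distinct (tl vs)" "hd vs \<notin> set (butlast (tl vs))" using x xs by auto
  have "ear_inn Ps i = set vs - {x, z}"
    using e x xs V by (auto simp: ear_inn_def ear_endpoints_def)
  then show "ear_inn Ps i = set (butlast (tl vs))" using * x xs by auto
qed

definition root :: 'v where
  "root = the_elem (verts (Ps ! 0))"

lemma root: "verts (Ps ! 0) = {root}"
  using ears by (auto simp: root_def ear_decomposition_def)

lemma Ps_nonempty: "0 < length Ps"
  using ears by (simp add: ear_decomposition_def)

lemma verts_ear: "m < length Ps \<Longrightarrow> verts (Ps ! m) \<subseteq> verts G" "m < length Ps \<Longrightarrow> edges (Ps ! m) \<subseteq> edges G"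
  using sub[of "Ps ! m"] by (auto simp: subgraph_def)

lemma ends_ear: "m < length Ps \<Longrightarrow> ends (Ps ! m) = ends G"
  using sub[of "Ps ! m"] by (auto simp: subgraph_def)

lemma root_in: "root \<in> verts G"
  using root verts_ear(1)[OF Ps_nonempty] by simp

text \<open>A vertex is internal to the ear of least index that contains it, unless it is the
  initial vertex.\<close>

lemma first_ear:
  assumes "m < length Ps" "v \<in> verts (Ps ! m)"
  shows "v = root \<or> (\<exists>i\<le>m. nontrivial_ear Ps i \<and> v \<in> ear_inn Ps i)"
proof -
  define i where "i = (LEAST i. v \<in> verts (Ps ! i))"
  have vi: "v \<in> verts (Ps ! i)" unfolding i_def using assms(2) by (rule LeastI)
  have im: "i \<le> m" unfolding i_def using assms(2) by (rule Least_le)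
  have "v \<notin> verts (Ps ! j)" if "j < i" for j using that not_less_Least unfolding i_def by blast
  then have inn: "v \<in> ear_inn Ps i" using vi by (auto simp: ear_inn_def prior_verts_def)
  show ?thesis
  proof (cases "i = 0")
    case True
    then show ?thesis using vi root by simp
  next
    case False
    then have "i \<in> ear_idx Ps" using im assms(1) by (simp add: ear_idx_def)
    then show ?thesis using inn_nontrivial inn im by blast
  qed
qed

lemma vertex_ear:
  assumes "v \<in> verts G" "v \<noteq> root"
  obtains i where "nontrivial_ear Ps i" "v \<in> ear_inn Ps i"
proof -
  have "v \<in> (\<Union>P\<in>set Ps. verts P)" using assms(1) ears by (simp add: ear_decomposition_def)
  then obtain m where "m < length Ps" "v \<in> verts (Ps ! m)" by (auto simp: in_set_conv_nth)
  then show ?thesis using first_ear assms(2) that by blast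
qed

lemma endpoint_ear:
  assumes "i \<in> ear_idx Ps" "v \<in> ear_endpoints Ps i"
  shows "v = root \<or> (\<exists>j<i. nontrivial_ear Ps j \<and> v \<in> ear_inn Ps j)"
proof -
  obtain m where "m < i" "v \<in> verts (Ps ! m)" using assms(2) by (auto simp: ear_endpoints_def prior_verts_def)
  moreover have "m < length Ps" using \<open>m < i\<close> assms(1) by (simp add: ear_idx_def)
  ultimately show ?thesis using first_ear by (meson order_le_less_trans)
qed

lemma inn_disjoint: "v \<in> ear_inn Ps i \<Longrightarrow> v \<in> ear_inn Ps j \<Longrightarrow> i = j"
  by (cases i j rule: linorder_cases) (auto simp: ear_inn_def prior_verts_def)

lemma root_not_inn: "i \<in> ear_idx Ps \<Longrightarrow> root \<notin> ear_inn Ps i"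
proof -
  assume "i \<in> ear_idx Ps"
  then have "verts (Ps ! 0) \<subseteq> prior_verts Ps i" by (fastforce simp: ear_idx_def prior_verts_def)
  then show ?thesis using root by (auto simp: ear_inn_def)
qed

lemma ear_edges_disjoint: "i < length Ps \<Longrightarrow> j < length Ps \<Longrightarrow> e \<in> edges (Ps ! i) \<Longrightarrow> e \<in> edges (Ps ! j) \<Longrightarrow> i = j"
  using ears unfolding ear_decomposition_def by (metis disjoint_iff linorder_neqE_nat)

end

section \<open>From the memory to the graph\<close>

locale encoded = ear_decomposed G Ps
  for G :: "('v, 'e) mgraph" and Ps :: "('v, 'e) mgraph list" +
  fixes T :: "'v set" and \<alpha> :: "'v \<Rightarrow> nat" and \<beta> :: "'e \<Rightarrow> nat" and s :: memory
  assumes T: "T \<subseteq> verts G" "even (card T)"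
    and nice: "nice_ear_decomposition G Ps"
    and enc: "encodes_input s \<alpha> \<beta> G T Ps"
begin

definition nt :: "nat list" where "nt = nontrivial_ears Ps"
definition k :: nat where "k = length nt"
definition n :: nat where "n = card (verts G)"
definition st :: "nat \<Rightarrow> nat" where "st = arr s 3"
definition w :: "nat \<Rightarrow> nat" where "w = arr s 4"
definition edge_at :: "nat \<Rightarrow> 'e" where "edge_at p = inv_into (edges G) \<beta> (arr s 5 p)"
definition \<tau> :: "nat \<Rightarrow> nat" where "\<tau> = arr s 2"
definition r :: nat where "r = reg s 3"

lemma bij_\<alpha>: "bij_betw \<alpha> (verts G) {..<n}"
  and bij_\<beta>: "bij_betw \<beta> (edges G) {..<card (edges G)}"
  and regs: "reg s 0 = n" "reg s 2 = k" "{reg s 3} = \<alpha> ` verts (Ps ! 0)"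
  and T_enc: "\<And>v. v \<in> verts G \<Longrightarrow> \<tau> (\<alpha> v) = (if v \<in> T then 1 else 0)"
  and st_0: "st 0 = 0"
  and st_Suc': "\<And>j. j < k \<Longrightarrow> st (Suc j) = st j + ear_length Ps (nt ! j) + 1"
  and enc_ear: "\<And>j. j < k \<Longrightarrow> encodes_ear s \<alpha> \<beta> Ps (nt ! j) (st j)"
proof -
  note e = enc[unfolded encodes_input_def]
  have T: "\<forall>v\<in>verts G. arr s 2 (\<alpha> v) = (if v \<in> T then 1 else 0)" using e by (elim conjE)
  have E: "\<forall>j<length (nontrivial_ears Ps).
        arr s 3 (Suc j) = arr s 3 j + ear_length Ps (nontrivial_ears Ps ! j) + 1 \<and>
        encodes_ear s \<alpha> \<beta> Ps (nontrivial_ears Ps ! j) (arr s 3 j)" using e by (elim conjE)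
  show "bij_betw \<alpha> (verts G) {..<n}" unfolding n_def using e by (elim conjE)
  show "bij_betw \<beta> (edges G) {..<card (edges G)}" using e by (elim conjE)
  show "reg s 0 = n" unfolding n_def using e by (elim conjE)
  show "reg s 2 = k" unfolding k_def nt_def using e by (elim conjE)
  show "{reg s 3} = \<alpha> ` verts (Ps ! 0)" using e by (elim conjE)
  show "\<tau> (\<alpha> v) = (if v \<in> T then 1 else 0)" if "v \<in> verts G" for v using T that unfolding \<tau>_def by blast
  show "st 0 = 0" unfolding st_def using e by (elim conjE)
  show "st (Suc j) = st j + ear_length Ps (nt ! j) + 1" if "j < k" for j
    using E that unfolding st_def nt_def k_def by blast
  show "encodes_ear s \<alpha> \<beta> Ps (nt ! j) (st j)" if "j < k" for j
    using E that unfolding st_def nt_def k_def by blast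
qed

lemma \<alpha>_inj: "u \<in> verts G \<Longrightarrow> v \<in> verts G \<Longrightarrow> \<alpha> u = \<alpha> v \<longleftrightarrow> u = v"
  using inj_on_eq_iff[OF bij_betw_imp_inj_on[OF bij_\<alpha>]] .

lemma \<alpha>_less: "v \<in> verts G \<Longrightarrow> \<alpha> v < n"
  using bij_betwE[OF bij_\<alpha>] by blast

lemma \<alpha>_surj: "x < n \<Longrightarrow> \<exists>v\<in>verts G. \<alpha> v = x"
  using bij_betw_imp_surj_on[OF bij_\<alpha>] by (metis image_iff lessThan_iff)

lemma r_eq: "r = \<alpha> root"
  using regs(3) root by (simp add: r_def)

lemma set_nt: "set nt = {i. nontrivial_ear Ps i}"
  by (auto simp: nt_def nontrivial_ears_def nontrivial_ear_def ear_idx_def)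

lemma sorted_nt: "sorted_wrt (<) nt"
  by (simp add: nt_def nontrivial_ears_def sorted_wrt_filter)

lemma distinct_nt: "distinct nt"
  by (simp add: nt_def nontrivial_ears_def)

lemma nt: "j < k \<Longrightarrow> nontrivial_ear Ps (nt ! j)"
  using set_nt by (auto simp: k_def)

lemma nt_idx: "j < k \<Longrightarrow> nt ! j \<in> ear_idx Ps"
  using nt by (simp add: nontrivial_ear_def)

lemma nt_less_length: "j < k \<Longrightarrow> nt ! j < length Ps"
  using nt_idx by (simp add: ear_idx_def)

lemma nt_ex: "nontrivial_ear Ps i \<Longrightarrow> \<exists>j<k. nt ! j = i"
  using set_nt in_set_conv_nth[of i nt] by (simp add: k_def)

lemma nt_less: "i < k \<Longrightarrow> j < k \<Longrightarrow> nt ! i < nt ! j \<Longrightarrow> i < j"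
  using sorted_wrt_nth_less[OF sorted_nt, of j i] unfolding k_def by (cases i j rule: linorder_cases) auto

lemma nt_inj: "i < k \<Longrightarrow> j < k \<Longrightarrow> nt ! i = nt ! j \<Longrightarrow> i = j"
  using distinct_nt by (simp add: nth_eq_iff_index_eq k_def)

lemma card_nt:
  assumes "\<And>i. Q i \<Longrightarrow> nontrivial_ear Ps i"
  shows "card {i. Q i} = card {j. j < k \<and> Q (nt ! j)}"
proof -
  have "bij_betw ((!) nt) {j. j < k \<and> Q (nt ! j)} {i. Q i}"
    unfolding bij_betw_def
  proof
    show "inj_on ((!) nt) {j. j < k \<and> Q (nt ! j)}" using nt_inj by (auto simp: inj_on_def)
    show "(!) nt ` {j. j < k \<and> Q (nt ! j)} = {i. Q i}" using nt_ex assms by (auto simp: image_iff)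
  qed
  then show ?thesis by (metis bij_betw_same_card)
qed

lemma st_Suc: "j < k \<Longrightarrow> st (Suc j) = st j + ear_length Ps (nt ! j) + 1" "j < k \<Longrightarrow> 2 \<le> ear_length Ps (nt ! j)"
  using st_Suc'[of j] nt[of j] by (auto simp: nontrivial_ear_def)

lemma ear_enc:
  assumes j: "j < k"
  obtains vs es where "traversal (Ps ! (nt ! j)) vs es" "{hd vs, last vs} = ear_endpoints Ps (nt ! j)"
    "length vs = Suc (ear_length Ps (nt ! j))" "length es = ear_length Ps (nt ! j)"
    "\<And>p. p \<le> ear_length Ps (nt ! j) \<Longrightarrow> w (st j + p) = \<alpha> (vs ! p)"
    "\<And>p. p < ear_length Ps (nt ! j) \<Longrightarrow> edge_at (st j + p) = es ! p \<and> arr s 5 (st j + p) = \<beta> (es ! p)"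
proof -
  from enc_ear[OF j] obtain vs es where *: "traversal (Ps ! (nt ! j)) vs es"
    "{hd vs, last vs} = ear_endpoints Ps (nt ! j)"
    "\<forall>p<length vs. arr s 4 (st j + p) = \<alpha> (vs ! p)" "\<forall>p<length es. arr s 5 (st j + p) = \<beta> (es ! p)"
    by (auto simp: encodes_ear_def)
  have len: "length vs = Suc (ear_length Ps (nt ! j))" "length es = ear_length Ps (nt ! j)"
    using traversal_length[OF *(1)] by (simp_all add: ear_length_def)
  have "es ! p \<in> edges G" if "p < length es" for p
    using *(1) that verts_ear(2)[OF nt_less_length[OF j]] by (auto simp: traversal_def)
  then have "edge_at (st j + p) = es ! p" if "p < length es" for p
    using that *(4) bij_\<beta> by (simp add: edge_at_def inv_into_f_f bij_betw_imp_inj_on)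
  then show ?thesis using that[OF *(1,2) len] *(3,4) len by (simp add: w_def less_Suc_eq_le)
qed

lemma w_verts: "j < k \<Longrightarrow> st j \<le> p \<Longrightarrow> p < st (Suc j) \<Longrightarrow> w p \<in> \<alpha> ` verts (Ps ! (nt ! j))"
proof -
  assume j: "j < k" and p: "st j \<le> p" "p < st (Suc j)"
  obtain vs es where e: "traversal (Ps ! (nt ! j)) vs es" "length vs = Suc (ear_length Ps (nt ! j))"
    "\<And>p. p \<le> ear_length Ps (nt ! j) \<Longrightarrow> w (st j + p) = \<alpha> (vs ! p)" using ear_enc[OF j] by metis
  have q: "p - st j < length vs" using p st_Suc[OF j] e(2) by simp
  then have "w p = \<alpha> (vs ! (p - st j))" using e(3)[of "p - st j"] p(1) e(2) by simp
  moreover have "vs ! (p - st j) \<in> verts (Ps ! (nt ! j))" using e(1) q by (auto simp: traversal_def)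
  ultimately show ?thesis by blast
qed

lemma w_less: "j < k \<Longrightarrow> st j \<le> p \<Longrightarrow> p < st (Suc j) \<Longrightarrow> w p < n"
proof -
  assume j: "j < k" and p: "st j \<le> p" "p < st (Suc j)"
  obtain v where "v \<in> verts (Ps ! (nt ! j))" "w p = \<alpha> v" using w_verts[OF j p] by blast
  then show ?thesis using verts_ear(1)[OF nt_less_length[OF j]] \<alpha>_less[of v] by auto
qed

lemma w_inner:
  assumes j: "j < k"
  shows "w ` {p. st j < p \<and> Suc p < st (Suc j)} = \<alpha> ` ear_inn Ps (nt ! j)"
    and "\<And>p q. st j < p \<Longrightarrow> Suc p < st (Suc j) \<Longrightarrow> st j \<le> q \<Longrightarrow> q < st (Suc j) \<Longrightarrow> w p = w q \<Longrightarrow> p = q"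
    and "\<alpha> ` ear_endpoints Ps (nt ! j) = {w (st j), w (st (Suc j) - 1)}"
proof -
  let ?l = "ear_length Ps (nt ! j)"
  obtain vs es where e: "traversal (Ps ! (nt ! j)) vs es" "{hd vs, last vs} = ear_endpoints Ps (nt ! j)"
    "length vs = Suc ?l" "\<And>p. p \<le> ?l \<Longrightarrow> w (st j + p) = \<alpha> (vs ! p)" using ear_enc[OF j] by metis
  note l = st_Suc[OF j]
  note inn = traversal_inner[OF nt_idx[OF j] e(1,2) l(2)]
  have btl: "butlast (tl vs) = map (\<lambda>i. vs ! Suc i) [0..<?l - 1]"
    by (rule nth_equalityI) (use e(3) in \<open>simp_all add: nth_butlast nth_tl\<close>)
  have set_inn: "ear_inn Ps (nt ! j) = (\<lambda>i. vs ! Suc i) ` {..<?l - 1}"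
    using inn(3) unfolding btl by (simp add: atLeast0LessThan)
  have P: "{p. st j < p \<and> Suc p < st (Suc j)} = (\<lambda>i. st j + Suc i) ` {..<?l - 1}"
  proof
    show "{p. st j < p \<and> Suc p < st (Suc j)} \<subseteq> (\<lambda>i. st j + Suc i) ` {..<?l - 1}"
    proof
      fix p assume "p \<in> {p. st j < p \<and> Suc p < st (Suc j)}"
      then show "p \<in> (\<lambda>i. st j + Suc i) ` {..<?l - 1}" using l
        by (intro image_eqI[of _ _ "p - Suc (st j)"]) auto
    qed
  qed (use l in auto)
  have wi: "w (st j + Suc i) = \<alpha> (vs ! Suc i)" if "i < ?l - 1" for i
    using e(4)[of "Suc i"] that by simp
  show "w ` {p. st j < p \<and> Suc p < st (Suc j)} = \<alpha> ` ear_inn Ps (nt ! j)"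
    unfolding P set_inn image_image using wi by (intro image_cong) auto
  have V: "vs ! p \<in> verts G" if "p \<le> ?l" for p
    using that e(1,3) verts_ear(1)[OF nt_less_length[OF j]] by (fastforce simp: traversal_def)
  show "p = q" if pq: "st j < p" "Suc p < st (Suc j)" "st j \<le> q" "q < st (Suc j)" "w p = w q" for p q
  proof -
    define a b where "a = p - st j" and "b = q - st j"
    have ab: "0 < a" "a < ?l" "b \<le> ?l" "p = st j + a" "q = st j + b" using pq l by (auto simp: a_def b_def)
    have "\<alpha> (vs ! a) = \<alpha> (vs ! b)" using pq(5) ab e(4)[of a] e(4)[of b] by simp
    then have eq: "vs ! a = vs ! b" using \<alpha>_inj V ab by simp
    show "p = q"
    proof (cases "b = 0")
      case True
      have "vs ! a \<in> set (butlast (tl vs))" unfolding btl using ab by (auto intro!: image_eqI[of _ _ "a - 1"])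
      moreover have "vs ! b = hd vs" using True e(3) by (cases vs) auto
      ultimately show ?thesis using inn(2) eq by simp
    next
      case False
      then have "tl vs ! (a - 1) = tl vs ! (b - 1)" using eq ab e(3) by (simp add: nth_tl)
      then have "a - 1 = b - 1" using inn(1) ab False e(3) by (subst (asm) nth_eq_iff_index_eq) auto
      then show ?thesis using ab False by simp
    qed
  qed
  have "vs \<noteq> []" using e(3) by auto
  then have "hd vs = vs ! 0" "last vs = vs ! ?l" using e(3) by (simp_all add: hd_conv_nth last_conv_nth)
  then show "\<alpha> ` ear_endpoints Ps (nt ! j) = {w (st j), w (st (Suc j) - 1)}"
    unfolding e(2)[symmetric] using e(4)[of 0] e(4)[of ?l] l by simp
qed

lemma edge_at_bij:
  assumes j: "j < k"
  shows "bij_betw edge_at {st j..<st (Suc j) - 1} (edges (Ps ! (nt ! j)))"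
    and "\<And>p. st j \<le> p \<Longrightarrow> Suc p < st (Suc j) \<Longrightarrow> arr s 5 p = \<beta> (edge_at p) \<and> \<alpha> ` ends G (edge_at p) = {w p, w (Suc p)}"
proof -
  let ?l = "ear_length Ps (nt ! j)"
  obtain vs es where e: "traversal (Ps ! (nt ! j)) vs es" "length vs = Suc ?l" "length es = ?l"
    "\<And>p. p \<le> ?l \<Longrightarrow> w (st j + p) = \<alpha> (vs ! p)"
    "\<And>p. p < ?l \<Longrightarrow> edge_at (st j + p) = es ! p \<and> arr s 5 (st j + p) = \<beta> (es ! p)" using ear_enc[OF j] by metis
  note l = st_Suc[OF j]
  have edge_atp: "edge_at p = es ! (p - st j)" if "p \<in> {st j..<st (Suc j) - 1}" for p
  proof -
    have "p - st j < ?l" "st j \<le> p" using that l by auto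
    then show ?thesis using e(5)[of "p - st j"] by simp
  qed
  have b: "bij_betw (\<lambda>p. p - st j) {st j..<st (Suc j) - 1} {..<length es}"
    by (rule bij_betw_byWitness[where f' = "\<lambda>i. i + st j"]) (use l e(3) in auto)
  have "bij_betw ((!) es) {..<length es} (edges (Ps ! (nt ! j)))"
    using e(1) by (intro bij_betw_nth) (simp_all add: traversal_def)
  from bij_betw_trans[OF b this] show "bij_betw edge_at {st j..<st (Suc j) - 1} (edges (Ps ! (nt ! j)))"
    by (rule bij_betw_cong[THEN iffD1, rotated]) (simp add: edge_atp)
  fix p assume p: "st j \<le> p" "Suc p < st (Suc j)"
  define a where "a = p - st j"
  have a: "p = st j + a" "a < ?l" using p l by (auto simp: a_def)
  have "ends G (es ! a) = {vs ! a, vs ! Suc a}"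
    using e(1) a(2) e(3) ends_ear[OF nt_less_length[OF j]] by (simp add: traversal_def)
  then show "arr s 5 p = \<beta> (edge_at p) \<and> \<alpha> ` ends G (edge_at p) = {w p, w (Suc p)}"
    using e(4)[of a] e(4)[of "Suc a"] e(5)[of a] a by simp
qed

lemma sum_\<tau>: "(\<Sum>v<n. \<tau> v) = card T"
proof -
  have "(\<Sum>v<n. \<tau> v) = (\<Sum>v\<in>verts G. \<tau> (\<alpha> v))" using sum.reindex_bij_betw[OF bij_\<alpha>] by metis
  also have "\<dots> = (\<Sum>v\<in>verts G. if v \<in> T then 1 else 0)" using T_enc by (intro sum.cong) auto
  also have "\<dots> = card T" using fin_G T(1) by (simp add: fin_mgraph_def sum.If_cases Int_absorb1)
  finally show ?thesis .
qed

lemma w_inn: "j < k \<Longrightarrow> st j < p \<Longrightarrow> Suc p < st (Suc j) \<Longrightarrow> \<exists>v\<in>ear_inn Ps (nt ! j). w p = \<alpha> v"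
  using w_inner(1)[of j] by blast

lemma inn_verts: "j < k \<Longrightarrow> v \<in> ear_inn Ps (nt ! j) \<Longrightarrow> v \<in> verts G"
  using verts_ear(1)[OF nt_less_length] by (auto simp: ear_inn_def)

lemma endpoints_verts: "j < k \<Longrightarrow> v \<in> ear_endpoints Ps (nt ! j) \<Longrightarrow> v \<in> verts G"
  using verts_ear(1)[OF nt_less_length] by (auto simp: ear_endpoints_def)

lemma w_endpoint: "j < k \<Longrightarrow> e = st j \<or> Suc e = st (Suc j) \<Longrightarrow> \<exists>v\<in>ear_endpoints Ps (nt ! j). w e = \<alpha> v"
proof -
  assume "j < k" "e = st j \<or> Suc e = st (Suc j)"
  then have "w e \<in> \<alpha> ` ear_endpoints Ps (nt ! j)" using w_inner(3)[of j] by (auto dest: sym)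
  then show ?thesis by blast
qed

lemma short_nt: "j < k \<Longrightarrow> st (Suc j) \<le> st j + 4 \<longleftrightarrow> short_ear Ps (nt ! j)"
proof -
  assume j: "j < k"
  have "ear_length Ps (nt ! j) \<le> 3 \<longleftrightarrow> ear_length Ps (nt ! j) = 2 \<or> ear_length Ps (nt ! j) = 3"
    using st_Suc(2)[OF j] by linarith
  then show ?thesis using st_Suc(1)[OF j] nt_idx[OF j] by (simp add: short_ear_def)
qed

text \<open>From here on the analysis by positions applies to the memory. Condition (ii) of niceness
  yields \<open>short_not_attached\<close>, and the even size of \<open>T\<close> yields
  \<open>demand_even\<close>.\<close>

sublocale ear_list n k r st w \<tau>
proof
  show "st j + 3 \<le> st (Suc j)" if "j < k" for j using st_Suc[OF that] by simp
  show "r < n" using r_eq \<alpha>_less root_in by simp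
  show "w p < n" if "j < k" "st j \<le> p" "p < st (Suc j)" for j p using w_less that .
  show "p = p'" if "i < k" "j < k" "st i < p" "Suc p < st (Suc i)" "st j < p'" "Suc p' < st (Suc j)" "w p = w p'"
    for i j p p'
  proof -
    note h = that
    obtain u v where uv: "u \<in> ear_inn Ps (nt ! i)" "w p = \<alpha> u" "v \<in> ear_inn Ps (nt ! j)" "w p' = \<alpha> v"
      using w_inn[OF h(1,3,4)] w_inn[OF h(2,5,6)] by blast
    have "u \<in> verts G" "v \<in> verts G" using uv inn_verts that(1,2) by blast+
    then have "u = v" using uv that(7) \<alpha>_inj[of u v] by simp
    then have "nt ! i = nt ! j" using uv inn_disjoint by blast
    then have "i = j" using nt_inj that(1,2) by blast
    then show ?thesis using w_inner(2)[of i p p'] that by simp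
  qed
  show "\<exists>j<k. \<exists>p. st j < p \<and> Suc p < st (Suc j) \<and> w p = x" if x: "x < n" "x \<noteq> r" for x
  proof -
    obtain v where v: "v \<in> verts G" "\<alpha> v = x" using \<alpha>_surj x by blast
    then have "v \<noteq> root" using x r_eq by auto
    then obtain i where "nontrivial_ear Ps i" "v \<in> ear_inn Ps i" using vertex_ear v by blast
    then obtain j where j: "j < k" "v \<in> ear_inn Ps (nt ! j)" using nt_ex by blast
    then have "x \<in> w ` {p. st j < p \<and> Suc p < st (Suc j)}" unfolding w_inner(1)[OF j(1)] using v by blast
    then show ?thesis using j(1) by auto
  qed
  show "w p \<noteq> r" if "j < k" "st j < p" "Suc p < st (Suc j)" for j p
  proof -
    note h = that
    obtain v where v: "v \<in> ear_inn Ps (nt ! j)" "w p = \<alpha> v" using w_inn[OF h] by blast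
    have "v \<noteq> root" using root_not_inn[OF nt_idx[OF that(1)]] v(1) by blast
    then show ?thesis using v(2) \<alpha>_inj[OF inn_verts[OF that(1) v(1)] root_in] by (simp add: r_eq)
  qed
  show "w e = r \<or> (\<exists>i<j. \<exists>p. st i < p \<and> Suc p < st (Suc i) \<and> w e = w p)"
    if "j < k" "e = st j \<or> Suc e = st (Suc j)" for j e
  proof -
    note h = that
    obtain v where v: "v \<in> ear_endpoints Ps (nt ! j)" "w e = \<alpha> v" using w_endpoint[OF h] by blast
    show ?thesis
    proof (cases "v = root")
      case False
      then obtain i' where i': "i' < nt ! j" "nontrivial_ear Ps i'" "v \<in> ear_inn Ps i'"
        using endpoint_ear[OF nt_idx[OF h(1)] v(1)] by blast
      then obtain i where i: "i < k" "nt ! i = i'" using nt_ex by blast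
      then have "i < j" using nt_less i' that(1) by blast
      moreover have "w e \<in> w ` {p. st i < p \<and> Suc p < st (Suc i)}" 
        unfolding w_inner(1)[OF i(1)] v(2) i(2) using i'(3) by (rule imageI)
      ultimately show ?thesis by blast
    qed (use v r_eq in simp)
  qed
  show "w e \<noteq> w p" if "i < k" "j < k" "st (Suc j) \<le> st j + 4" "st j < p" "Suc p < st (Suc j)"
    "e = st i \<or> Suc e = st (Suc i)" for i j p e
  proof
    note h = that
    assume eq: "w e = w p"
    obtain u where u: "u \<in> ear_endpoints Ps (nt ! i)" "w e = \<alpha> u" using w_endpoint[OF h(1,6)] by blast
    obtain v where v: "v \<in> ear_inn Ps (nt ! j)" "w p = \<alpha> v" using w_inn[OF h(2,4,5)] by blast
    have "u = v" using eq u(2) v(2) \<alpha>_inj[OF endpoints_verts[OF that(1) u(1)] inn_verts[OF that(2) v(1)]] by simp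
    then have "attached Ps (nt ! i) (nt ! j)" using u(1) v(1) unfolding attached_def by blast
    moreover have "pendant_ear Ps (nt ! j)" 
      using short_nt[OF h(2)] h(3) nice unfolding nice_ear_decomposition_def by blast
    ultimately show False using nt[OF h(1)] unfolding pendant_ear_def by blast
  qed
  show "\<tau> v \<le> 1" if "v < n" for v using \<alpha>_surj[OF that] T_enc by auto
  show "even (\<Sum>v<n. \<tau> v)" using sum_\<tau> T by simp
qed

lemma len_eq: "j < k \<Longrightarrow> len j = ear_length Ps (nt ! j)"
  using st_Suc(1)[of j] by (simp add: len_def fin_def)

lemma inner_eq: "j < k \<Longrightarrow> w ` inner j = \<alpha> ` ear_inn Ps (nt ! j)"
proof -
  assume j: "j < k"
  have "inner j = {p. st j < p \<and> Suc p < st (Suc j)}" using st_fin(2)[OF j] by (auto simp: inner_def)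
  then show ?thesis using w_inner(1)[OF j] by simp
qed

lemma pendant_eq: "j < k \<Longrightarrow> pendant j \<longleftrightarrow> pendant_ear Ps (nt ! j)"
proof -
  assume j: "j < k"
  have "pendant j \<longleftrightarrow> (\<forall>i<k. {w (st i), w (fin i)} \<inter> w ` inner j = {})"
    by (auto simp: pendant_def)
  also have "\<dots> \<longleftrightarrow> (\<forall>i<k. ear_endpoints Ps (nt ! i) \<inter> ear_inn Ps (nt ! j) = {})"
  proof (intro all_cong1 imp_cong refl)
    fix i assume i: "i < k"
    have "{w (st i), w (fin i)} = \<alpha> ` ear_endpoints Ps (nt ! i)" using w_inner(3)[OF i] by (simp add: fin_def)
    moreover have "\<alpha> ` ear_endpoints Ps (nt ! i) \<inter> \<alpha> ` ear_inn Ps (nt ! j) = \<alpha> ` (ear_endpoints Ps (nt ! i) \<inter> ear_inn Ps (nt ! j))"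
      by (rule inj_on_image_Int[symmetric, of \<alpha> "verts G"])
        (use bij_\<alpha> endpoints_verts[OF i] inn_verts[OF j] in \<open>auto simp: bij_betw_def\<close>)
    ultimately show "{w (st i), w (fin i)} \<inter> w ` inner j = {} \<longleftrightarrow>
      ear_endpoints Ps (nt ! i) \<inter> ear_inn Ps (nt ! j) = {}" using inner_eq[OF j] by simp
  qed
  also have "\<dots> \<longleftrightarrow> pendant_ear Ps (nt ! j)"
    using nt nt_ex j unfolding pendant_ear_def attached_def by metis
  finally show ?thesis .
qed

lemma clean_eq: "j < k \<Longrightarrow> clean j \<longleftrightarrow> clean_ear Ps T (nt ! j)"
proof -
  assume j: "j < k"
  have "(\<forall>p\<in>inner j. \<tau> (w p) = 0) \<longleftrightarrow> (\<forall>x\<in>w ` inner j. \<tau> x = 0)" by simp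
  also have "\<dots> \<longleftrightarrow> (\<forall>v\<in>ear_inn Ps (nt ! j). \<tau> (\<alpha> v) = 0)" unfolding inner_eq[OF j] by simp
  also have "\<dots> \<longleftrightarrow> ear_inn Ps (nt ! j) \<inter> T = {}" using T_enc inn_verts[OF j] by auto
  finally have "(\<forall>p\<in>inner j. \<tau> (w p) = 0) \<longleftrightarrow> ear_inn Ps (nt ! j) \<inter> T = {}" .
  moreover have "len j \<le> 3 \<longleftrightarrow> short_ear Ps (nt ! j)"
    using short_nt[OF j] len_eq[OF j] st_Suc(1)[OF j] by simp
  ultimately show ?thesis by (simp add: clean_def clean_ear_def)
qed

lemma E_eq: "E j = {st j..<st (Suc j) - 1}"
  by (simp add: E_def fin_def)

lemma edge_at_edge: "p \<in> EE \<Longrightarrow> edge_at p \<in> edges G \<and> arr s 5 p = \<beta> (edge_at p) \<and> \<alpha> ` ends G (edge_at p) = {w p, w (Suc p)}"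
proof -
  assume "p \<in> EE"
  then obtain j where j: "j < k" "p \<in> E j" by (auto simp: EE_def)
  then have "edge_at p \<in> edges (Ps ! (nt ! j))" using edge_at_bij(1)[OF j(1)] bij_betwE unfolding E_eq by blast
  moreover have "st j \<le> p" "Suc p < st (Suc j)" using j by (auto simp: E_eq)
  ultimately show ?thesis using edge_at_bij(2)[OF j(1)] verts_ear(2)[OF nt_less_length[OF j(1)]] by blast
qed

lemma edge_at_inj: "inj_on edge_at EE"
proof (rule inj_onI)
  fix p q assume pq: "p \<in> EE" "q \<in> EE" "edge_at p = edge_at q"
  then obtain i j where ij: "i < k" "j < k" "p \<in> E i" "q \<in> E j" by (auto simp: EE_def)
  have "edge_at p \<in> edges (Ps ! (nt ! i))" "edge_at q \<in> edges (Ps ! (nt ! j))"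
    using edge_at_bij(1)[OF ij(1)] edge_at_bij(1)[OF ij(2)] ij(3,4) bij_betwE unfolding E_eq by blast+
  then have "nt ! i = nt ! j" using ear_edges_disjoint nt_less_length ij pq(3) by metis
  then have "i = j" using nt_inj ij by blast
  then show "p = q" using edge_at_bij(1)[OF ij(1)] ij pq(3) unfolding E_eq by (metis bij_betw_imp_inj_on inj_onD)
qed

lemma ends_verts: "e \<in> edges G \<Longrightarrow> ends G e \<subseteq> verts G"
  using fin_G by (simp add: fin_mgraph_def)

lemma edge_at_ends:
  assumes "p \<in> EE"
  obtains u v where "u \<in> verts G" "v \<in> verts G" "\<alpha> u = w p" "\<alpha> v = w (Suc p)" "ends G (edge_at p) = {u, v}" "u \<noteq> v"
proof -
  note e = edge_at_edge[OF assms]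
  obtain u v where uv: "u \<in> ends G (edge_at p)" "\<alpha> u = w p" "v \<in> ends G (edge_at p)" "\<alpha> v = w (Suc p)"
  proof -
    have "w p \<in> \<alpha> ` ends G (edge_at p)" "w (Suc p) \<in> \<alpha> ` ends G (edge_at p)" using e by simp_all
    then show ?thesis using that by (elim imageE) simp
  qed
  have sub: "ends G (edge_at p) \<subseteq> verts G" using e ends_verts by blast
  have V: "u \<in> verts G" "v \<in> verts G" using uv sub by blast+
  have "\<alpha> ` ends G (edge_at p) = \<alpha> ` {u, v}" using e uv by simp
  then have "ends G (edge_at p) = {u, v}"
    using inj_on_image_eq_iff[OF bij_betw_imp_inj_on[OF bij_\<alpha>] sub, of "{u, v}"] V by simp
  moreover have "u \<noteq> v"
  proof
    assume "u = v"
    then show False using uv(2,4) adj_neq[OF assms] by simp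
  qed
  ultimately show ?thesis using that[OF V uv(2,4)] by blast
qed

text \<open>Each link lifts to an edge of \<open>G\<close>, and injectivity of
  \<open>\<alpha>\<close> makes consecutive lifted edges fit together.\<close>

lemma conn_reachable:
  assumes "conn w X x y" "X \<subseteq> EE" "u \<in> verts G" "\<alpha> u = x"
  shows "\<exists>v\<in>verts G. \<alpha> v = y \<and> reachable (spanning_subgraph G (edge_at ` X)) u v"
  using assms(1) unfolding conn_def
proof (induction rule: rtrancl_induct)
  case base
  then show ?case using assms(3,4) by (auto simp: reachable_def)
next
  case (step y z)
  then obtain v where v: "v \<in> verts G" "\<alpha> v = y" "reachable (spanning_subgraph G (edge_at ` X)) u v" by blast
  obtain p where p: "p \<in> X" "{w p, w (Suc p)} = {y, z}" using step.hyps(2) by (auto simp: link_def)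
  have "p \<in> EE" using p assms(2) by blast
  then obtain a b where ab: "a \<in> verts G" "b \<in> verts G" "\<alpha> a = w p" "\<alpha> b = w (Suc p)" "ends G (edge_at p) = {a, b}"
    using edge_at_ends by metis
  then obtain v' where v': "v' \<in> verts G" "\<alpha> v' = z" "ends G (edge_at p) = {v, v'}"
  proof -
    from p(2) consider "w p = y" "w (Suc p) = z" | "w p = z" "w (Suc p) = y" by (auto simp: doubleton_eq_iff)
    then show ?thesis
    proof cases
      case 1
      then have "a = v" using \<alpha>_inj[OF ab(1) v(1)] ab(3) v(2) by simp
      then show ?thesis using that[of b] ab 1 by simp
    next
      case 2
      then have "b = v" using \<alpha>_inj[OF ab(2) v(1)] ab(4) v(2) by simp
      then show ?thesis using that[of a] ab 2 by (simp add: insert_commute)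
    qed
  qed
  have "(v, v') \<in> {(x, y). \<exists>e\<in>edges (spanning_subgraph G (edge_at ` X)). ends (spanning_subgraph G (edge_at ` X)) e = {x, y}}"
    using v' p(1) by (auto simp: spanning_subgraph_def)
  then have "reachable (spanning_subgraph G (edge_at ` X)) u v'"
    using v(3) unfolding reachable_def by (rule rtrancl_into_rtrancl[rotated])
  then show ?case using v' by blast
qed

text \<open>The edges of a forest can be accepted in any order, since by
  \<open>forest_not_reachable\<close> the ends of an edge are never joined by the others. Hence
  plain induction on the finite set \<open>X\<close>.\<close>

lemma forest_indep:
  assumes f: "forest (spanning_subgraph G S)" and S: "S \<subseteq> edges G" and X: "X \<subseteq> EE" "edge_at ` X \<subseteq> S"
  shows "indep w X"
  using finite_subset[OF X(1) finite_EE] X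
proof (induction X rule: finite_induct)
  case empty
  show ?case by (rule indep_empty)
next
  case (insert p X)
  have p: "p \<in> EE" "X \<subseteq> EE" using insert.prems by auto
  obtain u v where uv: "u \<in> verts G" "v \<in> verts G" "\<alpha> u = w p" "\<alpha> v = w (Suc p)" "ends G (edge_at p) = {u, v}" "u \<noteq> v"
    using edge_at_ends[OF p(1)] .
  show ?case
  proof (rule indep_insert)
    show "indep w X" using insert by simp
    show "\<not> conn w X (w p) (w (Suc p))"
    proof
      assume "conn w X (w p) (w (Suc p))"
      then have "reachable (spanning_subgraph G (edge_at ` X)) u v"
      proof -
        obtain v' where "v' \<in> verts G" "\<alpha> v' = w (Suc p)" "reachable (spanning_subgraph G (edge_at ` X)) u v'"
          using conn_reachable[OF \<open>conn w X (w p) (w (Suc p))\<close> p(2) uv(1,3)] by blast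
        then show ?thesis using \<alpha>_inj[OF _ uv(2), of v'] uv(4) by simp
      qed
      moreover have "edge_at p \<notin> edge_at ` X" using edge_at_inj p insert.hyps(2) by (metis inj_on_image_mem_iff)
      moreover have "ends G e \<subseteq> verts G" if "e \<in> S" for e using that S ends_verts by blast
      moreover have "edge_at p \<in> S" "edge_at ` X \<subseteq> S" using insert.prems(2) by auto
      ultimately show False
        using forest_not_reachable[OF f _ _ uv(5,6), of "edge_at ` X"] by blast
    qed
  qed
qed

end

section \<open>The connected T-join\<close>

text \<open>The program writes edge numbers while the proof speaks of edges; this translates one
  list into the other.\<close>

lemma map_out_list: "map (\<lambda>(e, c). (g e, c)) (out_list f b x N) = out_list (\<lambda>p. g (f p)) b x N"
  unfolding out_list_def map_concat map_map by (intro arg_cong[where f = concat] map_cong) auto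

lemma set_out_list: "set (out_list f b x N) =
    (\<lambda>p. (f p, False)) ` {p. p < N \<and> b p = 1} \<union> (\<lambda>p. (f p, True)) ` {p. p < N \<and> x p = 1}"
  by (auto simp: out_list_def split: if_splits)

lemma distinct_out_list:
  "inj_on f {p. p < N \<and> (b p = 1 \<or> x p = 1)} \<Longrightarrow> distinct (out_list f b x N)"
proof (induction N)
  case 0
  show ?case by (simp add: out_list_def)
next
  case (Suc N)
  have "inj_on f {p. p < N \<and> (b p = 1 \<or> x p = 1)}" using Suc.prems by (rule inj_on_subset) auto
  then have d: "distinct (out_list f b x N)" by (rule Suc.IH)
  have new: "f N \<noteq> f p" if "p < N" "b p = 1 \<or> x p = 1" "b N = 1 \<or> x N = 1" for p
  proof
    assume "f N = f p"
    then have "N = p" using inj_onD[OF Suc.prems] that by simp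
    then show False using that(1) by simp
  qed
  have "out_list f b x (Suc N) = out_list f b x N @ ((if b N = 1 then [(f N, False)] else []) @
     (if x N = 1 then [(f N, True)] else []))" by (simp add: out_list_def)
  then show ?case using d new by (auto simp: set_out_list)
qed

context encoded
begin

lemma inn_nonempty: "j < k \<Longrightarrow> ear_inn Ps (nt ! j) \<noteq> {}"
proof -
  assume j: "j < k"
  have "Suc (st j) \<in> inner j" using st_fin(1)[OF j] by (simp add: inner_def)
  then show ?thesis using inner_eq[OF j] by auto
qed

lemma clean_nontrivial: "clean_ear Ps T i \<Longrightarrow> nontrivial_ear Ps i"
  by (auto simp: clean_ear_def short_ear_def nontrivial_ear_def)

lemma clean_pendant: "clean_ear Ps T i \<Longrightarrow> pendant_ear Ps i"
  using nice by (auto simp: clean_ear_def nice_ear_decomposition_def)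

lemma inn_inj: "inj_on (ear_inn Ps) {i. nontrivial_ear Ps i}"
proof (rule inj_onI)
  fix i j assume ij: "i \<in> {i. nontrivial_ear Ps i}" "j \<in> {i. nontrivial_ear Ps i}" "ear_inn Ps i = ear_inn Ps j"
  then obtain a where "a < k" "nt ! a = i" using nt_ex by blast
  then obtain v where "v \<in> ear_inn Ps i" using inn_nonempty by blast
  then show "i = j" using inn_disjoint ij(3) by blast
qed

text \<open>A short ear has at most two internal vertices, at the consecutive positions after its
  start.\<close>

lemma short_inn_edge:
  assumes j: "j < k" and l: "len j \<le> 3" and uv: "u \<in> ear_inn Ps (nt ! j)" "v \<in> ear_inn Ps (nt ! j)" "u \<noteq> v"
  shows "\<exists>e\<in>edges G. ends G e = {u, v}"
proof -
  have "\<alpha> u \<in> w ` inner j" "\<alpha> v \<in> w ` inner j" using uv inner_eq[OF j] by blast+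
  then obtain p q where pq: "p \<in> inner j" "q \<in> inner j" "\<alpha> u = w p" "\<alpha> v = w q" by blast
  have "p \<noteq> q"
  proof
    assume "p = q"
    then show False using pq \<alpha>_inj[OF inn_verts[OF j uv(1)] inn_verts[OF j uv(2)]] uv(3) by simp
  qed
  define m where "m = Suc (st j)"
  have m: "p = m \<and> q = Suc m \<or> p = Suc m \<and> q = m" and "m \<in> inner j"
    using pq(1,2) \<open>p \<noteq> q\<close> l by (auto simp: inner_def len_def m_def)
  then have "m \<in> EE" using inner_subset_E E_EE[OF j] by blast
  then obtain a b where ab: "a \<in> verts G" "b \<in> verts G" "\<alpha> a = w m" "\<alpha> b = w (Suc m)" "ends G (edge_at m) = {a, b}"
    using edge_at_ends by metis
  have V: "u \<in> verts G" "v \<in> verts G" using uv inn_verts[OF j] by blast+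
  have "{a, b} = {u, v}"
  proof (cases "p = m \<and> q = Suc m")
    case True
    then have "a = u" "b = v" using ab(3,4) pq(3,4) \<alpha>_inj[OF ab(1) V(1)] \<alpha>_inj[OF ab(2) V(2)] by simp_all
    then show ?thesis by simp
  next
    case False
    then have "p = Suc m" "q = m" using m by auto
    then have "a = v" "b = u" using ab(3,4) pq(3,4) \<alpha>_inj[OF ab(1) V(2)] \<alpha>_inj[OF ab(2) V(1)] by simp_all
    then show ?thesis by auto
  qed
  then show ?thesis using ab(5) edge_at_edge[OF \<open>m \<in> EE\<close>] by auto
qed

text \<open>Condition (iii) of niceness keeps edges of the induced subgraph from leaving the
  interior of a clean ear, and the middle edge of a 3-ear joins its two internal vertices.\<close>

lemma eardrum_eq: "associated_eardrum G T Ps = ear_inn Ps ` {i. clean_ear Ps T i}"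
proof -
  let ?X = "\<Union>i\<in>{i. clean_ear Ps T i}. ear_inn Ps i"
  let ?H = "induced_subgraph G ?X"
  have comp: "{u \<in> ?X. reachable ?H v u} = ear_inn Ps i" if i: "clean_ear Ps T i" and v: "v \<in> ear_inn Ps i" for i v
  proof
    show "{u \<in> ?X. reachable ?H v u} \<subseteq> ear_inn Ps i"
    proof
      fix u assume "u \<in> {u \<in> ?X. reachable ?H v u}"
      then have "(v, u) \<in> {(x, y). \<exists>e\<in>edges ?H. ends ?H e = {x, y}}\<^sup>*" by (simp add: reachable_def)
      then show "u \<in> ear_inn Ps i"
      proof (induction rule: rtrancl_induct)
        case (step y z)
        then obtain e where e: "e \<in> edges G" "ends G e \<subseteq> ?X" "ends G e = {y, z}"
          by (auto simp: induced_subgraph_def)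
        then obtain i' where i': "clean_ear Ps T i'" "z \<in> ear_inn Ps i'" by blast
        have "i' = i"
        proof (rule ccontr)
          assume "i' \<noteq> i"
          then have "\<exists>i j u v e. short_ear Ps i \<and> short_ear Ps j \<and> i \<noteq> j \<and>
            u \<in> ear_inn Ps i \<and> v \<in> ear_inn Ps j \<and> e \<in> edges G \<and> ends G e = {u, v}"
            using i i' step.IH e unfolding clean_ear_def by metis
          then show False using nice unfolding nice_ear_decomposition_def by blast
        qed
        then show ?case using i' by simp
      qed (rule v)
    qed
    show "ear_inn Ps i \<subseteq> {u \<in> ?X. reachable ?H v u}"
    proof
      fix u assume u: "u \<in> ear_inn Ps i"
      have "reachable ?H v u"
      proof (cases "u = v")
        case False
        obtain j where j: "j < k" "nt ! j = i" using nt_ex clean_nontrivial i by blast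
        have "clean j" using clean_eq[OF j(1)] i j(2) by simp
        then obtain e where e: "e \<in> edges G" "ends G e = {v, u}"
          using short_inn_edge[of j v u] j u v False by (auto simp: clean_def)
        then have "e \<in> edges ?H" "ends ?H e = {v, u}" using u v i by (auto simp: induced_subgraph_def)
        then show ?thesis unfolding reachable_def by blast
      qed (simp add: reachable_def)
      then show "u \<in> {u \<in> ?X. reachable ?H v u}" using u i by blast
    qed
  qed
  have V: "verts ?H = ?X" by (simp add: induced_subgraph_def)
  show ?thesis unfolding associated_eardrum_def component_verts_def V
  proof
    show "{C. \<exists>v\<in>?X. C = {u \<in> ?X. reachable ?H v u}} \<subseteq> ear_inn Ps ` {i. clean_ear Ps T i}"
      using comp by blast
    show "ear_inn Ps ` {i. clean_ear Ps T i} \<subseteq> {C. \<exists>v\<in>?X. C = {u \<in> ?X. reachable ?H v u}}"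
    proof
      fix C assume "C \<in> ear_inn Ps ` {i. clean_ear Ps T i}"
      then obtain i where i: "clean_ear Ps T i" "C = ear_inn Ps i" by blast
      obtain j where j: "j < k" "nt ! j = i" using nt_ex clean_nontrivial i(1) by blast
      obtain v where v: "v \<in> ear_inn Ps i" using inn_nonempty j by blast
      then have "C = {u \<in> ?X. reachable ?H v u}" using comp[OF i(1) v] i(2) by simp
      moreover have "v \<in> ?X" using v i(1) by blast
      ultimately show "C \<in> {C. \<exists>v\<in>?X. C = {u \<in> ?X. reachable ?H v u}}" by blast
    qed
  qed
qed

lemma card_eardrum: "card (associated_eardrum G T Ps) = card {j. j < k \<and> clean j}"
proof -
  have "inj_on (ear_inn Ps) {i. clean_ear Ps T i}"
    using inn_inj by (rule inj_on_subset) (use clean_nontrivial in auto)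
  then have "card (associated_eardrum G T Ps) = card {i. clean_ear Ps T i}"
    unfolding eardrum_eq by (rule card_image)
  also have "\<dots> = card {j. j < k \<and> clean_ear Ps T (nt ! j)}" by (rule card_nt) (rule clean_nontrivial)
  also have "{j. j < k \<and> clean_ear Ps T (nt ! j)} = {j. j < k \<and> clean j}" using clean_eq by auto
  finally show ?thesis .
qed

lemma pendant_count: "num_pendant_ears Ps = card {j. j < k \<and> pendant j}"
proof -
  have "{i \<in> ear_idx Ps. pendant_ear Ps i} = {i. pendant_ear Ps i}"
    by (auto simp: pendant_ear_def nontrivial_ear_def)
  moreover have "card {i. pendant_ear Ps i} = card {j. j < k \<and> pendant_ear Ps (nt ! j)}"
    by (rule card_nt) (simp add: pendant_ear_def)
  moreover have "{j. j < k \<and> pendant_ear Ps (nt ! j)} = {j. j < k \<and> pendant j}" using pendant_eq by auto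
  ultimately show ?thesis by (simp add: num_pendant_ears_def)
qed

text \<open>Condition (i) of niceness. Trivial ears have the odd length 1, so every even ear is
  listed in the array.\<close>

lemma phi_eq: "phi G = card {j. j < k \<and> even (len j)}"
proof -
  have "phi G = num_even_ears Ps" using nice by (simp add: nice_ear_decomposition_def)
  also have "\<dots> = card {i. i \<in> ear_idx Ps \<and> even (ear_length Ps i)}" by (simp add: num_even_ears_def)
  also have "\<dots> = card {j. j < k \<and> nt ! j \<in> ear_idx Ps \<and> even (ear_length Ps (nt ! j))}"
  proof (rule card_nt)
    fix i assume i: "i \<in> ear_idx Ps \<and> even (ear_length Ps i)"
    then have "1 \<le> ear_length Ps i" "ear_length Ps i \<noteq> 1" using ear_length_pos by auto
    then show "nontrivial_ear Ps i" using i by (simp add: nontrivial_ear_def)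
  qed
  also have "{j. j < k \<and> nt ! j \<in> ear_idx Ps \<and> even (ear_length Ps (nt ! j))} = {j. j < k \<and> even (len j)}"
    using len_eq nt_idx by auto
  finally show ?thesis .
qed

text \<open>The members of the earmuff have to be matched with blocks of the array. The point is
  that \<open>P f\<close> is the very clean ear with interior \<open>f\<close>, and not another ear
  running through \<open>f\<close>.\<close>

lemma obtain_muff:
  assumes "contains_max_earmuff G (associated_eardrum G T Ps) Ps"
  obtains muff where "\<forall>j\<in>muff. j < k \<and> clean j" "indep w (\<Union>j\<in>muff. E j)"
    "card muff = mu G (associated_eardrum G T Ps)"
proof -
  let ?M = "associated_eardrum G T Ps"
  obtain F P where F: "earmuff G ?M F P" "card F = mu G ?M" "\<And>f. f \<in> F \<Longrightarrow> \<exists>i\<in>ear_idx Ps. P f = Ps ! i"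
    using assms unfolding contains_max_earmuff_def by blast
  define muff where "muff = {j. j < k \<and> clean j \<and> ear_inn Ps (nt ! j) \<in> F}"
  have FM: "F \<subseteq> ?M" and paths: "\<And>f. f \<in> F \<Longrightarrow> P f \<in> paths_with_inn G f"
    and forest: "forest (spanning_subgraph G (\<Union>f\<in>F. edges (P f)))"
    using F(1) by (auto simp: earmuff_def)
  have P: "P (ear_inn Ps (nt ! j)) = Ps ! (nt ! j)" if j: "j \<in> muff" for j
  proof -
    let ?f = "ear_inn Ps (nt ! j)"
    have jk: "j < k" and f: "?f \<in> F" and pend: "pendant_ear Ps (nt ! j)"
      using j clean_pendant clean_eq by (auto simp: muff_def)
    obtain i where i: "i \<in> ear_idx Ps" "P ?f = Ps ! i" using F(3)[OF f] by blast
    obtain a b where ab: "path_between (P ?f) a b" "verts (P ?f) - {a, b} = ?f" "a \<noteq> b"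
      using paths[OF f] by (auto simp: paths_with_inn_def)
    obtain v where v: "v \<in> ?f" using inn_nonempty[OF jk] by blast
    have "i = nt ! j"
    \<comment> \<open>Otherwise a vertex of \<open>f\<close>, being internal to no second ear, is an
      endpoint of ear \<open>i\<close>. As it is an inner vertex of the path \<open>P f\<close>,
      that ear has length at least 2 and is attached to a pendant ear.\<close>
    proof (rule ccontr)
      assume "i \<noteq> nt ! j"
      then have "v \<notin> ear_inn Ps i" using inn_disjoint v by blast
      moreover have "v \<in> verts (Ps ! i)" using v ab(2) i(2) by auto
      ultimately have "v \<in> ear_endpoints Ps i" by (auto simp: ear_endpoints_def ear_inn_def)
      then have att: "attached Ps i (nt ! j)" using v by (auto simp: attached_def)
      obtain vs es where t: "traversal (Ps ! i) vs es" "distinct vs" "hd vs = a" "last vs = b"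
        using ab(1) i(2) by (auto simp: path_between_def)
      have "v \<in> set vs" "v \<noteq> a" "v \<noteq> b" using v ab(2) t(1) i(2) by (auto simp: traversal_def)
      then have "length vs > 2" using t(3,4)
        by (cases vs; cases "tl vs"; cases "tl (tl vs)") auto
      then have "nontrivial_ear Ps i" using traversal_length(2)[OF t(1)] i(1)
        by (simp add: nontrivial_ear_def ear_length_def)
      then show False using att pend by (auto simp: pendant_ear_def)
    qed
    then show ?thesis using i(2) by simp
  qed
  show ?thesis
  proof (rule that)
    show "\<forall>j\<in>muff. j < k \<and> clean j" by (simp add: muff_def)
    show "indep w (\<Union>j\<in>muff. E j)"
    proof (rule forest_indep[OF forest])
      have "edges (P f) \<subseteq> edges G" if "f \<in> F" for f
        using paths[OF that] by (auto simp: paths_with_inn_def subgraph_def)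
      then show "(\<Union>f\<in>F. edges (P f)) \<subseteq> edges G" by blast
      show "(\<Union>j\<in>muff. E j) \<subseteq> EE" using E_EE by (auto simp: muff_def)
      show "edge_at ` (\<Union>j\<in>muff. E j) \<subseteq> (\<Union>f\<in>F. edges (P f))"
      proof
        fix e assume "e \<in> edge_at ` (\<Union>j\<in>muff. E j)"
        then obtain j p where j: "j \<in> muff" "p \<in> E j" "e = edge_at p" by blast
        then have "j < k" by (simp add: muff_def)
        then have "e \<in> edges (Ps ! (nt ! j))" using edge_at_bij(1) j bij_betwE unfolding E_eq by blast
        then have "e \<in> edges (P (ear_inn Ps (nt ! j)))" using P[OF j(1)] by simp
        then show "e \<in> (\<Union>f\<in>F. edges (P f))" using j(1) by (auto simp: muff_def)
      qed
    qed
    have "bij_betw (\<lambda>j. ear_inn Ps (nt ! j)) muff F"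
      unfolding bij_betw_def
    proof
      show "inj_on (\<lambda>j. ear_inn Ps (nt ! j)) muff"
      proof (rule inj_onI)
        fix i j assume ij: "i \<in> muff" "j \<in> muff" "ear_inn Ps (nt ! i) = ear_inn Ps (nt ! j)"
        then have "i < k" "j < k" by (auto simp: muff_def)
        then have "nt ! i = nt ! j" using inj_onD[OF inn_inj ij(3)] nt by blast
        then show "i = j" using nt_inj \<open>i < k\<close> \<open>j < k\<close> by blast
      qed
      show "(\<lambda>j. ear_inn Ps (nt ! j)) ` muff = F"
      proof
        show "F \<subseteq> (\<lambda>j. ear_inn Ps (nt ! j)) ` muff"
        proof
          fix f assume f: "f \<in> F"
          then obtain i where i: "clean_ear Ps T i" "f = ear_inn Ps i" using FM eardrum_eq by blast
          then obtain j where j: "j < k" "nt ! j = i" using nt_ex clean_nontrivial by blast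
          then have "j \<in> muff" using i f clean_eq[OF j(1)] by (simp add: muff_def)
          then show "f \<in> (\<lambda>j. ear_inn Ps (nt ! j)) ` muff" using i j by blast
        qed
      qed (auto simp: muff_def)
    qed
    then show "card muff = mu G ?M" using bij_betw_same_card F(2) by metis
  qed
qed

lemma sum_card:
  assumes "\<forall>p\<in>EE. y p \<le> 1"
  shows "(\<Sum>p\<in>EE. y p) = card (bset y)"
proof -
  have "(\<Sum>p\<in>EE. y p) = (\<Sum>p\<in>EE. if y p = 1 then 1 else 0)"
    using assms by (intro sum.cong) (auto simp: le_Suc_eq)
  then show ?thesis by (simp add: sum.If_cases bset_def Int_def)
qed

lemma dg_card:
  assumes "\<forall>p\<in>EE. y p \<le> 1" "v \<in> verts G"
  shows "dg y (\<alpha> v) = card {p \<in> bset y. v \<in> ends G (edge_at p)}"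
proof -
  have i: "inc p (\<alpha> v) = (if v \<in> ends G (edge_at p) then 1 else 0)" if p: "p \<in> EE" for p
  proof -
    obtain a b where ab: "a \<in> verts G" "b \<in> verts G" "\<alpha> a = w p" "\<alpha> b = w (Suc p)" "ends G (edge_at p) = {a, b}"
      using edge_at_ends[OF p] by metis
    show ?thesis using \<alpha>_inj[OF ab(1) assms(2)] \<alpha>_inj[OF ab(2) assms(2)] unfolding inc_def ab(5) ab(3,4)[symmetric] by auto
  qed
  have "dg y (\<alpha> v) = (\<Sum>p\<in>EE. if y p = 1 \<and> v \<in> ends G (edge_at p) then 1 else 0)"
    unfolding dg_def
  proof (rule sum.cong)
    fix p assume p: "p \<in> EE"
    then have "y p = 0 \<or> y p = 1" using assms(1) by (auto simp: le_Suc_eq)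
    then show "y p * inc p (\<alpha> v) = (if y p = 1 \<and> v \<in> ends G (edge_at p) then 1 else 0)" using i[OF p] by auto
  qed simp
  also have "\<dots> = card {p \<in> bset y. v \<in> ends G (edge_at p)}"
    by (simp add: sum.If_cases bset_def Int_def)
  finally show ?thesis .
qed

text \<open>The Boolean tells the two copies apart, so sizes and degrees simply add up. Connectivity
  is already provided by the copies from \<open>bset b\<close>.\<close>

lemma join_from_outcome:
  assumes bx: "\<forall>p\<in>EE. b p \<le> 1 \<and> x p \<le> 1" and off: "\<forall>p<st k. p \<notin> EE \<longrightarrow> b p = 0 \<and> x p = 0"
    and par: "\<forall>v<n. even (\<tau> v + dg b v + dg x v)" and con: "\<forall>u<n. \<forall>v<n. conn w (bset b) u v"
  defines "F \<equiv> set (out_list edge_at b x (st k))"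
  shows "connected_T_join G T F" "card F = (\<Sum>p\<in>EE. b p + x p)" "distinct (out_list edge_at b x (st k))"
proof -
  have sets: "{p. p < st k \<and> b p = 1} = bset b" "{p. p < st k \<and> x p = 1} = bset x"
    using off EE_less by (auto simp: bset_def)
  have F: "F = (\<lambda>p. (edge_at p, False)) ` bset b \<union> (\<lambda>p. (edge_at p, True)) ` bset x"
    unfolding F_def set_out_list sets ..
  have fin [simp]: "finite (bset y)" for y by (simp add: bset_def)
  have inj: "inj_on (\<lambda>p. (edge_at p, c)) S" if "S \<subseteq> EE" for c :: bool and S
    using inj_on_subset[OF edge_at_inj that] by (auto simp: inj_on_def)
  have bE: "bset y \<subseteq> EE" for y by (auto simp: bset_def)
  have cardF: "card ((\<lambda>p. (edge_at p, False)) ` S \<union> (\<lambda>p. (edge_at p, True)) ` S') = card S + card S'"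
    if "S \<subseteq> EE" "S' \<subseteq> EE" for S S'
    using that by (subst card_Un_disjoint) (auto intro: finite_subset[OF _ finite_EE] simp: card_image inj)
  show "card F = (\<Sum>p\<in>EE. b p + x p)"
    using cardF[OF bE bE] sum_card[of b] sum_card[of x] bx by (simp add: F sum.distrib)
  have "{p. p < st k \<and> (b p = 1 \<or> x p = 1)} \<subseteq> EE" using off by auto
  then show "distinct (out_list edge_at b x (st k))"
    by (intro distinct_out_list inj_on_subset[OF edge_at_inj])
  have deg: "degree (double_graph G) F v = dg b (\<alpha> v) + dg x (\<alpha> v)" if v: "v \<in> verts G" for v
  proof -
    have "{f \<in> F. v \<in> ends (double_graph G) f} =
      (\<lambda>p. (edge_at p, False)) ` {p \<in> bset b. v \<in> ends G (edge_at p)} \<union> (\<lambda>p. (edge_at p, True)) ` {p \<in> bset x. v \<in> ends G (edge_at p)}"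
      by (auto simp: F double_graph_def)
    moreover have "{p \<in> bset y. v \<in> ends G (edge_at p)} \<subseteq> EE" for y using bE by blast
    ultimately show ?thesis using dg_card[of b v] dg_card[of x v] bx v cardF by (simp add: degree_def)
  qed
  have "T_join (double_graph G) T F"
    unfolding T_join_def
  proof
    show "F \<subseteq> edges (double_graph G)" using edge_at_edge bE by (fastforce simp: F double_graph_def)
    have "odd (degree (double_graph G) F v) \<longleftrightarrow> v \<in> T" if v: "v \<in> verts G" for v
    proof -
      have "even (\<tau> (\<alpha> v) + (dg b (\<alpha> v) + dg x (\<alpha> v)))" using par \<alpha>_less[OF v] by (simp add: add.assoc)
      then show ?thesis using T_enc[OF v] deg[OF v] by (simp split: if_splits)
    qed
    then show "{v \<in> verts (double_graph G). odd (degree (double_graph G) F v)} = T"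
      using T(1) by (auto simp: double_graph_def)
  qed
  moreover have "connected_graph (spanning_subgraph (double_graph G) F)"
    unfolding connected_graph_def
  proof
    show "verts (spanning_subgraph (double_graph G) F) \<noteq> {}"
      using root_in by (auto simp: spanning_subgraph_def double_graph_def)
    have "reachable (spanning_subgraph (double_graph G) F) u v" if uv: "u \<in> verts G" "v \<in> verts G" for u v
    proof -
      have "conn w (bset b) (\<alpha> u) (\<alpha> v)" using con \<alpha>_less uv by blast
      then obtain v' where v': "v' \<in> verts G" "\<alpha> v' = \<alpha> v" "reachable (spanning_subgraph G (edge_at ` bset b)) u v'"
        using conn_reachable[OF _ bE uv(1) refl] by blast
      then have "v' = v" using \<alpha>_inj[OF v'(1) uv(2)] by simp
      then have "(u, v) \<in> {(x, y). \<exists>e\<in>edge_at ` bset b. ends G e = {x, y}}\<^sup>*"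
        using v'(3) by (simp add: reachable_def spanning_subgraph_def)
      moreover have "{(x, y). \<exists>e\<in>edge_at ` bset b. ends G e = {x, y}} \<subseteq> {(x, y). \<exists>e\<in>F. ends G (fst e) = {x, y}}"
        unfolding F by force
      ultimately have "(u, v) \<in> {(x, y). \<exists>e\<in>F. ends G (fst e) = {x, y}}\<^sup>*"
        using rtrancl_mono by blast
      then show ?thesis by (simp add: reachable_def spanning_subgraph_def double_graph_def)
    qed
    then show "\<forall>u\<in>verts (spanning_subgraph (double_graph G) F). \<forall>v\<in>verts (spanning_subgraph (double_graph G) F).
      reachable (spanning_subgraph (double_graph G) F) u v"
      by (simp add: spanning_subgraph_def double_graph_def)
  qed
  ultimately show "connected_T_join G T F" by (simp add: connected_T_join_def)
qed

lemma run_program: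
  assumes max: "contains_max_earmuff G (associated_eardrum G T Ps) Ps"
  shows "\<exists>t s' F. runs program s t s' \<and> t \<le> 300 * card (verts G) ^ 3 \<and> encodes_output s' \<beta> F \<and>
        connected_T_join G T F \<and>
        real (card F) \<le> L_mu G (associated_eardrum G T Ps) + 1 / 2 * L_phi G
                         - real (num_pendant_ears Ps)"
proof -
  let ?M = "associated_eardrum G T Ps"
  obtain muff where muff: "\<forall>j\<in>muff. j < k \<and> clean j" "indep w (\<Union>j\<in>muff. E j)"
    "card muff = mu G ?M" by (rule obtain_muff[OF max])
  interpret muff_list n k r st w \<tau> muff by unfold_locales (use muff in auto)
  let ?Q = "\<lambda>s'. \<exists>F. encodes_output s' \<beta> F \<and> connected_T_join G T F \<and>
        real (card F) \<le> L_mu G ?M + 1 / 2 * L_phi G - real (num_pendant_ears Ps)"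
  have "wpt program (300 * n ^ 3) ?Q s"
  proof (rule wpt_program)
    show "stat s" unfolding stat_def using regs by (simp add: st_def w_def)
    show "st 0 = 0" by (rule st_0)
    show "arr s 2 v = \<tau> v" for v by (simp add: \<tau>_def)
    fix s' :: memory and b x fs
    assume out: "outcome b x" and fs: "fs = out_list (arr s 5) b x (st k)" and len_fs: "reg s' 0 = length fs"
      and arrs: "stored s' fs"
    note out' = out[unfolded outcome_def]
    define fs' where "fs' = out_list edge_at b x (st k)"
    have fs': "fs' = map (\<lambda>(e, c). (inv_into (edges G) \<beta> e, c)) fs"
      unfolding fs fs'_def map_out_list edge_at_def ..
    have join: "connected_T_join G T (set fs')" "card (set fs') = (\<Sum>p\<in>EE. b p + x p)" "distinct fs'"
      unfolding fs'_def by (rule join_from_outcome; use out' in blast)+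
    \<comment> \<open>The inverse of \<open>\<beta>\<close> is meaningful only on numbers of edges;
      every listed entry comes from a position in \<open>EE\<close>, where array 5 holds such a
      number.\<close>
    have \<beta>_inv: "\<beta> (inv_into (edges G) \<beta> (fst f)) = fst f" if "f \<in> set fs" for f
    proof -
      have "f \<in> (\<lambda>p. (arr s 5 p, False)) ` {p. p < st k \<and> b p = 1} \<union> (\<lambda>p. (arr s 5 p, True)) ` {p. p < st k \<and> x p = 1}"
        using that unfolding fs set_out_list .
      then obtain p where p: "p < st k" "b p = 1 \<or> x p = 1" "fst f = arr s 5 p" by auto
      then have "p \<in> EE" using out' by force
      then have "fst f = \<beta> (edge_at p)" "edge_at p \<in> edges G" using edge_at_edge p(3) by auto
      then show ?thesis by (simp add: f_inv_into_f)
    qed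
    have "encodes_output s' \<beta> (set fs')"
      unfolding encodes_output_def
    proof (intro exI[of _ fs'] conjI allI impI)
      show "distinct fs'" by (rule join(3))
      show "reg s' 0 = length fs'" using len_fs by (simp add: fs')
      fix i assume "i < length fs'"
      then have i: "i < length fs" by (simp add: fs')
      then have "fs' ! i = (inv_into (edges G) \<beta> (fst (fs ! i)), snd (fs ! i))"
        by (simp add: fs' case_prod_beta)
      then show "arr s' 0 i = \<beta> (fst (fs' ! i))" "arr s' 1 i = (if snd (fs' ! i) then 1 else 0)"
        using arrs i \<beta>_inv[of "fs ! i"] by simp_all
    qed simp
    moreover have "real (card (set fs')) \<le> L_mu G ?M + 1 / 2 * L_phi G - real (num_pendant_ears Ps)"
    proof -
      have "(\<Sum>j<k. 2 * (len j div 2)) = (\<Sum>j<k. (len j - 1) + (if even (len j) then 1 else 0))"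
      proof (rule sum.cong)
        fix j assume "j \<in> {..<k}"
        then have "2 \<le> len j" using len_ge by simp
        then show "2 * (len j div 2) = (len j - 1) + (if even (len j) then 1 else 0)" by (auto elim!: oddE)
      qed simp
      also have "\<dots> = (n - 1) + phi G"
        unfolding phi_eq using n_eq by (simp add: sum.distrib sum.If_cases Int_def)
      finally have half: "2 * (\<Sum>j<k. len j div 2) = (n - 1) + phi G" by (simp add: sum_distrib_left)
      \<comment> \<open>With \<open>m\<close> the number of vertices and \<open>g\<close> the value
        of \<open>phi\<close>, \<open>f\<close> is half of \<open>L_phi\<close> and
        \<open>d + e - b\<close> is \<open>L_mu\<close>.\<close>
      have arith: "a \<le> m - 1 + e - b + 1 / 2 * (m + g - 1) - c"
        if "a + b + c \<le> d + e + f" "d = m - 1" "2 * f = d + g" for a b c d e f g m :: real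
        using that by (simp add: field_simps)
      have "card (set fs') + mu G ?M + num_pendant_ears Ps \<le> (n - 1) + card ?M + (\<Sum>j<k. len j div 2)"
        using out' join(2) muff(3) pendant_count card_eardrum by simp
      then have "real (card (set fs')) + real (mu G ?M) + real (num_pendant_ears Ps) \<le>
        real (n - 1) + real (card ?M) + real (\<Sum>j<k. len j div 2)" by linarith
      moreover have "real (n - 1) = real n - 1" using n_pos by (simp add: of_nat_diff)
      moreover have "2 * real (\<Sum>j<k. len j div 2) = real (n - 1) + real (phi G)"
        using half by linarith
      ultimately show ?thesis unfolding L_mu_def L_phi_def n_def[symmetric] by (rule arith)
    qed
    ultimately show "?Q s'" using join(1) by blast
  qed
  then show ?thesis unfolding wpt_def n_def by blast
qed

end

theorem theorem22:
  "\<exists>(c::com) (K::nat). \<forall>(G :: ('v, 'e) mgraph) (T :: 'v set) Ps \<alpha> \<beta> s.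
     fin_mgraph G \<and> T \<subseteq> verts G \<and> even (card T) \<and>
     nice_ear_decomposition G Ps \<and>
     contains_max_earmuff G (associated_eardrum G T Ps) Ps \<and>
     encodes_input s \<alpha> \<beta> G T Ps \<longrightarrow>
     (\<exists>t s' F.
        runs c s t s' \<and> t \<le> K * card (verts G) ^ 3 \<and>
        encodes_output s' \<beta> F \<and>
        connected_T_join G T F \<and>
        real (card F) \<le> L_mu G (associated_eardrum G T Ps) + 1 / 2 * L_phi G
                         - real (num_pendant_ears Ps))"
proof (rule exI[of _ program], rule exI[of _ 300], intro allI impI)
  fix G :: "('v, 'e) mgraph" and T Ps \<alpha> \<beta> s
  assume *: "fin_mgraph G \<and> T \<subseteq> verts G \<and> even (card T) \<and> nice_ear_decomposition G Ps \<and>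
     contains_max_earmuff G (associated_eardrum G T Ps) Ps \<and> encodes_input s \<alpha> \<beta> G T Ps"
  interpret encoded G Ps T \<alpha> \<beta> s
    by unfold_locales (use * in \<open>simp_all add: nice_ear_decomposition_def\<close>)
  show "\<exists>t s' F. runs program s t s' \<and> t \<le> 300 * card (verts G) ^ 3 \<and> encodes_output s' \<beta> F \<and>
      connected_T_join G T F \<and>
      real (card F) \<le> L_mu G (associated_eardrum G T Ps) + 1 / 2 * L_phi G - real (num_pendant_ears Ps)"
    using run_program * by blast
qed

end
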